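(* Let $n\ge2$ and let $\Gamma$ be a planar $n$-web obtained from a framed oriented link diagram by resolving all crossings, where resolving a crossing means replacing it either by its orientation-respecting smoothing or by the sink–source configuration $X_n$. Then $\sum_v l(P(S,v))$ (sum over all vertices $v$ of $\Gamma$) is even for every state $S$ of $\Gamma$. Consequently, all coefficients of $\langle\Gamma\rangle_n\in\mathbb{Z}[q^{\pm1}]$ are non-negative.
   Context: An $n$-web is an oriented surface embedded in $\mathbb{R}^3$ composed of finitely many directed annuli, directed bands and discs. A band is an embedded square $[0,1]\times[0,1]$ directed from its source $[0,1]\times\{0\}$ to its target $[0,1]\times\{1\}$. The annuli, discs and interiors of bands are disjoint; sources and targets of bands are pairwise disjoint and lie in boundaries of discs; the boundary of each disc contains either exactly $n$ sources and no targets of bands (the disc is a source of the web) or exactly $n$ targets and no sources (a sink); each disc has a marked boundary point outside the bands. An $n$-web diagram is an orientation-preserving projection to $\mathbb{R}^2$ which is an embedding except for finitely many transverse crossings (with over/under information) away from the discs. A planar $n$-web is an $n$-web diagram without crossings. The bands at a disc $v$ are ordered $1,\dots,n$ starting at the marked point, clockwise if $v$ is a sink and counter-clockwise if $v$ is a source. The configuration $X_n$: draw the crossing with both incoming strands arriving from the top and both outgoing strands leaving at the bottom, and replace it by one sink and one source such that the incoming strands (left to right) are the first and second band at the sink, the outgoing strands (left to right) are the first and second band at the source, and for $3\le i\le n$ the $i$-th band at the source is the $i$-th band at the sink, these $n-2$ bands being parallel, directed from source to sink, without crossings. (The bracket of a diagram with a crossing is a linear combination of the brackets of the diagrams with the crossing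 replaced by its oriented smoothing and by $X_n$; $\Gamma$ is one of the leaves of the resulting skein tree of a link.) A state $S$ of a planar $n$-web is a labeling of its annuli and bands $e$ by numbers $S(e)\in\{1,\dots,n\}$ such that the bands attached to each disc have different labels (no restriction for annuli); $P(S,v)\in S_n$ is the permutation with $P(S,v)(i)$ equal to the label of the $i$-th band at $v$. For $\sigma\in S_n$, $l(\sigma)=\#\{i<j:\sigma(i)>\sigma(j)\}$ and $b_\sigma$ is the positive braid with $l(\sigma)$ crossings on $n$ downward strands representing $\sigma$. $[n]=\frac{q^n-q^{-n}}{q-q^{-1}}$. $\langle\cdot\rangle_n\in\mathbb{Z}[q^{\pm1/n}]$ is the unique isotopy invariant of $n$-webs such that: (1) $q^{1/n}\langle\Gamma_+\rangle_n-q^{-1/n}\langle\Gamma_-\rangle_n=(q-q^{-1})\langle\Gamma_0\rangle_n$ for diagrams differing only by a positive crossing, negative crossing, oriented smoothing; (2) adding a small curl with a positive (negative) crossing multiplies the bracket by $q^{n-1/n}$ (by $q^{1/n-n}$); (3) if in some disc $\Gamma$ consists of $n$ parallel downward strands running from the top into a sink with marked point at its bottom, and below it a source with marked point at its top with $n$ parallel downward strands running to the bottom, then $\langle\Gamma\rangle_n=q^{n(n-1)}\sum_{\sigma\in S_n}(-q^{(1-n)/n})^{l(\sigma)}\langle\Gamma_\sigma\rangle_n$, where $\Gamma_\sigma$ has the disc content replaced by $b_\sigma$; (4) adding an unlinked trivial framed knot multiplies the bracket by $[n]$; (5) $\langle\emptyset\rangle_n=1$. *)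

theory Defs
  imports
    Complex_Main
    "HOL-Library.Poly_Mapping"
    "HOL-Combinatorics.Permutations"
begin

text \<open>
  Diagrams of webs are given in Morse position: a diagram in the plane, generic with respect to the
  height function, is cut by horizontal lines into slices that contain one elementary piece each.
  Every diagram is planar isotopic to one of this form. The word at a horizontal
  line lists, from left to right, the directions of the strands that meet the line.
\<close>

datatype dir = Dn | Up

fun opp :: "dir \<Rightarrow> dir" where
  "opp Dn = Up"
| "opp Up = Dn"

text \<open>
  \<^item> \<open>Cap d\<close> is a local maximum and \<open>Cup d\<close> a local minimum of a strand; \<open>d\<close> is the direction of the
    left leg.
  \<^item> \<open>PosX\<close> and \<open>NegX\<close> are the positive and the negative crossing of two downward strands.
    At \<open>PosX\<close> the strand from top right to bottom left is the over-strand. Crossings in other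
    directions are obtained by rotation, with the help of caps and cups.
  \<^item> \<open>Sink\<close> is a disc with \<open>n\<close> bands arriving from the top and the marked point at its
    bottom, \<open>Source\<close> a disc with \<open>n\<close> bands leaving at the bottom and the marked point at its top.
    The clockwise order from the marked point of the sink and the counter-clockwise order from the
    marked point of the source are then both the order from left to right. Other positions
    of the disc are obtained by rotation, with the help of caps and cups.
\<close>

datatype piece = Cap dir | Cup dir | PosX | NegX | Sink | Source

fun piece_dom :: "nat \<Rightarrow> piece \<Rightarrow> dir list" where
  "piece_dom n (Cap d) = []"
| "piece_dom n (Cup d) = [d, opp d]"
| "piece_dom n PosX = [Dn, Dn]"
| "piece_dom n NegX = [Dn, Dn]"
| "piece_dom n Sink = replicate n Dn"
| "piece_dom n Source = []"

fun piece_cod :: "nat \<Rightarrow> piece \<Rightarrow> dir list" where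
  "piece_cod n (Cap d) = [d, opp d]"
| "piece_cod n (Cup d) = []"
| "piece_cod n PosX = [Dn, Dn]"
| "piece_cod n NegX = [Dn, Dn]"
| "piece_cod n Sink = []"
| "piece_cod n Source = replicate n Dn"

text \<open>
  In the slice \<open>(k, g)\<close> there are \<open>k\<close> vertical strands to the left of the piece \<open>g\<close>. A diagram is the
  list of its slices from top to bottom.
\<close>

type_synonym slice = "nat \<times> piece"
type_synonym diagram = "slice list"

fun slice_ok :: "nat \<Rightarrow> dir list \<Rightarrow> slice \<Rightarrow> bool" where
  "slice_ok n w (k, g) \<longleftrightarrow>
     k \<le> length w \<and> take (length (piece_dom n g)) (drop k w) = piece_dom n g"

fun slice_out :: "nat \<Rightarrow> dir list \<Rightarrow> slice \<Rightarrow> dir list" where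
  "slice_out n w (k, g) = take k w @ piece_cod n g @ drop (k + length (piece_dom n g)) w"

fun tangle :: "nat \<Rightarrow> dir list \<Rightarrow> diagram \<Rightarrow> dir list \<Rightarrow> bool" where
  "tangle n w [] w' \<longleftrightarrow> w = w'"
| "tangle n w (s # D) w' \<longleftrightarrow> slice_ok n w s \<and> tangle n (slice_out n w s) D w'"

definition web_diagram :: "nat \<Rightarrow> diagram \<Rightarrow> bool" where
  "web_diagram n D \<longleftrightarrow> tangle n [] D []"

definition planar_web :: "nat \<Rightarrow> diagram \<Rightarrow> bool" where
  "planar_web n D \<longleftrightarrow> web_diagram n D \<and> (\<forall>(k, g)\<in>set D. g \<noteq> PosX \<and> g \<noteq> NegX)"

text \<open>The framing of a link diagram is the blackboard framing.\<close>

definition link_diagram :: "nat \<Rightarrow> diagram \<Rightarrow> bool" where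
  "link_diagram n D \<longleftrightarrow> web_diagram n D \<and> (\<forall>(k, g)\<in>set D. g \<noteq> Sink \<and> g \<noteq> Source)"

definition shift :: "nat \<Rightarrow> diagram \<Rightarrow> diagram" where
  "shift k D = map (\<lambda>(j, g). (k + j, g)) D"

text \<open>
  The \<open>n - 2\<close> parallel bands of \<open>X_n\<close> leave the source at the bottom as the bands \<open>3, \<dots>, n\<close>, turn
  upwards to the right of both discs, and enter the sink from the top as the bands \<open>3, \<dots>, n\<close>.
  The two discs are stacked, the sink on top, with facing marked points.
  Turning the sink clockwise and the source counter-clockwise, so that the marked points
  lie on the left, makes these bands straight.
\<close>

definition sink_source :: "nat \<Rightarrow> diagram" where
  "sink_source n =
     map (\<lambda>j. (j, Cap Dn)) [2..<n] @ [(0, Sink), (0, Source)] @ map (\<lambda>j. (j, Cup Dn)) (rev [2..<n])"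

inductive resolution :: "nat \<Rightarrow> diagram \<Rightarrow> diagram \<Rightarrow> bool" for n :: nat where
  Nil: "resolution n [] []"
| keep: "resolution n D G \<Longrightarrow> g \<noteq> PosX \<Longrightarrow> g \<noteq> NegX \<Longrightarrow> resolution n ((k, g) # D) ((k, g) # G)"
| smooth: "resolution n D G \<Longrightarrow> g = PosX \<or> g = NegX \<Longrightarrow> resolution n ((k, g) # D) G"
| vertices: "resolution n D G \<Longrightarrow> g = PosX \<or> g = NegX \<Longrightarrow>
    resolution n ((k, g) # D) (shift k (sink_source n) @ G)"

text \<open>
  The word at the \<open>i\<close>-th horizontal line, the one directly above the slice \<open>D ! i\<close>. The point
  \<open>(i, j)\<close> is the one where the \<open>j\<close>-th strand (counted from 0) meets this line.
\<close>

definition level :: "nat \<Rightarrow> diagram \<Rightarrow> nat \<Rightarrow> dir list" where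
  "level n D i = fold (\<lambda>s w. slice_out n w s) (take i D) []"

definition points :: "nat \<Rightarrow> diagram \<Rightarrow> (nat \<times> nat) set" where
  "points n D = {(i, j). i \<le> length D \<and> j < length (level n D i)}"

text \<open>Two points are joined if a strand within a single slice connects them.\<close>

fun slice_joins :: "nat \<Rightarrow> nat \<Rightarrow> nat \<Rightarrow> slice \<Rightarrow> ((nat \<times> nat) \<times> (nat \<times> nat)) set" where
  "slice_joins n w i (k, g) =
     {((i, j), (Suc i, j)) | j. j < k} \<union>
     {((i, k + length (piece_dom n g) + j), (Suc i, k + length (piece_cod n g) + j)) | j.
        k + length (piece_dom n g) + j < w} \<union>
     (case g of
        Cap d \<Rightarrow> {((Suc i, k), (Suc i, Suc k))}
      | Cup d \<Rightarrow> {((i, k), (i, Suc k))}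
      | PosX \<Rightarrow> {((i, k), (Suc i, Suc k)), ((i, Suc k), (Suc i, k))}
      | NegX \<Rightarrow> {((i, k), (Suc i, Suc k)), ((i, Suc k), (Suc i, k))}
      | Sink \<Rightarrow> {}
      | Source \<Rightarrow> {})"

definition joined :: "nat \<Rightarrow> diagram \<Rightarrow> ((nat \<times> nat) \<times> (nat \<times> nat)) set" where
  "joined n D = (\<Union>i<length D. slice_joins n (length (level n D i)) i (D ! i))"

definition edge_of :: "nat \<Rightarrow> diagram \<Rightarrow> nat \<times> nat \<Rightarrow> (nat \<times> nat) set" where
  "edge_of n D p = (joined n D \<union> (joined n D)\<inverse>)\<^sup>* `` {p}"

text \<open>The bands and annuli of a diagram, as sets of points.\<close>

definition edges :: "nat \<Rightarrow> diagram \<Rightarrow> (nat \<times> nat) set set" where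
  "edges n D = edge_of n D ` points n D"

text \<open>The discs, each represented by the index of its slice.\<close>

definition vertices :: "diagram \<Rightarrow> nat set" where
  "vertices D = {v. v < length D \<and> (snd (D ! v) = Sink \<or> snd (D ! v) = Source)}"

definition band_end :: "diagram \<Rightarrow> nat \<Rightarrow> nat \<Rightarrow> nat \<times> nat" where
  "band_end D v i = (if snd (D ! v) = Sink then v else Suc v, fst (D ! v) + (i - 1))"

definition band :: "nat \<Rightarrow> diagram \<Rightarrow> nat \<Rightarrow> nat \<Rightarrow> (nat \<times> nat) set" where
  "band n D v i = edge_of n D (band_end D v i)"

definition state :: "nat \<Rightarrow> diagram \<Rightarrow> ((nat \<times> nat) set \<Rightarrow> nat) \<Rightarrow> bool" where
  "state n D S \<longleftrightarrow>
     (\<forall>e\<in>edges n D. S e \<in> {1..n}) \<and>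
     (\<forall>v\<in>vertices D. inj_on (\<lambda>i. S (band n D v i)) {1..n})"

definition vertex_perm :: "nat \<Rightarrow> diagram \<Rightarrow> ((nat \<times> nat) set \<Rightarrow> nat) \<Rightarrow> nat \<Rightarrow> nat \<Rightarrow> nat" where
  "vertex_perm n D S v i = (if i \<in> {1..n} then S (band n D v i) else i)"

definition inversions :: "nat \<Rightarrow> (nat \<Rightarrow> nat) \<Rightarrow> nat" where
  "inversions n \<sigma> = card {(i, j). 1 \<le> i \<and> i < j \<and> j \<le> n \<and> \<sigma> i > \<sigma> j}"

text \<open>
  The crossing \<open>g\<close> turned by a quarter turn, as a tangle from \<open>[Dn, Up]\<close> to \<open>[Up, Dn]\<close> and from
  \<open>[Up, Dn]\<close> to \<open>[Dn, Up]\<close>.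
\<close>

definition turn_left :: "piece \<Rightarrow> diagram" where
  "turn_left g = [(0, Cap Up), (1, g), (2, Cup Dn)]"

definition turn_right :: "piece \<Rightarrow> diagram" where
  "turn_right g = [(2, Cap Dn), (1, g), (0, Cup Up)]"

text \<open>Small curls with the crossing \<open>g\<close>, to the right and to the left of a downward strand.\<close>

definition curl_right :: "piece \<Rightarrow> diagram" where
  "curl_right g = [(1, Cap Dn), (0, g), (1, Cup Dn)]"

definition curl_left :: "piece \<Rightarrow> diagram" where
  "curl_left g = [(0, Cap Up), (1, g), (0, Cup Up)]"

text \<open>
  The local moves. The rules up to \<open>turn_source\<close> generate planar isotopy: height exchange of distant
  pieces, straightening of a strand, and full turns of a crossing, a sink and a source. The
  rules \<open>R1\<close> to \<open>R3\<close> are the framed Reidemeister moves; versions with other directions of the strands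
  follow. The last two rules move a strand over or under a disc.
\<close>

inductive local_move :: "nat \<Rightarrow> diagram \<Rightarrow> diagram \<Rightarrow> bool" for n :: nat where
  exchange: "local_move n
     [(j, g), (j + length (piece_cod n g) + m, h)]
     [(j + length (piece_dom n g) + m, h), (j, g)]"
| straighten_right: "local_move n [(1, Cap (opp d)), (0, Cup d)] []"
| straighten_left: "local_move n [(0, Cap d), (1, Cup (opp d))] []"
| turn_crossing: "g = PosX \<or> g = NegX \<Longrightarrow> local_move n
     [(2, Cap Dn), (3, Cap Dn), (2, g), (1, Cup Up), (0, Cup Up)]
     [(0, Cap Up), (1, Cap Up), (2, g), (3, Cup Dn), (2, Cup Dn)]"
| turn_sink: "local_move n
     (map (\<lambda>j. (j, Cap Up)) [0..<n] @ [(n, Sink)])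
     (map (\<lambda>j. (j, Cap Dn)) [0..<n] @ [(0, Sink)])"
| turn_source: "local_move n
     ([(n, Source)] @ map (\<lambda>j. (j, Cup Up)) (rev [0..<n]))
     ([(0, Source)] @ map (\<lambda>j. (j, Cup Dn)) (rev [0..<n]))"
| R1: "g = PosX \<or> g = NegX \<Longrightarrow> local_move n (curl_right g) (curl_left g)"
| R2: "(g, h) = (PosX, NegX) \<or> (g, h) = (NegX, PosX) \<Longrightarrow> local_move n [(0, g), (0, h)] []"
| R2_antiparallel: "(g, h) = (PosX, NegX) \<or> (g, h) = (NegX, PosX) \<Longrightarrow>
     local_move n (turn_left g @ turn_right h) []"
| R2_antiparallel': "(g, h) = (PosX, NegX) \<or> (g, h) = (NegX, PosX) \<Longrightarrow>
     local_move n (turn_right g @ turn_left h) []"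
| R3: "local_move n [(0, PosX), (1, PosX), (0, PosX)] [(1, PosX), (0, PosX), (1, PosX)]"
| slide_sink: "g = PosX \<or> g = NegX \<Longrightarrow> local_move n
     (map (\<lambda>i. (i, g)) [0..<n] @ [(0, Sink)]) [(1, Sink)]"
| slide_source: "g = PosX \<or> g = NegX \<Longrightarrow> local_move n
     ([(0, Source)] @ map (\<lambda>i. (i, g)) (rev [0..<n])) [(1, Source)]"

inductive move :: "nat \<Rightarrow> diagram \<Rightarrow> diagram \<Rightarrow> bool" for n :: nat where
  "local_move n L R \<Longrightarrow>
   web_diagram n (T @ shift k L @ U) \<Longrightarrow> web_diagram n (T @ shift k R @ U) \<Longrightarrow>
   move n (T @ shift k L @ U) (T @ shift k R @ U)"

definition isotopic :: "nat \<Rightarrow> diagram \<Rightarrow> diagram \<Rightarrow> bool" where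
  "isotopic n = equivclp (move n)"

text \<open>
  Laurent polynomials in \<open>q\<^bsup>1/n\<^esup>\<close> with integer coefficients; \<open>q_root_pow k\<close> is \<open>q\<^bsup>k/n\<^esup>\<close>, so that
  \<open>q\<close> itself is \<open>q_root_pow n\<close>.
\<close>

type_synonym laurent = "int \<Rightarrow>\<^sub>0 int"

definition q_root_pow :: "int \<Rightarrow> laurent" where
  "q_root_pow k = Poly_Mapping.single k 1"

text \<open>The quantum integer \<open>[n] = q\<^bsup>n-1\<^esup> + q\<^bsup>n-3\<^esup> + \<dots> + q\<^bsup>1-n\<^esup>\<close>.\<close>

definition quantum_int :: "nat \<Rightarrow> laurent" where
  "quantum_int n = (\<Sum>i<n. q_root_pow (int n * (int n - 1 - 2 * int i)))"

lemma q_root_pow_mult: "q_root_pow a * q_root_pow b = q_root_pow (a + b)"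
  by (simp add: q_root_pow_def mult_single)

lemma quantum_int_eq:
  "(q_root_pow (int n) - q_root_pow (- int n)) * quantum_int n =
     q_root_pow (int n * int n) - q_root_pow (- (int n * int n))"
proof -
  define f where "f i = q_root_pow (int n * (int n - 2 * int i))" for i
  have "(q_root_pow (int n) - q_root_pow (- int n)) *
      q_root_pow (int n * (int n - 1 - 2 * int i)) = f i - f (Suc i)" for i
    by (simp add: f_def q_root_pow_mult left_diff_distrib algebra_simps)
  then have "(q_root_pow (int n) - q_root_pow (- int n)) * quantum_int n =
      (\<Sum>i<n. f i - f (Suc i))"
    by (simp add: quantum_int_def sum_distrib_left)
  also have "\<dots> = f 0 - f n"
    by (rule sum_lessThan_telescope')
  finally show ?thesis
    by (simp add: f_def algebra_simps)
qed

text \<open>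
  The word \<open>ks\<close> in the generators \<open>1, \<dots>, n - 1\<close> of the braid group, read from top to bottom, gives a
  positive braid with \<open>l(\<sigma>)\<close> crossings in which the strand starting at the \<open>i\<close>-th place ends at
  the \<open>\<sigma>(i)\<close>-th place. Any two such braids are isotopic.
\<close>

definition positive_braid_word :: "nat \<Rightarrow> (nat \<Rightarrow> nat) \<Rightarrow> nat list \<Rightarrow> bool" where
  "positive_braid_word n \<sigma> ks \<longleftrightarrow>
     set ks \<subseteq> {1..<n} \<and> length ks = inversions n \<sigma> \<and>
     (\<forall>i\<in>{1..n}. fold (\<lambda>k. Transposition.transpose k (Suc k)) ks i = \<sigma> i)"

definition braid :: "nat list \<Rightarrow> diagram" where
  "braid ks = map (\<lambda>k. (k - 1, PosX)) ks"

text \<open>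
  The axioms of the bracket. In each of them \<open>T\<close> and \<open>U\<close> are the parts of the diagram above and
  below the place of the local change, and \<open>k\<close> is the number of strands to the left of it.
\<close>

locale web_bracket =
  fixes n :: nat and B :: "diagram \<Rightarrow> laurent"
  assumes invariant: "isotopic n D D' \<Longrightarrow> B D = B D'"
    and skein: "web_diagram n (T @ [(k, PosX)] @ U) \<Longrightarrow>
      q_root_pow 1 * B (T @ [(k, PosX)] @ U) - q_root_pow (- 1) * B (T @ [(k, NegX)] @ U) =
      (q_root_pow (int n) - q_root_pow (- int n)) * B (T @ U)"
    and positive_curl: "web_diagram n (T @ shift k C @ U) \<Longrightarrow>
      C = curl_right PosX \<or> C = curl_left PosX \<Longrightarrow>
      B (T @ shift k C @ U) = q_root_pow (int n * int n - 1) * B (T @ U)"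
    and negative_curl: "web_diagram n (T @ shift k C @ U) \<Longrightarrow>
      C = curl_right NegX \<or> C = curl_left NegX \<Longrightarrow>
      B (T @ shift k C @ U) = q_root_pow (1 - int n * int n) * B (T @ U)"
    and vertex: "web_diagram n (T @ [(k, Sink), (k, Source)] @ U) \<Longrightarrow>
      (\<And>\<sigma>. \<sigma> permutes {1..n} \<Longrightarrow> positive_braid_word n \<sigma> (b \<sigma>)) \<Longrightarrow>
      B (T @ [(k, Sink), (k, Source)] @ U) =
      q_root_pow (int n * (int n * (int n - 1))) *
      (\<Sum>\<sigma> | \<sigma> permutes {1..n}.
         (- q_root_pow (1 - int n)) ^ inversions n \<sigma> * B (T @ shift k (braid (b \<sigma>)) @ U))"
    and trivial_knot: "web_diagram n (T @ [(k, Cap d), (k, Cup d)] @ U) \<Longrightarrow>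
      B (T @ [(k, Cap d), (k, Cup d)] @ U) = quantum_int n * B (T @ U)"
    and empty: "B [] = 1"

lemma tangle_append:
  "tangle n w (D @ E) w'' \<longleftrightarrow> (\<exists>w'. tangle n w D w' \<and> tangle n w' E w'')"
  by (induction D arbitrary: w) auto

lemma shift_append: "shift k (D @ E) = shift k D @ shift k E"
  by (simp add: shift_def)

lemma tangle_shift:
  "tangle n w D w' \<Longrightarrow> tangle n (u @ w @ v) (shift (length u) D) (u @ w' @ v)"
proof (induction D arbitrary: w)
  case Nil
  then show ?case by (simp add: shift_def)
next
  case (Cons s D)
  obtain k g where s: "s = (k, g)" by (cases s)
  have ok: "slice_ok n w (k, g)" and t: "tangle n (slice_out n w (k, g)) D w'"
    using Cons.prems s by auto
  let ?d = "length (piece_dom n g)"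
  have le: "k + ?d \<le> length w"
  proof -
    have "length (take ?d (drop k w)) = ?d" using ok by simp
    then show ?thesis using ok by (auto simp: min_def split: if_splits)
  qed
  have "slice_ok n (u @ w @ v) (length u + k, g)"
    using ok le by (auto simp: min_def)
  moreover have "slice_out n (u @ w @ v) (length u + k, g) = u @ slice_out n w (k, g) @ v"
    using le by simp
  ultimately show ?case
    using Cons.IH[OF t] s by (simp add: shift_def)
qed

lemma tangle_caps:
  "tangle n (replicate a Dn) (map (\<lambda>j. (j, Cap Dn)) [a..<a + m])
     (replicate (a + m) Dn @ replicate m Up)"
proof (induction m)
  case 0
  then show ?case by simp
next
  case (Suc m)
  have "replicate (a + m) Dn @ Dn # Up # replicate m Up =
      replicate (a + Suc m) Dn @ replicate (Suc m) Up"
    by (simp add: replicate_append_same replicate_app_Cons_same)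
  then show ?case
    using Suc by (auto simp: tangle_append)
qed

lemma tangle_cups:
  "tangle n (replicate (a + m) Dn @ replicate m Up) (map (\<lambda>j. (j, Cup Dn)) (rev [a..<a + m]))
     (replicate a Dn)"
proof (induction m)
  case 0
  then show ?case by simp
next
  case (Suc m)
  have eq: "replicate (a + Suc m) Dn @ replicate (Suc m) Up =
      replicate (a + m) Dn @ [Dn, Up] @ replicate m Up"
    by (simp add: replicate_append_same replicate_app_Cons_same)
  show ?case
    using Suc by (simp only: eq) simp
qed

lemma tangle_sink_source:
  assumes "2 \<le> n"
  shows "tangle n [Dn, Dn] (sink_source n) [Dn, Dn]"
proof -
  obtain m where n: "n = 2 + m" using assms le_Suc_ex by blast
  have "tangle n (replicate 2 Dn) (map (\<lambda>j. (j, Cap Dn)) [2..<n])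
      (replicate n Dn @ replicate m Up)"
    using tangle_caps[of n 2 m] n by simp
  moreover have "tangle n (replicate n Dn @ replicate m Up) [(0, Sink), (0, Source)]
      (replicate n Dn @ replicate m Up)"
    by simp
  moreover have "tangle n (replicate n Dn @ replicate m Up)
      (map (\<lambda>j. (j, Cup Dn)) (rev [2..<n])) (replicate 2 Dn)"
    using tangle_cups[of n 2 m] n by simp
  ultimately have "tangle n (replicate 2 Dn) (sink_source n) (replicate 2 Dn)"
    unfolding sink_source_def tangle_append by blast
  then show ?thesis by (simp add: numeral_2_eq_2)
qed

lemma slice_crossing:
  assumes "slice_ok n w (k, g)" "g = PosX \<or> g = NegX"
  shows "\<exists>u v. w = u @ [Dn, Dn] @ v \<and> length u = k \<and> slice_out n w (k, g) = w"
proof -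
  have d: "take 2 (drop k w) = [Dn, Dn]" "k \<le> length w"
    using assms by (auto simp: numeral_2_eq_2)
  have w: "w = take k w @ [Dn, Dn] @ drop (k + 2) w"
    by (metis d(1) append_take_drop_id add.commute drop_drop)
  moreover have "slice_out n w (k, g) = take k w @ [Dn, Dn] @ drop (k + 2) w"
    using assms(2) by auto
  ultimately show ?thesis
    using d(2) by (intro exI[of _ "take k w"] exI[of _ "drop (k + 2) w"]) simp
qed

lemma resolution_tangle:
  assumes "resolution n D G" "2 \<le> n" "tangle n w D w'"
  shows "tangle n w G w'"
  using assms(1,3)
proof (induction arbitrary: w rule: resolution.induct)
  case Nil
  then show ?case by simp
next
  case (keep D G g k)
  then show ?case by simp
next
  case (smooth D G g k)
  then show ?case using slice_crossing[of n w k g] by auto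
next
  case (vertices D G g k)
  then obtain u v where w: "w = u @ [Dn, Dn] @ v" "length u = k" "slice_out n w (k, g) = w"
    using slice_crossing[of n w k g] by auto
  have "tangle n w (shift k (sink_source n)) w"
    using tangle_shift[OF tangle_sink_source[OF assms(2)], of u v] w by simp
  moreover have "tangle n w G w'"
    using vertices w by simp
  ultimately show ?case by (auto simp: tangle_append)
qed

lemma resolution_no_crossing:
  "resolution n D G \<Longrightarrow> \<forall>(k, g)\<in>set G. g \<noteq> PosX \<and> g \<noteq> NegX"
  by (induction rule: resolution.induct) (auto simp: shift_def sink_source_def)

lemma planar_web_resolution:
  assumes "2 \<le> n" "link_diagram n D" "resolution n D \<Gamma>"
  shows "planar_web n \<Gamma>"
proof -
  have "tangle n [] D []"
    using assms(2) by (simp add: link_diagram_def web_diagram_def)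
  then have "tangle n [] \<Gamma> []"
    by (rule resolution_tangle[OF assms(3) assms(1)])
  with resolution_no_crossing[OF assms(3)] show ?thesis
    by (simp add: planar_web_def web_diagram_def)
qed

end

theory Submission
  imports Defs
begin

text \<open>
  Parity: read the labels of a state along a horizontal line as a word. Caps and cups change its
  number of inversions by an even number. A sink followed by the source below it permutes the \<open>n\<close>
  labels of its bands, which changes the number of inversions by the sum of the two \<open>l(P(S, v))\<close>
  modulo 2. The word is empty at the top and at the bottom.

  Positivity: the bracket is a state sum in which the planar pieces have monomial weights, up to
  the signs \<open>(-1)\<^bsup>l(P(S, v))\<^esup>\<close> of the vertices, which cancel by parity. To identify a given bracket
  with the state sum, resolve the vertices into braids; the difference of the two is then a functional on link
  diagrams that satisfies homogeneous skein relations and vanishes on the empty diagram. It vanishes on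
  all link diagrams by induction on the number of crossings. Modulo fewer crossings the
  over/under information does not matter, and the curves underlying a diagram can be reduced to
  nothing by moves that never increase the number of crossings.
\<close>

section \<open>Reduction of plane curves\<close>

text \<open>A bracket is any function with the stated properties; its existence is not part of the
  claim. The state sum is only a candidate to compare it with, and invariance under moves of discs
  is never asked of it: each sink of a resolution lies directly above its source at the same place,
  which is the very shape in which the \<open>vertex\<close> axiom replaces the pair by braids.
  Agreement on diagrams without discs is then enough.

  The weights come from the R-matrix of the \<open>n\<close>-dimensional representation of quantum
  \<open>sl_n\<close>. The sum over braids becomes the quantum antisymmetrizer, which on
  \<open>n\<close> strands has rank one and so factors through the empty word; the two factors are
  the weights of sink and source. The coefficient \<open>-q^((1-n)/n)\<close> times the
  normalization \<open>q^(-1/n)\<close> of a positive crossing is \<open>-q^(-1)\<close>, which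
  leaves integer powers of \<open>q\<close> in every planar piece.

  The obstacle on the side of links is that only crossings of two downward strands are primitive.
  Curves are therefore reduced as words without directions, and each rule is lifted afterwards to
  all directions.\<close>

datatype kind = KCap | KCup | KX

fun kdom :: "kind \<Rightarrow> nat" where
  "kdom KCap = 0" | "kdom KCup = 2" | "kdom KX = 2"

fun kcod :: "kind \<Rightarrow> nat" where
  "kcod KCap = 2" | "kcod KCup = 0" | "kcod KX = 2"

type_synonym shadow = "(nat \<times> kind) list"

text \<open>The rules are oriented so that none of them adds a crossing: R2, loops, circles and
  zigzags only disappear, while exchanges and slides, which keep the number of crossings, are listed
  in both directions. \<open>R3\<close> has the direction in which a crossing passes an arc.\<close>

inductive shadow_rule :: "shadow \<Rightarrow> shadow \<Rightarrow> bool" where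
  exchange: "shadow_rule [(j, g), (j + kcod g + m, h)] [(j + kdom g + m, h), (j, g)]"
| exchange': "shadow_rule [(j + kdom g + m, h), (j, g)] [(j, g), (j + kcod g + m, h)]"
| straighten_left: "shadow_rule [(k, KCap), (Suc k, KCup)] []"
| straighten_right: "shadow_rule [(Suc k, KCap), (k, KCup)] []"
| circle: "shadow_rule [(k, KCap), (k, KCup)] []"
| R2: "shadow_rule [(k, KX), (k, KX)] []"
| R3: "shadow_rule [(Suc k, KX), (k, KX), (Suc k, KX)] [(k, KX), (Suc k, KX), (k, KX)]"
| slide_cap: "shadow_rule [(k, KCap), (Suc k, KX)] [(Suc k, KCap), (k, KX)]"
| slide_cap': "shadow_rule [(Suc k, KCap), (k, KX)] [(k, KCap), (Suc k, KX)]"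
| slide_cup: "shadow_rule [(k, KX), (Suc k, KCup)] [(Suc k, KX), (k, KCup)]"
| slide_cup': "shadow_rule [(Suc k, KX), (k, KCup)] [(k, KX), (Suc k, KCup)]"
| loop_cap: "shadow_rule [(k, KCap), (k, KX)] [(k, KCap)]"
| loop_cup: "shadow_rule [(k, KX), (k, KCup)] [(k, KCup)]"

inductive red1 :: "shadow \<Rightarrow> shadow \<Rightarrow> bool" where
  red1: "shadow_rule L R \<Longrightarrow> red1 (T @ L @ U) (T @ R @ U)"

abbreviation red :: "shadow \<Rightarrow> shadow \<Rightarrow> bool" where
  "red \<equiv> red1\<^sup>*\<^sup>*"

lemma red_rule: "shadow_rule L R \<Longrightarrow> red (T @ L @ U) (T @ R @ U)"
  by (simp add: red1 r_into_rtranclp)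

lemma red_context: "red D E \<Longrightarrow> red (T @ D @ U) (T @ E @ U)"
proof (induction rule: rtranclp_induct)
  case (step E G)
  from step.hyps(2) have "red1 (T @ E @ U) (T @ G @ U)"
  proof cases
    case (red1 L R T' U')
    then show ?thesis using red1.red1[of L R "T @ T'" "U' @ U"] by simp
  qed
  with step.IH show ?case by simp
qed simp

lemma red_left: "red D E \<Longrightarrow> red (T @ D) (T @ E)"
  using red_context[of D E T "[]"] by simp

lemma red_right: "red D E \<Longrightarrow> red (D @ U) (E @ U)"
  using red_context[of D E "[]" U] by simp

lemma red_Cons: "red D E \<Longrightarrow> red (s # D) (s # E)"
  using red_left[of D E "[s]"] by simp

lemma red_prefix: "shadow_rule L R \<Longrightarrow> red (L @ U) (R @ U)"
  using red_rule[of L R "[]" U] by simp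

text \<open>
  The arc with feet at the places \<open>a\<close> and \<open>b + 1\<close> whose left leg crosses all strands in between.
  A piece above it is either absorbed or passes below it, which eliminates the cup.
\<close>

definition chain :: "nat \<Rightarrow> nat \<Rightarrow> shadow" where
  "chain a b = map (\<lambda>i. (i, KX)) [a..<b] @ [(b, KCup)]"

lemma chain_end: "chain a a = [(a, KCup)]"
  by (simp add: chain_def)

lemma chain_Cons: "a < b \<Longrightarrow> chain a b = (a, KX) # chain (Suc a) b"
  by (simp add: chain_def upt_conv_Cons)


section \<open>Moving a single piece past an arc\<close>

lemma red_exchange:
  assumes "i + kcod g \<le> j"
  shows "red ((i, g) # (j, h) # U) ((j - kcod g + kdom g, h) # (i, g) # U)"
proof -
  obtain m where j: "j = i + kcod g + m" using assms le_Suc_ex by blast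
  then have e: "j - kcod g + kdom g = i + kdom g + m" by simp
  show ?thesis
    unfolding e using red_prefix[OF shadow_rule.exchange[of i g m h], of U] j by simp
qed

lemma red_exchange':
  assumes "i + kdom g \<le> j"
  shows "red ((j, h) # (i, g) # U) ((i, g) # (j - kdom g + kcod g, h) # U)"
proof -
  obtain m where j: "j = i + kdom g + m" using assms le_Suc_ex by blast
  then have e: "j - kdom g + kcod g = i + kcod g + m" by simp
  show ?thesis
    unfolding e using red_prefix[OF shadow_rule.exchange'[of i g m h], of U] j by simp
qed

text \<open>The arc ends two strands, both to the left of the piece, so the piece comes out two
  places further left.\<close>

lemma red_far_right:
  assumes "a \<le> b" "b + 2 \<le> j"
  shows "red ((j, g) # chain a b) (chain a b @ [(j - 2, g)])"
  using assms(1)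
proof (induction rule: inc_induct)
  case base
  then show ?case
    using red_exchange'[of b KCup j g "[]"] assms by (simp add: chain_end)
next
  case (step i)
  have "red ((j, g) # (i, KX) # chain (Suc i) b) ((i, KX) # (j, g) # chain (Suc i) b)"
    using red_exchange'[of i KX j g "chain (Suc i) b"] assms step by (simp add: Suc_diff_Suc numeral_2_eq_2)
  also have "red \<dots> ((i, KX) # chain (Suc i) b @ [(j - 2, g)])"
    using step by (intro red_Cons) simp
  finally show ?case using step by (simp add: chain_Cons)
qed

text \<open>Here the piece keeps its place and the arc moves, by the change that the piece makes in
  the number of strands.\<close>

lemma red_far_left:
  assumes "a \<le> b" "j + kcod g \<le> a"
  shows "red ((j, g) # chain a b)
    (chain (a - kcod g + kdom g) (b - kcod g + kdom g) @ [(j, g)])"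
  using assms(1)
proof (induction rule: inc_induct)
  case base
  then show ?case
    using red_exchange[of j g b KCup "[]"] assms by (simp add: chain_end)
next
  case (step i)
  have "red ((j, g) # (i, KX) # chain (Suc i) b) ((i - kcod g + kdom g, KX) # (j, g) # chain (Suc i) b)"
    using red_exchange[of j g i KX] assms step by simp
  also have "red \<dots> ((i - kcod g + kdom g, KX) #
      chain (Suc i - kcod g + kdom g) (b - kcod g + kdom g) @ [(j, g)])"
    using step by (intro red_Cons) simp
  moreover have "chain (i - kcod g + kdom g) (b - kcod g + kdom g) =
      (i - kcod g + kdom g, KX) # chain (Suc i - kcod g + kdom g) (b - kcod g + kdom g)"
    using step assms by (subst chain_Cons) (auto simp: Suc_diff_le)
  ultimately show ?case
    using step by (simp only: chain_Cons[of i] append_Cons)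
qed

definition cup_free :: "shadow \<Rightarrow> bool" where
  "cup_free D \<longleftrightarrow> KCup \<notin> snd ` set D"

lemma cup_free_simps [simp]:
  "cup_free []" "cup_free ((k, g) # D) \<longleftrightarrow> g \<noteq> KCup \<and> cup_free D"
  "cup_free (D @ E) \<longleftrightarrow> cup_free D \<and> cup_free E"
  by (auto simp: cup_free_def)

definition crossings :: "nat \<Rightarrow> nat \<Rightarrow> shadow" where
  "crossings a b = map (\<lambda>i. (i, KX)) [a..<b]"

lemma cup_free_crossings [simp]: "cup_free (crossings a b)"
  by (auto simp: cup_free_def crossings_def)

lemma chain_split: "a \<le> c \<Longrightarrow> c \<le> b \<Longrightarrow> chain a b = crossings a c @ chain c b"
  using upt_add_eq_append[of a c "b - c"] by (simp add: chain_def crossings_def)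

lemma chain_snoc: "a < b \<Longrightarrow> chain a b = crossings a (b - 1) @ [(b - 1, KX), (b, KCup)]"
  by (simp add: chain_split[of a "b - 1" b] chain_Cons[of "b - 1" b] chain_end del: One_nat_def)

text \<open>The crossings touch no place beyond \<open>c\<close> and keep the number of strands, so
  the piece passes them without a shift.\<close>

lemma red_past_crossings:
  assumes "a \<le> c" "c < j"
  shows "red ((j, g) # crossings a c @ U) (crossings a c @ (j, g) # U)"
  using assms(1)
proof (induction rule: inc_induct)
  case base
  then show ?case by (simp add: crossings_def)
next
  case (step i)
  have "red ((j, g) # (i, KX) # crossings (Suc i) c @ U) ((i, KX) # (j, g) # crossings (Suc i) c @ U)"
    using red_exchange'[of i KX j g "crossings (Suc i) c @ U"] assms step
    by (simp add: Suc_diff_Suc numeral_2_eq_2)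
  also have "red \<dots> ((i, KX) # crossings (Suc i) c @ (j, g) # U)"
    using step by (intro red_Cons) simp
  finally show ?case using step by (simp add: crossings_def upt_conv_Cons)
qed

text \<open>The right leg of the cap is the left leg of the arc, so the two form a zigzag. Each
  slide takes the cap across one strand and leaves a crossing on its left, which passes below the
  arc. Once cap and cup are adjacent, the zigzag straightens and the cup is gone.\<close>

lemma red_cap_chain:
  assumes "a \<le> b"
  shows "\<exists>R. cup_free R \<and> red ((a, KCap) # chain (Suc a) (Suc b)) R"
  using assms
proof (induction rule: inc_induct)
  case base
  have "red [(b, KCap), (Suc b, KCup)] []"
    using red_prefix[OF shadow_rule.straighten_left[of b], of "[]"] by simp
  then show ?case by (intro exI[of _ "[]"]) (simp add: chain_end)
next
  case (step i)
  then obtain R where R: "cup_free R" "red ((Suc i, KCap) # chain (Suc (Suc i)) (Suc b)) R" by blast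
  have "red ((i, KCap) # (Suc i, KX) # chain (Suc (Suc i)) (Suc b))
      ((Suc i, KCap) # (i, KX) # chain (Suc (Suc i)) (Suc b))"
    using red_prefix[OF shadow_rule.slide_cap[of i]] by simp
  also have "red \<dots> ((Suc i, KCap) # chain (Suc (Suc i)) (Suc b) @ [(i, KX)])"
    using red_far_left[of "Suc (Suc i)" "Suc b" i KX] step by (intro red_Cons) simp
  also have "red \<dots> (R @ [(i, KX)])"
    using red_right[OF R(2), of "[(i, KX)]"] by simp
  finally have "red ((i, KCap) # chain (Suc i) (Suc b)) (R @ [(i, KX)])"
    using step by (simp add: chain_Cons)
  then show ?case using R(1) by (intro exI[of _ "R @ [(i, KX)]"]) simp
qed

text \<open>The cases are the positions of the piece relative to the feet \<open>a\<close> and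
  \<open>b + 1\<close>. The cup disappears when a cap shares a strand with the arc; in all other
  cases the arc, possibly with other feet, moves above the piece or absorbs it.\<close>

lemma red_piece_chain:
  assumes "a \<le> b" "g \<noteq> KCup"
  shows "(\<exists>R. cup_free R \<and> red ((j, g) # chain a b) R) \<or>
    (\<exists>a' b' R. a' \<le> b' \<and> cup_free R \<and> red ((j, g) # chain a b) (chain a' b' @ R))"
    (is "?A \<or> ?B")
proof -
  have B: ?B if "red ((j, g) # chain a b) (chain a' b' @ R)" "a' \<le> b'" "cup_free R" for a' b' R
    using that by blast
  consider "j + kcod g \<le> a" | "j \<ge> b + 2" | "g = KX" "Suc j = a" | "g = KX" "j = a"
    | "g = KX" "a < j" "j < b" | "g = KX" "a < j" "j = b" | "g = KX" "j = Suc b"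
    | "g = KCap" "Suc j = a" | "g = KCap" "j = a" | "g = KCap" "a < j" "j < b"
    | "g = KCap" "a < j" "j = b" | "g = KCap" "j = Suc b"
    using assms by (cases g) (simp_all, linarith+)
  then show ?thesis
  proof cases
    case 1
    then show ?thesis using assms by (intro disjI2 B[OF red_far_left]) auto
  next
    case 2
    then show ?thesis using assms by (intro disjI2 B[OF red_far_right]) auto
  next
    case 3
    then have "(j, g) # chain a b = chain j b @ []" using assms by (simp add: chain_Cons)
    then show ?thesis using assms 3 by (intro disjI2 B[of j b "[]"]) auto
  next
    case 4
    show ?thesis
    proof (cases "a = b")
      case True
      then have "red ((j, g) # chain a b) (chain a b @ [])"
        using 4 red_prefix[OF shadow_rule.loop_cup[of a], of "[]"] by (simp add: chain_end)
      then show ?thesis using assms by - (rule disjI2, rule B, assumption, auto)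
    next
      case False
      then have "red ((j, g) # chain a b) (chain (Suc a) b @ [])"
        using 4 assms red_prefix[OF shadow_rule.R2[of a]] by (simp add: chain_Cons)
      then show ?thesis using assms False by - (rule disjI2, rule B, assumption, auto)
    qed
  next
    \<comment> \<open>The left leg of the arc crosses the two strands of this crossing one after the
      other, so R3 carries the crossing to the other side of the leg, where it sits one place
      further left.\<close>
    case 5
    then obtain i where i: "j = Suc i" "a \<le> i" by (cases j) auto
    have c: "chain a b = crossings a i @ (i, KX) # (j, KX) # chain (Suc j) b"
      using 5 i by (simp add: chain_split[of a i b] chain_Cons[of i] chain_Cons[of "Suc i"])
    have "red ((j, g) # chain a b) (crossings a i @ (j, KX) # (i, KX) # (j, KX) # chain (Suc j) b)"
      using red_past_crossings[of a i j KX "(i, KX) # (j, KX) # chain (Suc j) b"] i 5 c by simp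
    also have "red \<dots> (crossings a i @ (i, KX) # (j, KX) # (i, KX) # chain (Suc j) b)"
      using red_prefix[OF shadow_rule.R3[of i]] i by (intro red_left) simp
    also have "red \<dots> (crossings a i @ (i, KX) # (j, KX) # chain (Suc j) b @ [(i, KX)])"
      using red_far_left[of "Suc j" b i KX] i 5
      by (intro red_left red_Cons) (simp add: Suc_diff_Suc numeral_2_eq_2)
    also have "\<dots> = chain a b @ [(i, KX)]" using c by simp
    finally show ?thesis using assms by - (rule disjI2, rule B, assumption, auto)
  next
    \<comment> \<open>The same strand crosses both legs of the arc. Sliding the cup turns the two
      crossings into a bigon, and R2 frees the strand.\<close>
    case 6
    then obtain i where i: "b = Suc i" "a \<le> i" by (cases b) auto
    have "red ((j, g) # chain a b) (crossings a i @ (b, KX) # (i, KX) # [(b, KCup)])"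
      using red_past_crossings[of a i b KX "(i, KX) # [(b, KCup)]"] 6 i by (simp add: chain_snoc)
    also have "red \<dots> (crossings a i @ (b, KX) # [(b, KX), (i, KCup)])"
      using red_prefix[OF shadow_rule.slide_cup[of i], of "[]"] i by (intro red_left red_Cons) simp
    also have "red \<dots> (crossings a i @ [(i, KCup)])"
      using red_prefix[OF shadow_rule.R2[of b], of "[(i, KCup)]"] by (intro red_left) simp
    also have "\<dots> = chain a i @ []"
      using i by (simp add: chain_split[of a i i] chain_end)
    finally show ?thesis using i by - (rule disjI2, rule B, assumption, auto)
  next
    \<comment> \<open>A crossing on the right leg slides around the cup to the left leg, because a
      chain has all its crossings on the left leg.\<close>
    case 7
    have "red ((j, g) # chain a b) (crossings a b @ [(j, KX), (b, KCup)])"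
      using red_past_crossings[of a b j KX "[(b, KCup)]"] 7 assms
      by (simp add: chain_split[of a b b] chain_end)
    also have "red \<dots> (crossings a b @ [(b, KX), (j, KCup)])"
      using red_prefix[OF shadow_rule.slide_cup'[of b], of "[]"] 7 by (intro red_left) simp
    also have "\<dots> = chain a j @ []"
      using 7 assms by (simp add: chain_snoc)
    finally show ?thesis using assms 7 by - (rule disjI2, rule B, assumption, auto)
  next
    case 8
    then show ?thesis using red_cap_chain[of j "b - 1"] assms by (cases b) auto
  next
    case 9
    show ?thesis
    proof (cases "a = b")
      case True
      then have "red ((j, g) # chain a b) []"
        using 9 red_prefix[OF shadow_rule.circle[of a], of "[]"] by (simp add: chain_end)
      then show ?thesis by (intro disjI1 exI[of _ "[]"]) auto
    next
      case False
      then obtain R where R: "cup_free R" "red ((a, KCap) # chain (Suc a) b) R"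
        using red_cap_chain[of a "b - 1"] assms by (cases b) auto
      have "red ((j, g) # chain a b) ((a, KCap) # chain (Suc a) b)"
        using 9 assms False red_prefix[OF shadow_rule.loop_cap[of a]] by (simp add: chain_Cons)
      also note R(2)
      finally show ?thesis using R(1) by blast
    qed
  next
    \<comment> \<open>The left leg crosses both feet of the cap; one slide makes this a bigon, and
      R2 pulls the cap out.\<close>
    case 10
    then obtain i where i: "j = Suc i" "a \<le> i" by (cases j) auto
    obtain c where b: "b = Suc (Suc c)" "i \<le> c" using 10 i by (metis less_iff_Suc_add add_Suc_right le_add1 add_Suc)
    have "red ((j, g) # chain a b) (crossings a i @ (j, KCap) # (i, KX) # (j, KX) # chain (Suc j) b)"
      using red_past_crossings[of a i j KCap "(i, KX) # (j, KX) # chain (Suc j) b"] i 10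
      by (simp add: chain_split[of a i b] chain_Cons[of i] chain_Cons[of "Suc i"])
    also have "red \<dots> (crossings a i @ (i, KCap) # (j, KX) # (j, KX) # chain (Suc j) b)"
      using red_prefix[OF shadow_rule.slide_cap'[of i]] i by (intro red_left) simp
    also have "red \<dots> (crossings a i @ (i, KCap) # chain (Suc j) b)"
      using red_prefix[OF shadow_rule.R2[of j]] by (intro red_left red_Cons) simp
    also have "red \<dots> (crossings a i @ chain i c @ [(i, KCap)])"
      using red_far_left[of "Suc j" b i KCap] i b by (intro red_left) simp
    also have "\<dots> = chain a c @ [(i, KCap)]"
      using i b by (simp add: chain_split[of a i c])
    finally show ?thesis using i b by - (rule disjI2, rule B, assumption, auto)
  next
    case 11
    then obtain i where i: "b = Suc i" "a \<le> i" by (cases b) auto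
    have "red ((j, g) # chain a b) (crossings a i @ (b, KCap) # (i, KX) # [(b, KCup)])"
      using red_past_crossings[of a i b KCap "(i, KX) # [(b, KCup)]"] 11 i by (simp add: chain_snoc)
    also have "red \<dots> (crossings a i @ (i, KCap) # (b, KX) # [(b, KCup)])"
      using red_prefix[OF shadow_rule.slide_cap'[of i]] i by (intro red_left) simp
    also have "red \<dots> (crossings a i @ (i, KCap) # [(b, KCup)])"
      using red_prefix[OF shadow_rule.loop_cup[of b], of "[]"] by (intro red_left red_Cons) simp
    also have "red \<dots> (crossings a i @ [])"
      using red_prefix[OF shadow_rule.straighten_left[of i], of "[]"] i by (intro red_left) simp
    finally show ?thesis by (intro disjI1 exI[of _ "crossings a i"]) simp
  next
    case 12
    have "red ((j, g) # chain a b) (crossings a b @ [(j, KCap), (b, KCup)])"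
      using red_past_crossings[of a b j KCap "[(b, KCup)]"] 12 assms
      by (simp add: chain_split[of a b b] chain_end)
    also have "red \<dots> (crossings a b @ [])"
      using red_prefix[OF shadow_rule.straighten_right[of b], of "[]"] 12 by (intro red_left) simp
    finally show ?thesis by (intro disjI1 exI[of _ "crossings a b"]) simp
  qed
qed

section \<open>Counting strands, and the elimination of all cups\<close>

fun width :: "nat \<Rightarrow> shadow \<Rightarrow> nat \<Rightarrow> bool" where
  "width m [] m' \<longleftrightarrow> m = m'"
| "width m ((k, g) # D) m' \<longleftrightarrow> k + kdom g \<le> m \<and> width (m - kdom g + kcod g) D m'"

lemma width_append: "width m (D @ E) m' \<longleftrightarrow> (\<exists>l. width m D l \<and> width l E m')"
  by (induction m D m' rule: width.induct) auto

lemma width_rule: "shadow_rule L R \<Longrightarrow> width m L m' \<Longrightarrow> width m R m'"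
  by (induction rule: shadow_rule.induct) auto

lemma width_red: "red D E \<Longrightarrow> width m D m' \<Longrightarrow> width m E m'"
proof (induction rule: rtranclp_induct)
  case (step E G)
  from step.hyps(2) show ?case
  proof cases
    case (red1 L R T U)
    then obtain l l' where "width m T l" "width l L l'" "width l' U m'"
      using step by (auto simp: width_append)
    with width_rule[OF red1(3)] red1 show ?thesis by (auto simp: width_append)
  qed
qed

lemma width_chain: "a \<le> b \<Longrightarrow> \<not> width 0 (chain a b @ R) m"
  by (cases "a = b") (simp_all add: chain_end chain_Cons)

text \<open>The pieces of \<open>S\<close> pass below the arc one at a time, beginning with the
  last. If none of them removed the cup, the arc would reach the top, where there are no strands to
  end; so some cap removes it. The suffix \<open>U\<close> carries the width of the whole word
  through the induction.\<close>

lemma cup_elimination: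
  assumes "cup_free S" "a \<le> b" "width 0 (S @ chain a b @ U) m"
  shows "\<exists>R. cup_free R \<and> red (S @ chain a b) R"
  using assms
proof (induction S arbitrary: a b U rule: rev_induct)
  case Nil
  then show ?case using width_chain[of a b U m] by simp
next
  case (snoc s S)
  obtain j g where s: "s = (j, g)" by (cases s)
  with snoc.prems have g: "g \<noteq> KCup" "cup_free S" by auto
  show ?case
    using red_piece_chain[OF snoc.prems(2) g(1), of j]
  proof (elim disjE exE conjE)
    fix R assume R: "cup_free R" "red ((j, g) # chain a b) R"
    then show ?thesis using red_left[OF R(2), of S] g s by (intro exI[of _ "S @ R"]) simp
  next
    fix a' b' R assume R: "a' \<le> b'" "cup_free R" "red ((j, g) # chain a b) (chain a' b' @ R)"
    have red: "red (S @ (j, g) # chain a b) (S @ chain a' b' @ R)"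
      using R(3) by (rule red_left)
    then have "width 0 (S @ chain a' b' @ R @ U) m"
      using width_red[OF red_right[OF red, of U], of 0 m] snoc.prems(3) s by simp
    then obtain R' where R': "cup_free R'" "red (S @ chain a' b') R'"
      using snoc.IH[OF g(2) R(1)] by blast
    have "red (S @ (j, g) # chain a b) (R' @ R)"
      using red red_right[OF R'(2), of R] by simp
    then show ?thesis using R(2) R'(1) s by (intro exI[of _ "R' @ R"]) simp
  qed
qed

lemma red_cup_free:
  assumes "width 0 D m"
  shows "\<exists>S. cup_free S \<and> red D S"
  using assms
proof (induction D arbitrary: m rule: rev_induct)
  case Nil
  then show ?case by (intro exI[of _ "[]"]) simp
next
  case (snoc s D)
  obtain k g where s: "s = (k, g)" by (cases s)
  from snoc.prems obtain l where "width 0 D l" by (auto simp: width_append)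
  from snoc.IH[OF this] obtain S where S: "cup_free S" "red D S" by blast
  have red: "red (D @ [s]) (S @ [s])" using S(2) by (rule red_right)
  show ?case
  proof (cases "g = KCup")
    case True
    have "width 0 (S @ chain k k @ []) m"
      using width_red[OF red snoc.prems] s True by (simp add: chain_end)
    from cup_elimination[OF S(1) _ this] obtain R where "cup_free R" "red (S @ chain k k) R" by auto
    with red s True show ?thesis by (auto simp: chain_end intro!: exI[of _ R] elim: rtranclp_trans)
  next
    case False
    with red S s show ?thesis by (intro exI[of _ "S @ [s]"]) simp
  qed
qed

lemma cup_free_width: "cup_free S \<Longrightarrow> width m S m' \<Longrightarrow> m \<le> m'"
proof (induction S arbitrary: m)
  case (Cons s S)
  obtain k g where s: "s = (k, g)" by (cases s)
  show ?case using Cons.IH[of "m - kdom g + kcod g"] Cons.prems s by (cases g) auto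
qed simp

text \<open>Without cups the number of strands never drops. A nonempty word that starts on no
  strands must begin with a cap, and could not return to zero.\<close>

theorem closed_shadow_reduces:
  assumes "width 0 D 0"
  shows "red D []"
proof -
  obtain S where S: "cup_free S" "red D S" using red_cup_free[OF assms] by blast
  have w: "width 0 S 0" using width_red[OF S(2) assms] .
  have "S = []"
  proof (cases S)
    case (Cons s S')
    obtain k g where "s = (k, g)" by (cases s)
    with Cons w S(1) cup_free_width[of S' 2 0] show ?thesis by (cases g) (auto simp: numeral_2_eq_2)
  qed simp
  with S(2) show ?thesis by simp
qed

section \<open>Functionals that satisfy the skein relation\<close>

fun vertex_free :: "diagram \<Rightarrow> bool" where
  "vertex_free [] \<longleftrightarrow> True"
| "vertex_free ((k, g) # D) \<longleftrightarrow> g \<noteq> Sink \<and> g \<noteq> Source \<and> vertex_free D"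

lemma vertex_free_iff: "vertex_free D \<longleftrightarrow> (\<forall>(k, g)\<in>set D. g \<noteq> Sink \<and> g \<noteq> Source)"
  by (induction D rule: vertex_free.induct) auto

lemma vertex_free_append [simp]: "vertex_free (D @ E) \<longleftrightarrow> vertex_free D \<and> vertex_free E"
  by (auto simp: vertex_free_iff)

lemma shift_simps [simp]:
  "shift k [] = []" "shift k ((j, g) # D) = (k + j, g) # shift k D"
  by (simp_all add: shift_def)

lemma shift_shift [simp]: "shift j (shift k D) = shift (j + k) D"
  by (induction D) auto

lemma shift_zero [simp]: "shift 0 D = D"
  by (induction D) auto

lemma vertex_free_shift [simp]: "vertex_free (shift k D) \<longleftrightarrow> vertex_free D"
  by (induction D) auto

lemma link_diagram_iff: "link_diagram n D \<longleftrightarrow> tangle n [] D [] \<and> vertex_free D"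
  by (simp add: link_diagram_def web_diagram_def vertex_free_iff)

lemma opp_opp [simp]: "opp (opp d) = d"
  by (cases d) auto

lemma tangle_det: "tangle n w D x \<Longrightarrow> tangle n w D y \<Longrightarrow> x = y"
  by (induction D arbitrary: w) auto

lemma tangle_middle:
  assumes "tangle n w (A @ shift (length u) L @ B) w'" "tangle n w A (u @ x @ v)" "tangle n x L x'"
  shows "tangle n (u @ x' @ v) B w'"
proof -
  obtain y z where yz: "tangle n w A y" "tangle n y (shift (length u) L) z" "tangle n z B w'"
    using assms(1) by (auto simp: tangle_append)
  have "y = u @ x @ v" using yz(1) assms(2) by (rule tangle_det)
  moreover from this have "z = u @ x' @ v"
    using yz(2) tangle_shift[OF assms(3), of u v] by (auto dest: tangle_det)
  ultimately show ?thesis using yz(3) by simp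
qed

text \<open>The properties of a bracket that involve no discs, restricted to link diagrams. Each is
  a homogeneous linear relation between values, so the difference of two such functionals is another
  one.\<close>

locale link_functional =
  fixes n :: nat and F :: "diagram \<Rightarrow> laurent"
  assumes invariant: "local_move n L R \<Longrightarrow> link_diagram n (T @ shift k L @ U) \<Longrightarrow>
      link_diagram n (T @ shift k R @ U) \<Longrightarrow> F (T @ shift k L @ U) = F (T @ shift k R @ U)"
    and skein: "link_diagram n (T @ [(k, PosX)] @ U) \<Longrightarrow>
      q_root_pow 1 * F (T @ [(k, PosX)] @ U) - q_root_pow (- 1) * F (T @ [(k, NegX)] @ U) =
      (q_root_pow (int n) - q_root_pow (- int n)) * F (T @ U)"
    and positive_curl: "link_diagram n (T @ shift k C @ U) \<Longrightarrow>
      C = curl_right PosX \<or> C = curl_left PosX \<Longrightarrow>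
      F (T @ shift k C @ U) = q_root_pow (int n * int n - 1) * F (T @ U)"
    and negative_curl: "link_diagram n (T @ shift k C @ U) \<Longrightarrow>
      C = curl_right NegX \<or> C = curl_left NegX \<Longrightarrow>
      F (T @ shift k C @ U) = q_root_pow (1 - int n * int n) * F (T @ U)"
    and trivial_knot: "link_diagram n (T @ [(k, Cap d), (k, Cup d)] @ U) \<Longrightarrow>
      F (T @ [(k, Cap d), (k, Cup d)] @ U) = quantum_int n * F (T @ U)"
begin

text \<open>\<open>L\<close> and \<open>R\<close> are interchangeable in every link diagram in which
  the strands that enter the place have the directions \<open>w\<close>. The prefix \<open>T\<close>
  is required to produce these directions; the common source and target words make the replacement a
  link diagram again.\<close>

definition eqv :: "dir list \<Rightarrow> diagram \<Rightarrow> diagram \<Rightarrow> bool" where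
  "eqv w L R \<longleftrightarrow> vertex_free L \<and> vertex_free R \<and> (\<exists>w'. tangle n w L w' \<and> tangle n w R w') \<and>
     (\<forall>T U u v. link_diagram n (T @ shift (length u) L @ U) \<longrightarrow> tangle n [] T (u @ w @ v) \<longrightarrow>
        F (T @ shift (length u) L @ U) = F (T @ shift (length u) R @ U))"

lemma eqv_vertex_free: "eqv w L R \<Longrightarrow> vertex_free L" "eqv w L R \<Longrightarrow> vertex_free R"
  unfolding eqv_def by blast+

lemma eqvD:
  assumes "eqv w L R" "link_diagram n (T @ shift (length u) L @ U)" "tangle n [] T (u @ w @ v)"
  shows "F (T @ shift (length u) L @ U) = F (T @ shift (length u) R @ U)"
    and "link_diagram n (T @ shift (length u) R @ U)"
proof -
  show "F (T @ shift (length u) L @ U) = F (T @ shift (length u) R @ U)"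
    using assms unfolding eqv_def by blast
  obtain w' where w': "tangle n w L w'" "tangle n w R w'"
    using assms(1) unfolding eqv_def by blast
  have "tangle n (u @ w' @ v) U []"
    using assms(2,3) w'(1) by (auto simp: link_diagram_iff intro: tangle_middle)
  then show "link_diagram n (T @ shift (length u) R @ U)"
    using assms tangle_shift[OF w'(2), of u v]
    using eqv_vertex_free[OF assms(1)] unfolding link_diagram_iff tangle_append by auto
qed

lemma eqv_tangle: "eqv w L R \<Longrightarrow> tangle n w L w' \<longleftrightarrow> tangle n w R w'"
  unfolding eqv_def by (blast dest: tangle_det)

lemma eqvI:
  assumes "vertex_free L" "vertex_free R" "tangle n w L w'" "tangle n w R w'"
    and "\<And>T U u v. link_diagram n (T @ shift (length u) L @ U) \<Longrightarrow>
      link_diagram n (T @ shift (length u) R @ U) \<Longrightarrow> tangle n [] T (u @ w @ v) \<Longrightarrow>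
      F (T @ shift (length u) L @ U) = F (T @ shift (length u) R @ U)"
  shows "eqv w L R"
proof -
  have "F (T @ shift (length u) L @ U) = F (T @ shift (length u) R @ U)"
    if *: "link_diagram n (T @ shift (length u) L @ U)" "tangle n [] T (u @ w @ v)" for T U u v
  proof -
    have "tangle n (u @ w' @ v) U []"
      using * assms(3) by (auto simp: link_diagram_iff intro: tangle_middle)
    then have "link_diagram n (T @ shift (length u) R @ U)"
      using assms * tangle_shift[OF assms(4), of u v]
      unfolding link_diagram_iff tangle_append by auto
    then show ?thesis using assms(5) * by blast
  qed
  then show ?thesis using assms(1-4) unfolding eqv_def by blast
qed

lemma eqv_refl: "vertex_free L \<Longrightarrow> tangle n w L w' \<Longrightarrow> eqv w L L"
  by (rule eqvI[of L L w w']) auto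

lemma eqv_sym: "eqv w L R \<Longrightarrow> eqv w R L"
proof -
  assume *: "eqv w L R"
  then obtain w' where w': "tangle n w L w'" "tangle n w R w'" unfolding eqv_def by blast
  show "eqv w R L"
  proof (rule eqvI[of R L w w'])
    fix T U u v
    assume "link_diagram n (T @ shift (length u) L @ U)" "tangle n [] T (u @ w @ v)"
    then show "F (T @ shift (length u) R @ U) = F (T @ shift (length u) L @ U)"
      using eqvD(1)[OF *, of T u U v] by simp
  qed (use eqv_vertex_free[OF *] w' in simp_all)
qed

lemma eqv_trans [trans]:
  assumes "eqv w L M" "eqv w M R"
  shows "eqv w L R"
proof -
  obtain w' where w': "tangle n w L w'" "tangle n w M w'" using assms(1) unfolding eqv_def by blast
  show ?thesis
  proof (rule eqvI[of L R w w'])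
    fix T U u v
    assume "link_diagram n (T @ shift (length u) L @ U)" "tangle n [] T (u @ w @ v)"
    then show "F (T @ shift (length u) L @ U) = F (T @ shift (length u) R @ U)"
      using eqvD[OF assms(1), of T u U v] eqvD[OF assms(2), of T u U v] by simp
  qed (use eqv_vertex_free[OF assms(1)] eqv_vertex_free[OF assms(2)] w'
        eqv_tangle[OF assms(2), of w'] in simp_all)
qed

lemma eqv_context:
  assumes "eqv x L R" "D = A @ shift (length u) L @ B" "E = A @ shift (length u) R @ B"
    "tangle n w A (u @ x @ v)" "tangle n w D w'" "vertex_free A" "vertex_free B"
  shows "eqv w D E"
proof -
  obtain x' where x': "tangle n x L x'" "tangle n x R x'" using assms(1) unfolding eqv_def by blast
  have B: "tangle n (u @ x' @ v) B w'"
    by (rule tangle_middle[OF assms(5)[unfolded assms(2)] assms(4) x'(1)])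
  show ?thesis
  proof (rule eqvI)
    show "tangle n w D w'" by fact
    show "tangle n w E w'"
      using assms(3,4) B tangle_shift[OF x'(2), of u v] by (auto simp: tangle_append)
  next
    fix T U a b
    assume *: "link_diagram n (T @ shift (length a) D @ U)" "tangle n [] T (a @ w @ b)"
    have "tangle n (a @ w @ b) (shift (length a) A) (a @ (u @ x @ v) @ b)"
      using assms(4) by (rule tangle_shift)
    then have "tangle n [] (T @ shift (length a) A) ((a @ u) @ x @ v @ b)"
      using *(2) by (auto simp: tangle_append)
    then show "F (T @ shift (length a) D @ U) = F (T @ shift (length a) E @ U)"
      using eqvD(1)[OF assms(1), of "T @ shift (length a) A" "a @ u" "shift (length a) B @ U" "v @ b"]
        * assms by (simp add: shift_append)
  qed (use assms(2,3,6,7) eqv_vertex_free[OF assms(1)] in simp_all)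
qed

lemma eqv_append:
  assumes "eqv w L R" "tangle n w L w'" "eqv w' M N"
  shows "eqv w (L @ M) (R @ N)"
proof -
  obtain w'' where w'': "tangle n w' M w''" using assms(3) unfolding eqv_def by blast
  have LM: "tangle n w (L @ M) w''" using assms(2) w'' by (auto simp: tangle_append)
  have R: "tangle n w R w'" using eqv_tangle[OF assms(1)] assms(2) by simp
  have RM: "tangle n w (R @ M) w''" using R w'' by (auto simp: tangle_append)
  have v: "vertex_free M" "vertex_free R"
    by (rule eqv_vertex_free[OF assms(3)], rule eqv_vertex_free[OF assms(1)])
  have "eqv w (L @ M) (R @ M)"
    by (rule eqv_context[OF assms(1), of _ "[]" "[]" M _ _ "[]" w'']) (use LM v in simp_all)
  also have "eqv w (R @ M) (R @ N)"
    by (rule eqv_context[OF assms(3), of _ R "[]" "[]" _ _ "[]" w'']) (use RM R v in simp_all)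
  finally show ?thesis .
qed

lemma eqv_move:
  assumes "local_move n L R" "vertex_free L" "vertex_free R" "tangle n w L w'" "tangle n w R w'"
  shows "eqv w L R"
  using assms by (intro eqvI invariant) auto

lemma eqv_exchange_pieces:
  assumes "tangle n x [(j, g)] x'" "tangle n y [(i, h)] y'" "vertex_free [(j, g), (i, h)]"
  shows "eqv (x @ y) [(j, g), (length x' + i, h)] [(length x + i, h), (j, g)]"
proof -
  have len: "j + length (piece_dom n g) \<le> length x"
    using assms(1) by (auto simp: min_def dest!: arg_cong[where f = length] split: if_splits)
  then obtain r where r: "length x = j + length (piece_dom n g) + r"
    using le_Suc_ex by blast
  have x': "length x' = j + length (piece_cod n g) + r"
    using assms(1) r by auto
  have move: "local_move n [(j, g), (length x' + i, h)] [(length x + i, h), (j, g)]"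
    using local_move.exchange[of n j g "r + i" h] by (simp only: x' r add.assoc)
  have g: "tangle n (x @ z) [(j, g)] (x' @ z)" for z
    using tangle_shift[OF assms(1), of "[]" z] by simp
  have h: "tangle n (z @ y) [(length z + i, h)] (z @ y')" for z
    using tangle_shift[OF assms(2), of z "[]"] by simp
  have "tangle n (x @ y) ([(j, g)] @ [(length x' + i, h)]) (x' @ y')"
    unfolding tangle_append using g[of y] h[of x'] by blast
  then have 1: "tangle n (x @ y) [(j, g), (length x' + i, h)] (x' @ y')"
    by (simp only: append_Cons append_Nil)
  have "tangle n (x @ y) ([(length x + i, h)] @ [(j, g)]) (x' @ y')"
    unfolding tangle_append using g[of y'] h[of x] by blast
  then have 2: "tangle n (x @ y) [(length x + i, h), (j, g)] (x' @ y')"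
    by (simp only: append_Cons append_Nil)
  show ?thesis
    by (rule eqv_move[OF move _ _ 1 2]) (use assms(3) in simp_all)
qed

lemma eqv_interchange_piece:
  assumes "tangle n x [(j, g)] x'" "tangle n y R y'" "vertex_free [(j, g)]" "vertex_free R"
  shows "eqv (x @ y) ((j, g) # shift (length x') R) (shift (length x) R @ [(j, g)])"
  using assms(2,4)
proof (induction R arbitrary: y)
  case Nil
  have "eqv (x @ y) [(j, g)] [(j, g)]"
    using tangle_shift[OF assms(1), of "[]" y] assms(3) by (intro eqv_refl) simp_all
  then show ?case by simp
next
  case (Cons s R)
  obtain i h where s: "s = (i, h)" by (cases s)
  then obtain z where z: "tangle n y [(i, h)] z" "tangle n z R y'"
    using Cons.prems(1) by auto
  have 1: "eqv (x @ y) [(j, g), (length x' + i, h)] [(length x + i, h), (j, g)]"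
    by (rule eqv_exchange_pieces[OF assms(1) z(1)]) (use assms(3) Cons.prems s in simp)
  have t: "tangle n (x @ y) [(length x + i, h)] (x @ z)"
    using tangle_shift[OF z(1), of x "[]"] by simp
  have t': "tangle n (x @ z) [(j, g)] (x' @ z)" 
    using tangle_shift[OF assms(1), of "[]" z] by simp
  have t'': "tangle n (x @ y) ([(length x + i, h)] @ [(j, g)]) (x' @ z)"
    using t t' unfolding tangle_append by blast
  have t1: "tangle n (x @ y) [(j, g), (length x' + i, h)] (x' @ z)"
    using t'' eqv_tangle[OF 1, of "x' @ z"] by (simp only: append_Cons append_Nil)
  have R: "tangle n (x' @ z) (shift (length x') R) (x' @ y')"
    using tangle_shift[OF z(2), of x' "[]"] by simp
  have vR: "vertex_free R" "vertex_free [(length x + i, h)]" "vertex_free (shift (length x') R)"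
    using Cons.prems s by auto
  have "eqv (x @ y) ([(j, g), (length x' + i, h)] @ shift (length x') R)
     ([(length x + i, h), (j, g)] @ shift (length x') R)"
    by (rule eqv_append[OF 1 t1 eqv_refl[OF vR(3) R]])
  also have "\<dots> = [(length x + i, h)] @ (j, g) # shift (length x') R" by simp
  also have "eqv (x @ y) \<dots> ([(length x + i, h)] @ shift (length x) R @ [(j, g)])"
    by (rule eqv_append[OF eqv_refl[OF vR(2) t] t Cons.IH[OF z(2) vR(1)]])
  finally show ?case by (simp add: s)
qed

text \<open>Tangles that stand side by side may be performed in either order. The exchange of single
  pieces is iterated over the right tangle in the previous lemma and over the left tangle
  here.\<close>

lemma eqv_interchange:
  assumes "tangle n x L x'" "tangle n y R y'" "vertex_free L" "vertex_free R"
  shows "eqv (x @ y) (L @ shift (length x') R) (shift (length x) R @ L)"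
  using assms(1,3)
proof (induction L arbitrary: x)
  case Nil
  have "eqv (x @ y) (shift (length x) R) (shift (length x) R)"
    using tangle_shift[OF assms(2), of x "[]"] assms(4) by (intro eqv_refl) simp_all
  then show ?case using Nil by simp
next
  case (Cons s L)
  obtain j g where s: "s = (j, g)" by (cases s)
  then obtain z where z: "tangle n x [(j, g)] z" "tangle n z L x'"
    using Cons.prems(1) by auto
  have t: "tangle n (x @ y) [(j, g)] (z @ y)"
    using tangle_shift[OF z(1), of "[]" y] by simp
  have t': "tangle n (z @ y) (shift (length z) R) (z @ y')"
    using tangle_shift[OF assms(2), of z "[]"] by simp
  have 1: "eqv (x @ y) ((j, g) # shift (length z) R) (shift (length x) R @ [(j, g)])"
    by (rule eqv_interchange_piece[OF z(1) assms(2) _ assms(4)]) (use Cons.prems s in simp)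
  have t'': "tangle n (x @ y) ((j, g) # shift (length z) R) (z @ y')"
    using t t' by auto
  have L: "tangle n (z @ y') L (x' @ y')"
    using tangle_shift[OF z(2), of "[]" y'] by simp
  have v: "vertex_free L" "vertex_free [(j, g)]"
    using Cons.prems s by auto
  have "eqv (x @ y) ([(j, g)] @ L @ shift (length x') R) ([(j, g)] @ shift (length z) R @ L)"
    by (rule eqv_append[OF eqv_refl[OF v(2) t] t Cons.IH[OF z(2) v(1)]])
  also have "\<dots> = ((j, g) # shift (length z) R) @ L" by simp
  also have "eqv (x @ y) \<dots> ((shift (length x) R @ [(j, g)]) @ L)"
    by (rule eqv_append[OF 1 t'' eqv_refl[OF v(1) L]])
  finally show ?case by (simp add: s)
qed

end

section \<open>Crossings of strands in arbitrary directions\<close>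

text \<open>
  At \<open>GX d e s\<close> the strand from top right to bottom left is the over-strand iff \<open>s\<close>. A quarter turn
  exchanges the two strands in this respect, hence the negations below.
\<close>

datatype gpiece = GCap dir | GCup dir | GX dir dir bool

fun gdom :: "gpiece \<Rightarrow> dir list" where
  "gdom (GCap d) = []"
| "gdom (GCup d) = [d, opp d]"
| "gdom (GX d e s) = [d, e]"

fun gcod :: "gpiece \<Rightarrow> dir list" where
  "gcod (GCap d) = [d, opp d]"
| "gcod (GCup d) = []"
| "gcod (GX d e s) = [e, d]"

fun crossing :: "bool \<Rightarrow> piece" where
  "crossing True = PosX"
| "crossing False = NegX"

lemma crossing_simps [simp]:
  "piece_dom n (crossing s) = [Dn, Dn]" "piece_cod n (crossing s) = [Dn, Dn]"
  "crossing s \<noteq> Sink" "crossing s \<noteq> Source"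
  by (cases s; simp)+

lemma crossing_cases: "crossing s = PosX \<or> crossing s = NegX"
  by (cases s) auto

fun realize_piece :: "gpiece \<Rightarrow> diagram" where
  "realize_piece (GCap d) = [(0, Cap d)]"
| "realize_piece (GCup d) = [(0, Cup d)]"
| "realize_piece (GX Dn Dn s) = [(0, crossing s)]"
| "realize_piece (GX Dn Up s) = turn_left (crossing (\<not> s))"
| "realize_piece (GX Up Dn s) = turn_right (crossing (\<not> s))"
| "realize_piece (GX Up Up s) =
     [(2, Cap Dn), (3, Cap Dn), (2, crossing s), (1, Cup Up), (0, Cup Up)]"

type_synonym gdiagram = "(nat \<times> gpiece) list"

fun realize :: "gdiagram \<Rightarrow> diagram" where
  "realize [] = []"
| "realize ((k, g) # G) = shift k (realize_piece g) @ realize G"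

lemma realize_append [simp]: "realize (G @ H) = realize G @ realize H"
  by (induction G rule: realize.induct) auto

definition gshift :: "nat \<Rightarrow> gdiagram \<Rightarrow> gdiagram" where
  "gshift k G = map (\<lambda>(j, g). (k + j, g)) G"

lemma gshift_simps [simp]:
  "gshift k [] = []" "gshift k ((j, g) # G) = (k + j, g) # gshift k G"
  by (simp_all add: gshift_def)

lemma realize_gshift [simp]: "realize (gshift k G) = shift k (realize G)"
  by (induction G rule: realize.induct) (auto simp: shift_append)

fun gtangle :: "dir list \<Rightarrow> gdiagram \<Rightarrow> dir list \<Rightarrow> bool" where
  "gtangle w [] w' \<longleftrightarrow> w = w'"
| "gtangle w ((k, g) # G) w' \<longleftrightarrow> k \<le> length w \<and> take (length (gdom g)) (drop k w) = gdom g \<and>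
     gtangle (take k w @ gcod g @ drop (k + length (gdom g)) w) G w'"

lemma gtangle_append: "gtangle w (G @ H) w'' \<longleftrightarrow> (\<exists>w'. gtangle w G w' \<and> gtangle w' H w'')"
  by (induction w G w'' rule: gtangle.induct) auto

lemmas as_Suc = numeral_2_eq_2 numeral_3_eq_3 eval_nat_numeral

lemma tangle_real_piece: "tangle n (gdom g) (realize_piece g) (gcod g)"
  by (cases g rule: realize_piece.cases) (simp_all add: turn_left_def turn_right_def as_Suc)

lemma vertex_free_real_piece: "vertex_free (realize_piece g)"
  by (cases g rule: realize_piece.cases) (simp_all add: turn_left_def turn_right_def)

lemma vertex_free_realize [simp]: "vertex_free (realize G)"
  by (induction G rule: realize.induct) (auto simp: vertex_free_real_piece)

lemma tangle_realize: "gtangle w G w' \<Longrightarrow> tangle n w (realize G) w'"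
proof (induction w G w' rule: gtangle.induct)
  case (2 w k g G w')
  let ?u = "take k w" and ?v = "drop (k + length (gdom g)) w"
  have w: "w = ?u @ gdom g @ ?v" "length ?u = k"
    using 2 by (auto simp: add.commute min_def) (metis append_take_drop_id drop_drop add.commute)
  have "tangle n w (shift k (realize_piece g)) (?u @ gcod g @ ?v)"
    using tangle_shift[OF tangle_real_piece[of n g], of ?u ?v] w by simp
  then show ?case using 2 by (auto simp: tangle_append)
qed simp

context link_functional
begin

lemma eqv_step:
  assumes "local_move n L R" "D = A @ shift k L @ B" "E = A @ shift k R @ B"
    "tangle n w D w'" "tangle n w E w'" "vertex_free D" "vertex_free E"
  shows "eqv w D E"
proof (rule eqvI[OF assms(6,7,4,5)])
  fix T U u v
  assume "link_diagram n (T @ shift (length u) D @ U)" "link_diagram n (T @ shift (length u) E @ U)"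
  then show "F (T @ shift (length u) D @ U) = F (T @ shift (length u) E @ U)"
    using invariant[OF assms(1), of "T @ shift (length u) A" "length u + k" "shift (length u) B @ U"]
    by (simp add: assms(2,3) shift_append)
qed

lemma eqv_swap:
  assumes "tangle n x L x'" "tangle n y R y'" "vertex_free L" "vertex_free R"
    "D = A @ shift (length u) (L @ shift (length x') R) @ B"
    "E = A @ shift (length u) (shift (length x) R @ L) @ B"
    "tangle n w A (u @ (x @ y) @ v)" "tangle n w D w'" "vertex_free A" "vertex_free B"
  shows "eqv w D E"
  by (rule eqv_context[OF eqv_interchange[OF assms(1-4)] assms(5-)])

text \<open>Height exchange takes \<open>R\<close> above the cap, after which the cap and the cup
  are adjacent and straighten. The four variants differ in the side of the bend and in whether an
  output or an input of the tangle is bent.\<close>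

lemma zigzag_left:
  assumes "tangle n x R (d # y)" "vertex_free R"
  shows "eqv x ([(0, Cap d)] @ shift 2 R @ [(1, Cup (opp d))]) R"
proof -
  have R: "tangle n (z @ x) (shift (length z) R) (z @ d # y)" for z
    using tangle_shift[OF assms(1), of z "[]"] by simp
  have 1: "tangle n x ([(0, Cap d)] @ shift 2 R @ [(1, Cup (opp d))]) (d # y)"
    using R[of "[d, opp d]"] by (auto simp: tangle_append as_Suc)
  have "eqv x ([(0, Cap d)] @ shift 2 R @ [(1, Cup (opp d))]) (R @ [(0, Cap d), (1, Cup (opp d))])"
    by (rule eqv_swap[of "[]" "[(0, Cap d)]" "[d, opp d]" x R "d # y" _ "[]" "[]" "[(1, Cup (opp d))]" _ _ "[]", OF _ assms(1) _ _ _ _ _ 1])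
       (use assms in \<open>simp_all add: as_Suc\<close>)
  also have "eqv x \<dots> R"
    by (rule eqv_step[OF local_move.straighten_left[of n d], of _ R 0 "[]" _ _ "d # y"])
       (use assms in \<open>auto simp: tangle_append\<close>)
  finally show ?thesis .
qed

lemma zigzag_right:
  assumes "tangle n x L (y @ [opp d])" "vertex_free L"
  shows "eqv x ([(length x, Cap d)] @ L @ [(length y, Cup (opp d))]) L"
proof -
  have L: "tangle n (x @ z) L (y @ opp d # z)" for z
    using tangle_shift[OF assms(1), of "[]" z] by simp
  have 1: "tangle n x ([(length x, Cap d)] @ L @ [(length y, Cup (opp d))]) (y @ [opp d])"
    using L[of "[d, opp d]"] by (auto simp: tangle_append as_Suc)
  have 2: "tangle n x (L @ [(length y + 1, Cap d), (length y, Cup (opp d))]) (y @ [opp d])"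
    using assms by (auto simp: tangle_append as_Suc)
  have "eqv x (L @ [(length y + 1, Cap d), (length y, Cup (opp d))])
      ([(length x, Cap d)] @ L @ [(length y, Cup (opp d))])"
    by (rule eqv_swap[of x L "y @ [opp d]" "[]" "[(0, Cap d)]" "[d, opp d]" _ "[]" "[]" "[(length y, Cup (opp d))]" _ _ "[]", OF assms(1) _ assms(2) _ _ _ _ 2])
       (use assms in \<open>simp_all add: as_Suc\<close>)
  from eqv_sym[OF this]
  have "eqv x ([(length x, Cap d)] @ L @ [(length y, Cup (opp d))])
    (L @ [(length y + 1, Cap d), (length y, Cup (opp d))])" .
  also have "eqv x \<dots> L"
    by (rule eqv_step[OF local_move.straighten_right[of n "opp d"], of _ L "length y" "[]" _ _ "y @ [opp d]"])
       (use assms 2 in \<open>simp_all add: as_Suc\<close>)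
  finally show ?thesis .
qed

lemma zigzag_left':
  assumes "tangle n (d # x) R y" "vertex_free R"
  shows "eqv (d # x) ([(1, Cap (opp d))] @ shift 2 R @ [(0, Cup d)]) R"
proof -
  have R: "tangle n (z @ d # x) (shift (length z) R) (z @ y)" for z
    using tangle_shift[OF assms(1), of z "[]"] by simp
  have 1: "tangle n (d # x) ([(1, Cap (opp d))] @ shift 2 R @ [(0, Cup d)]) y"
    using R[of "[d, opp d]"] by (auto simp: tangle_append as_Suc)
  have 2: "tangle n (d # x) ([(1, Cap (opp d))] @ [(0, Cup d)] @ R) y"
    using assms by (auto simp: as_Suc)
  have "eqv (d # x) ([(1, Cap (opp d))] @ [(0, Cup d)] @ R) ([(1, Cap (opp d))] @ shift 2 R @ [(0, Cup d)])"
    by (rule eqv_swap[of "[d, opp d]" "[(0, Cup d)]" "[]" "d # x" R y _ "[(1, Cap (opp d))]" "[]" "[]" _ _ "[]", OF _ assms(1) _ assms(2) _ _ _ 2])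
       (use assms in \<open>simp_all add: as_Suc\<close>)
  from eqv_sym[OF this]
  have "eqv (d # x) ([(1, Cap (opp d))] @ shift 2 R @ [(0, Cup d)]) ([(1, Cap (opp d))] @ [(0, Cup d)] @ R)" .
  also have "eqv (d # x) \<dots> R"
    by (rule eqv_step[OF local_move.straighten_right[of n d], of _ "[]" 0 R _ _ y])
       (use assms 2 in \<open>simp_all add: as_Suc\<close>)
  finally show ?thesis .
qed

lemma zigzag_right':
  assumes "tangle n (x @ [d]) L y" "vertex_free L"
  shows "eqv (x @ [d]) ([(length x, Cap d)] @ L @ [(length y, Cup (opp d))]) L"
proof -
  have L: "tangle n (x @ d # z) L (y @ z)" for z
    using tangle_shift[OF assms(1), of "[]" z] by simp
  have 1: "tangle n (x @ [d]) ([(length x, Cap d)] @ L @ [(length y, Cup (opp d))]) y"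
    using L[of "[opp d, d]"] by (auto simp: tangle_append as_Suc)
  have "eqv (x @ [d]) ([(length x, Cap d)] @ L @ [(length y, Cup (opp d))])
     ([(length x, Cap d)] @ [(length x + 1, Cup (opp d))] @ L)"
    by (rule eqv_swap[of "x @ [d]" L y "[opp d, d]" "[(0, Cup (opp d))]" "[]" _ "[(length x, Cap d)]" "[]" "[]" _ _ "[]", OF assms(1) _ assms(2) _ _ _ _ 1])
       (use assms in \<open>simp_all add: as_Suc\<close>)
  also have "eqv (x @ [d]) \<dots> L"
    by (rule eqv_step[OF local_move.straighten_left[of n d], of _ "[]" "length x" L _ _ y])
       (use assms in \<open>simp_all add: as_Suc\<close>)
  finally show ?thesis .
qed

text \<open>A crossing of two upward strands is defined by a half turn in one direction; the half
  turn in the other direction gives the same functional.\<close>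

lemma turn_crossing_eqv:
  "eqv [Up, Up] (realize_piece (GX Up Up s))
     [(0, Cap Up), (1, Cap Up), (2, crossing s), (3, Cup Dn), (2, Cup Dn)]"
  by (rule eqv_step[OF local_move.turn_crossing[of "crossing s"], of _ "[]" 0 "[]" _ _ "[Up, Up]"])
     (simp_all add: crossing_cases as_Suc)

text \<open>Crossings with an upward strand are turned crossings of downward strands, so the two
  sides differ by a zigzag; two upward strands on the right-hand side with \<open>d = Up\<close>
  also need the other half turn. The flag is negated because \<open>z\<close> comes from the top
  right on one side and from the top left on the other.\<close>

lemma slide_cap_eqv:
  "eqv [z] (realize [(0, GCap d), (1, GX (opp d) z s)]) (realize [(1, GCap d), (0, GX z d (\<not> s))])"
proof (cases d; cases z)
  assume "d = Dn" "z = Dn"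
  then show ?thesis
    using zigzag_left[of "[Dn]" "[(1, Cap Dn), (0, crossing (\<not> s))]" Dn "[Dn, Up]"]
    by (simp add: turn_right_def as_Suc)
next
  assume "d = Up" "z = Dn"
  then show ?thesis
    using eqv_sym[OF zigzag_right[of "[Dn]" "[(0, Cap Up), (1, crossing s)]" "[Up, Dn]" Up]]
    by (simp add: turn_left_def as_Suc)
next
  assume "d = Dn" "z = Up"
  then show ?thesis
    using zigzag_left[of "[Up]" "[(1, Cap Dn), (2, Cap Dn), (1, crossing s), (0, Cup Up)]" Dn "[Up, Up]"]
    by (simp add: turn_right_def as_Suc)
next
  assume dz: "d = Up" "z = Up"
  let ?L = "[(0, Cap Up), (1, Cap Up), (2, crossing (\<not> s)), (3, Cup Dn)]"
  have "eqv [Up] ?L ([(1, Cap Up)] @ ?L @ [(2, Cup Dn)])"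
    using eqv_sym[OF zigzag_right[of "[Up]" ?L "[Up, Up]" Up]]
    by (simp add: as_Suc)
  also have "eqv [Up] \<dots> ([(1, Cap Up)] @ realize_piece (GX Up Up (\<not> s)))"
    by (rule eqv_context[OF eqv_sym[OF turn_crossing_eqv[of "\<not> s"]], of _ "[(1, Cap Up)]" "[]" "[]" _ _ "[Dn]" "[Up, Up, Dn]"])
       (simp_all add: as_Suc)
  finally show ?thesis using dz by (simp add: turn_left_def as_Suc)
qed

lemma slide_cup_eqv:
  "eqv [d, z, opp d] (realize [(0, GX d z s), (1, GCup d)])
     (realize [(1, GX z (opp d) (\<not> s)), (0, GCup d)])"
proof (cases d; cases z)
  assume "d = Dn" "z = Dn"
  then show ?thesis
    using eqv_sym[OF zigzag_left'[of Dn "[Dn, Up]" "[(0, crossing s), (1, Cup Dn)]" "[Dn]"]]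
    by (simp add: turn_left_def as_Suc)
next
  assume dz: "d = Dn" "z = Up"
  let ?R = "[(0, Cap Up), (1, crossing (\<not> s)), (2, Cup Dn), (1, Cup Dn)]"
  have "eqv [Dn, Up, Up] ?R ([(1, Cap Up)] @ shift 2 ?R @ [(0, Cup Dn)])"
    using eqv_sym[OF zigzag_left'[of Dn "[Up, Up]" ?R "[Up]"]]
    by (simp add: as_Suc)
  also have "eqv [Dn, Up, Up] \<dots> (shift 1 (realize_piece (GX Up Up (\<not> s))) @ [(0, Cup Dn)])"
    by (rule eqv_context[OF eqv_sym[OF turn_crossing_eqv[of "\<not> s"]], of _ "[]" "[Dn]" "[(0, Cup Dn)]" _ _ "[]" "[Up]"])
       (simp_all add: as_Suc)
  finally show ?thesis using dz by (simp add: turn_left_def as_Suc)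
next
  assume "d = Up" "z = Dn"
  then show ?thesis
    using zigzag_right'[of "[Up, Dn]" Dn "[(1, crossing (\<not> s)), (0, Cup Up)]" "[Dn]"]
    by (simp add: turn_right_def as_Suc)
next
  assume "d = Up" "z = Up"
  then show ?thesis
    using zigzag_right'[of "[Up, Up]" Dn "[(3, Cap Dn), (2, crossing s), (1, Cup Up), (0, Cup Up)]" "[Up]"]
    by (simp add: turn_right_def as_Suc)
qed

text \<open>
  The second crossing is moved along the caps of the first one until it becomes a
  crossing of the same two downward strands.
\<close>

lemma R2_up:
  assumes "(g, h) = (PosX, NegX) \<or> (g, h) = (NegX, PosX)"
  defines "b \<equiv> [(2, Cap Dn), (3, Cap Dn)]" and "e \<equiv> [(1, Cup Up), (0, Cup Up)]"
    and "c \<equiv> [(0, Cap Dn), (1, Cap Dn)] :: diagram"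
  shows "eqv [Up, Up] (b @ [(2, h)] @ e @ b @ [(2, g)] @ e) []"
proof -
  have gh [simp]: "piece_dom n g = [Dn, Dn]" "piece_cod n g = [Dn, Dn]" "g \<noteq> Sink" "g \<noteq> Source"
    "piece_dom n h = [Dn, Dn]" "piece_cod n h = [Dn, Dn]" "h \<noteq> Sink" "h \<noteq> Source"
    using assms(1) by auto
  let ?X = "b @ [(2, g)] @ e"
  have X: "tangle n [Up, Up] ?X [Up, Up]" by (simp add: b_def e_def as_Suc)
  have turn: "eqv [] (c @ shift 2 ?X) (c @ [(0, g)])"
  proof -
    have "eqv [] (c @ shift 2 ?X) (c @ [(0, g)] @ c @ [(3, Cup Up), (2, Cup Up)])"
      by (rule eqv_swap[of "[]" c "[Dn, Dn, Up, Up]" "[]" "c @ [(0, g)]" "[Dn, Dn, Up, Up]" _ "[]" "[]"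
          "[(3, Cup Up), (2, Cup Up)]" _ _ "[]" "[Dn, Dn, Up, Up]"])
         (simp_all add: b_def c_def e_def as_Suc)
    also have "eqv [] \<dots> (c @ [(0, g)] @ [(0, Cap Dn), (1, Cup Up), (1, Cap Dn), (2, Cup Up)])"
      by (rule eqv_step[OF local_move.exchange[of n 1 "Cap Dn" 0 "Cup Up"], of _ "c @ [(0, g), (0, Cap Dn)]" 0
          "[(2, Cup Up)]" _ _ "[Dn, Dn, Up, Up]"])
         (simp_all add: b_def c_def e_def as_Suc)
    also have "eqv [] \<dots> (c @ [(0, g)] @ [(1, Cap Dn), (2, Cup Up)])"
      by (rule eqv_step[OF local_move.straighten_left[of n Dn], of _ "c @ [(0, g)]" 0
          "[(1, Cap Dn), (2, Cup Up)]" _ _ "[Dn, Dn, Up, Up]"])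
         (simp_all add: b_def c_def e_def as_Suc)
    also have "eqv [] \<dots> (c @ [(0, g)])"
      by (rule eqv_step[OF local_move.straighten_left[of n Dn], of _ "c @ [(0, g)]" 1
          "[]" _ _ "[Dn, Dn, Up, Up]"])
         (simp_all add: b_def c_def e_def as_Suc)
    finally show ?thesis .
  qed
  have "eqv [Up, Up] (b @ [(2, h)] @ e @ ?X) (b @ [(2, h)] @ shift 4 ?X @ e)"
    by (rule eqv_swap[of "[Up, Up, Dn, Dn]" e "[]" "[Up, Up]" ?X "[Up, Up]" _ "b @ [(2, h)]" "[]"
          "[]" _ _ "[]" "[Up, Up]"])
       (use X in \<open>simp_all add: b_def e_def as_Suc\<close>)
  also have "eqv [Up, Up] \<dots> (b @ shift 4 ?X @ [(2, h)] @ e)"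
    by (rule eqv_swap[of "[Dn, Dn]" "[(0, h)]" "[Dn, Dn]" "[Up, Up]" ?X "[Up, Up]" _ b "[Up, Up]"
          e _ _ "[]" "[Up, Up]"])
       (use X in \<open>simp_all add: b_def e_def as_Suc\<close>)
  also have "eqv [Up, Up] \<dots> (b @ [(2, g)] @ [(2, h)] @ e)"
    by (rule eqv_context[OF turn, of _ "[]" "[Up, Up]" "[(2, h)] @ e" _ _ "[]" "[Up, Up]"])
       (simp_all add: b_def c_def e_def as_Suc)
  also have "eqv [Up, Up] \<dots> (b @ e)"
    by (rule eqv_step[OF local_move.R2[OF assms(1)], of _ b 2 e _ _ "[Up, Up]"])
       (simp_all add: b_def c_def e_def as_Suc)
  also have "eqv [Up, Up] (b @ e) [(2, Cap Dn), (1, Cup Up), (1, Cap Dn), (0, Cup Up)]"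
    by (rule eqv_sym, rule eqv_step[OF local_move.exchange[of n 1 "Cup Up" 0 "Cap Dn"], of _ "[(2, Cap Dn)]" 0
          "[(0, Cup Up)]" _ _ "[Up, Up]"])
       (simp_all add: b_def c_def e_def as_Suc)
  also have "eqv [Up, Up] \<dots> [(1, Cap Dn), (0, Cup Up)]"
    by (rule eqv_step[OF local_move.straighten_right[of n Up], of _ "[]" 1
          "[(1, Cap Dn), (0, Cup Up)]" _ _ "[Up, Up]"])
       (simp_all add: as_Suc)
  also have "eqv [Up, Up] \<dots> []"
    by (rule eqv_step[OF local_move.straighten_right[of n Up], of _ "[]" 0 "[]" _ _ "[Up, Up]"])
       (simp_all add: as_Suc)
  finally show ?thesis by simp
qed

lemma R2_eqv: "eqv [d, e] (realize [(0, GX d e s), (0, GX e d (\<not> s))]) []"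
proof (cases d; cases e)
  assume "d = Dn" "e = Dn"
  then show ?thesis
    using eqv_step[OF local_move.R2[of "crossing s" "crossing (\<not> s)"], of _ "[]" 0 "[]" _ "[Dn, Dn]" "[Dn, Dn]"]
    by (cases s) (simp_all add: as_Suc)
next
  assume "d = Dn" "e = Up"
  then show ?thesis
    using eqv_step[OF local_move.R2_antiparallel[of "crossing (\<not> s)" "crossing s"], of _ "[]" 0 "[]" _ "[Dn, Up]" "[Dn, Up]"]
    by (cases s) (simp_all add: turn_left_def turn_right_def as_Suc)
next
  assume "d = Up" "e = Dn"
  then show ?thesis
    using eqv_step[OF local_move.R2_antiparallel'[of "crossing (\<not> s)" "crossing s"], of _ "[]" 0 "[]" _ "[Up, Dn]" "[Up, Dn]"]
    by (cases s) (simp_all add: turn_left_def turn_right_def as_Suc)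
next
  assume "d = Up" "e = Up"
  then show ?thesis
    using R2_up[of "crossing (\<not> s)" "crossing s"] by (cases s) (simp_all add: as_Suc)
qed

end

lemma q_root_pow_zero: "q_root_pow 0 = 1"
  by (simp add: q_root_pow_def single_one)

lemma q_root_pow_mult_eq_0 [simp]: "q_root_pow a * x = 0 \<longleftrightarrow> x = 0"
proof
  assume "q_root_pow a * x = 0"
  then have "q_root_pow (- a) * (q_root_pow a * x) = 0" by simp
  then show "x = 0"
    by (simp add: mult.assoc[symmetric] q_root_pow_mult q_root_pow_zero)
qed simp

lemma q_root_pow_nonzero [simp]: "q_root_pow a \<noteq> 0"
  using q_root_pow_mult_eq_0[of a 1] by simp

context link_functional
begin

section \<open>Linear relations as implications between vanishing values\<close>

text \<open>Only the vanishing of \<open>F\<close> is at stake, so a relation can be kept without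
  its coefficients. In this form the skein relation, curls and circles are handled in the same way
  as isotopies.\<close>

definition kills :: "dir list \<Rightarrow> diagram \<Rightarrow> diagram list \<Rightarrow> bool" where
  "kills w L Rs \<longleftrightarrow> (\<forall>T U u v. link_diagram n (T @ shift (length u) L @ U) \<longrightarrow>
     tangle n [] T (u @ w @ v) \<longrightarrow> (\<forall>R\<in>set Rs. F (T @ shift (length u) R @ U) = 0) \<longrightarrow>
     F (T @ shift (length u) L @ U) = 0)"

lemma killsI:
  assumes "\<And>T U u v. link_diagram n (T @ shift (length u) L @ U) \<Longrightarrow>
     tangle n [] T (u @ w @ v) \<Longrightarrow> (\<And>R. R \<in> set Rs \<Longrightarrow> F (T @ shift (length u) R @ U) = 0) \<Longrightarrow>
     F (T @ shift (length u) L @ U) = 0"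
  shows "kills w L Rs"
  using assms unfolding kills_def by blast

lemma killsD:
  "kills w L Rs \<Longrightarrow> link_diagram n (T @ shift (length u) L @ U) \<Longrightarrow>
     tangle n [] T (u @ w @ v) \<Longrightarrow> (\<And>R. R \<in> set Rs \<Longrightarrow> F (T @ shift (length u) R @ U) = 0) \<Longrightarrow>
     F (T @ shift (length u) L @ U) = 0"
  unfolding kills_def by blast

lemma link_replace:
  assumes "link_diagram n (T @ shift (length u) L @ U)" "tangle n [] T (u @ w @ v)"
    "tangle n w L y" "tangle n w R y" "vertex_free R"
  shows "link_diagram n (T @ shift (length u) R @ U)"
proof -
  have "tangle n (u @ y @ v) U []"
    using assms(1-3) by (auto simp: link_diagram_iff intro: tangle_middle)
  then show ?thesis
    using assms tangle_shift[OF assms(4), of u v] unfolding link_diagram_iff tangle_append by auto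
qed

lemma kills_of_eqv:
  assumes "eqv w L R"
  shows "kills w L [R]"
  by (rule killsI) (simp add: eqvD(1)[OF assms])

lemma kills_eqv_left:
  assumes "eqv w L L'" "kills w L' Rs"
  shows "kills w L Rs"
proof (rule killsI)
  fix T U u v
  assume *: "link_diagram n (T @ shift (length u) L @ U)" "tangle n [] T (u @ w @ v)"
    "\<And>R. R \<in> set Rs \<Longrightarrow> F (T @ shift (length u) R @ U) = 0"
  show "F (T @ shift (length u) L @ U) = 0"
    using killsD[OF assms(2) eqvD(2)[OF assms(1) *(1,2)] *(2,3)] eqvD(1)[OF assms(1) *(1,2)] by simp
qed

lemma kills_eqv_right:
  assumes "kills w L (Rs @ [R])" "eqv w R R'" "tangle n w L y" "tangle n w R y"
  shows "kills w L (Rs @ [R'])"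
proof (rule killsI)
  fix T U u v
  assume *: "link_diagram n (T @ shift (length u) L @ U)" "tangle n [] T (u @ w @ v)"
    "\<And>M. M \<in> set (Rs @ [R']) \<Longrightarrow> F (T @ shift (length u) M @ U) = 0"
  have "link_diagram n (T @ shift (length u) R @ U)"
    by (rule link_replace[OF *(1,2) assms(3,4)]) (rule eqv_vertex_free[OF assms(2)])
  then have "F (T @ shift (length u) R @ U) = 0"
    using eqvD(1)[OF assms(2) _ *(2)] *(3)[of R'] by simp
  with *(3) show "F (T @ shift (length u) L @ U) = 0"
    by (intro killsD[OF assms(1) *(1,2)]) auto
qed

lemma kills_context:
  assumes "kills x L Rs" "D = A @ shift (length u) L @ B" "tangle n w A (u @ x @ v)"
    "Ms = map (\<lambda>R. A @ shift (length u) R @ B) Rs"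
  shows "kills w D Ms"
proof (rule killsI)
  fix T U a b
  assume *: "link_diagram n (T @ shift (length a) D @ U)" "tangle n [] T (a @ w @ b)"
    "\<And>R. R \<in> set Ms \<Longrightarrow> F (T @ shift (length a) R @ U) = 0"
  have "tangle n (a @ w @ b) (shift (length a) A) (a @ (u @ x @ v) @ b)"
    using assms(3) by (rule tangle_shift)
  then have "tangle n [] (T @ shift (length a) A) ((a @ u) @ x @ v @ b)"
    using *(2) by (auto simp: tangle_append)
  moreover have "F ((T @ shift (length a) A) @ shift (length (a @ u)) R @ shift (length a) B @ U) = 0"
    if "R \<in> set Rs" for R
    using *(3)[of "A @ shift (length u) R @ B"] that assms(4) by (simp add: shift_append)
  ultimately show "F (T @ shift (length a) D @ U) = 0"
    using killsD[OF assms(1), of "T @ shift (length a) A" "a @ u" "shift (length a) B @ U" "v @ b"]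
      *(1) assms(2) by (simp add: shift_append)
qed

text \<open>The coefficients of both crossings are units, so the relation can be solved for either
  of them.\<close>

lemma skein_down: "kills [Dn, Dn] [(0, crossing s)] [[(0, crossing (\<not> s))], []]"
proof (rule killsI)
  fix T U u v
  assume *: "link_diagram n (T @ shift (length u) [(0, crossing s)] @ U)" "tangle n [] T (u @ [Dn, Dn] @ v)"
    and 0: "\<And>R. R \<in> set [[(0, crossing (\<not> s))], []] \<Longrightarrow> F (T @ shift (length u) R @ U) = 0"
  have "link_diagram n (T @ shift (length u) [(0, PosX)] @ U)"
    by (rule link_replace[OF *, of "[Dn, Dn]"]) simp_all
  then have "q_root_pow 1 * F (T @ [(length u, PosX)] @ U) = q_root_pow (- 1) * F (T @ [(length u, NegX)] @ U)"
    using skein[of T "length u" U] 0[of "[]"] by simp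
  then show "F (T @ shift (length u) [(0, crossing s)] @ U) = 0"
    using 0[of "[(0, crossing (\<not> s))]"] by (cases s) auto
qed

lemma caps_cups_up:
  "eqv [Up, Up] [(2, Cap Dn), (3, Cap Dn), (1, Cup Up), (0, Cup Up)] []"
proof -
  have "eqv [Up, Up] [(2, Cap Dn), (3, Cap Dn), (1, Cup Up), (0, Cup Up)]
      [(2, Cap Dn), (1, Cup Up), (1, Cap Dn), (0, Cup Up)]"
    by (rule eqv_sym, rule eqv_step[OF local_move.exchange[of n 1 "Cup Up" 0 "Cap Dn"], of _ "[(2, Cap Dn)]" 0
          "[(0, Cup Up)]" _ _ "[Up, Up]"])
       (simp_all add: as_Suc)
  also have "eqv [Up, Up] \<dots> [(1, Cap Dn), (0, Cup Up)]"
    by (rule eqv_step[OF local_move.straighten_right[of n Up], of _ "[]" 1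
          "[(1, Cap Dn), (0, Cup Up)]" _ _ "[Up, Up]"])
       (simp_all add: as_Suc)
  also have "eqv [Up, Up] \<dots> []"
    by (rule eqv_step[OF local_move.straighten_right[of n Up], of _ "[]" 0 "[]" _ _ "[Up, Up]"])
       (simp_all add: as_Suc)
  finally show ?thesis .
qed

definition smoothing :: "dir \<Rightarrow> dir \<Rightarrow> gdiagram" where
  "smoothing d e = (if d = e then [] else [(0, GCup d), (0, GCap e)])"

text \<open>The relation is applied to the downward crossing inside the turned one. For antiparallel
  strands the result contains a cap beside a cup, and height exchange puts the cup on top; for
  upward strands the remaining caps and cups straighten.\<close>

lemma skein_kills:
  "kills [d, e] (realize [(0, GX d e s)]) [realize [(0, GX d e (\<not> s))], realize (smoothing d e)]"
proof (cases d; cases e)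
  assume "d = Dn" "e = Dn"
  then show ?thesis using skein_down[of s] by (simp add: smoothing_def)
next
  assume de: "d = Dn" "e = Up"
  have "kills [Dn, Up] (realize [(0, GX Dn Up s)]) ([realize [(0, GX Dn Up (\<not> s))]] @ [[(0, Cap Up), (2, Cup Dn)]])"
    by (rule kills_context[OF skein_down[of "\<not> s"], of _ "[(0, Cap Up)]" "[Up]" "[(2, Cup Dn)]" _ "[Up]"])
       (simp_all add: turn_left_def as_Suc)
  moreover have "eqv [Dn, Up] [(0, Cap Up), (2, Cup Dn)] [(0, Cup Dn), (0, Cap Up)]"
    by (rule eqv_step[OF local_move.exchange[of n 0 "Cap Up" 0 "Cup Dn"], of _ "[]" 0 "[]" _ _ "[Up, Dn]"])
       (simp_all add: as_Suc)
  ultimately have "kills [Dn, Up] (realize [(0, GX Dn Up s)]) ([realize [(0, GX Dn Up (\<not> s))]] @ [[(0, Cup Dn), (0, Cap Up)]])"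
    by (rule kills_eqv_right[of _ _ _ _ _ "[Up, Dn]"]) (simp_all add: turn_left_def as_Suc)
  then show ?thesis using de by (simp add: smoothing_def)
next
  assume de: "d = Up" "e = Dn"
  have "kills [Up, Dn] (realize [(0, GX Up Dn s)]) ([realize [(0, GX Up Dn (\<not> s))]] @ [[(2, Cap Dn), (0, Cup Up)]])"
    by (rule kills_context[OF skein_down[of "\<not> s"], of _ "[(2, Cap Dn)]" "[Up]" "[(0, Cup Up)]" _ "[Up]"])
       (simp_all add: turn_right_def as_Suc)
  moreover have "eqv [Up, Dn] [(2, Cap Dn), (0, Cup Up)] [(0, Cup Up), (0, Cap Dn)]"
    by (rule eqv_sym, rule eqv_step[OF local_move.exchange[of n 0 "Cup Up" 0 "Cap Dn"], of _ "[]" 0 "[]" _ _ "[Dn, Up]"])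
       (simp_all add: as_Suc)
  ultimately have "kills [Up, Dn] (realize [(0, GX Up Dn s)]) ([realize [(0, GX Up Dn (\<not> s))]] @ [[(0, Cup Up), (0, Cap Dn)]])"
    by (rule kills_eqv_right[of _ _ _ _ _ "[Dn, Up]"]) (simp_all add: turn_right_def as_Suc)
  then show ?thesis using de by (simp add: smoothing_def)
next
  assume de: "d = Up" "e = Up"
  have "kills [Up, Up] (realize [(0, GX Up Up s)])
      ([realize [(0, GX Up Up (\<not> s))]] @ [[(2, Cap Dn), (3, Cap Dn), (1, Cup Up), (0, Cup Up)]])"
    by (rule kills_context[OF skein_down[of s], of _ "[(2, Cap Dn), (3, Cap Dn)]" "[Up, Up]" "[(1, Cup Up), (0, Cup Up)]" _ "[Up, Up]"])
       (simp_all add: as_Suc)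
  then have "kills [Up, Up] (realize [(0, GX Up Up s)]) ([realize [(0, GX Up Up (\<not> s))]] @ [[]])"
    by (rule kills_eqv_right[OF _ caps_cups_up, of _ _ "[Up, Up]"]) (simp_all add: as_Suc)
  then show ?thesis using de by (simp add: smoothing_def)
qed

lemma circle_kills: "kills [] (realize [(0, GCap d), (0, GCup d)]) [realize []]"
proof (rule killsI)
  fix T U u v
  assume *: "link_diagram n (T @ shift (length u) (realize [(0, GCap d), (0, GCup d)]) @ U)"
    and 0: "\<And>R. R \<in> set [realize []] \<Longrightarrow> F (T @ shift (length u) R @ U) = 0"
  then show "F (T @ shift (length u) (realize [(0, GCap d), (0, GCup d)]) @ U) = 0"
    using trivial_knot[of T "length u" d U] 0[of "[]"] by simp
qed

lemma curl_kills:
  assumes "C = curl_right (crossing s) \<or> C = curl_left (crossing s)"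
  shows "kills [Dn] C [[]]"
proof (rule killsI)
  fix T U u v
  assume *: "link_diagram n (T @ shift (length u) C @ U)"
    and 0: "\<And>R. R \<in> set [[]] \<Longrightarrow> F (T @ shift (length u) R @ U) = 0"
  then show "F (T @ shift (length u) C @ U) = 0"
    using positive_curl[OF *] negative_curl[OF *] assms 0[of "[]"] by (cases s) auto
qed

text \<open>After an exchange of the given cap with the cap of the quarter turn, the diagram
  contains a small curl on a downward strand.\<close>

lemma loop_cap_kills:
  "kills [] (realize [(0, GCap d), (0, GX d (opp d) s)]) [realize [(0, GCap (opp d))]]"
proof (cases d)
  case Dn
  have "eqv [] [(0, Cap Dn), (0, Cap Up), (1, crossing (\<not> s)), (2, Cup Dn)]
     [(0, Cap Up), (2, Cap Dn), (1, crossing (\<not> s)), (2, Cup Dn)]"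
    by (rule eqv_sym, rule eqv_step[OF local_move.exchange[of n 0 "Cap Up" 0 "Cap Dn"], of _ "[]" 0
        "[(1, crossing (\<not> s)), (2, Cup Dn)]" _ _ "[Up, Dn]"])
       (simp_all add: as_Suc)
  moreover have "kills [] [(0, Cap Up), (2, Cap Dn), (1, crossing (\<not> s)), (2, Cup Dn)] [[(0, Cap Up)]]"
    by (rule kills_context[OF curl_kills[of "curl_right (crossing (\<not> s))" "\<not> s"], of _ "[(0, Cap Up)]" "[Up]" "[]" _ "[]"])
       (simp_all add: curl_right_def as_Suc)
  ultimately show ?thesis using Dn kills_eqv_left by (simp add: turn_left_def as_Suc)
next
  case Up
  have "eqv [] [(0, Cap Up), (2, Cap Dn), (1, crossing (\<not> s)), (0, Cup Up)]
     [(0, Cap Dn), (0, Cap Up), (1, crossing (\<not> s)), (0, Cup Up)]"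
    by (rule eqv_step[OF local_move.exchange[of n 0 "Cap Up" 0 "Cap Dn"], of _ "[]" 0
        "[(1, crossing (\<not> s)), (0, Cup Up)]" _ _ "[Dn, Up]"])
       (simp_all add: as_Suc)
  moreover have "kills [] [(0, Cap Dn), (0, Cap Up), (1, crossing (\<not> s)), (0, Cup Up)] [[(0, Cap Dn)]]"
    by (rule kills_context[OF curl_kills[of "curl_left (crossing (\<not> s))" "\<not> s"], of _ "[(0, Cap Dn)]" "[]" "[]" _ "[Up]"])
       (simp_all add: curl_left_def as_Suc)
  ultimately show ?thesis using Up kills_eqv_left by (simp add: turn_right_def as_Suc)
qed

lemma loop_cup_kills:
  "kills [opp d, d] (realize [(0, GX (opp d) d s), (0, GCup d)]) [realize [(0, GCup (opp d))]]"
proof (cases d)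
  case Dn
  have "eqv [Up, Dn] [(2, Cap Dn), (1, crossing (\<not> s)), (0, Cup Up), (0, Cup Dn)]
     [(2, Cap Dn), (1, crossing (\<not> s)), (2, Cup Dn), (0, Cup Up)]"
    by (rule eqv_step[OF local_move.exchange[of n 0 "Cup Up" 0 "Cup Dn"], of _ "[(2, Cap Dn), (1, crossing (\<not> s))]" 0
        "[]" _ _ "[]"])
       (simp_all add: as_Suc)
  moreover have "kills [Up, Dn] [(2, Cap Dn), (1, crossing (\<not> s)), (2, Cup Dn), (0, Cup Up)] [[(0, Cup Up)]]"
    by (rule kills_context[OF curl_kills[of "curl_right (crossing (\<not> s))" "\<not> s"], of _ "[]" "[Up]" "[(0, Cup Up)]" _ "[]"])
       (simp_all add: curl_right_def as_Suc)
  ultimately show ?thesis using Dn kills_eqv_left by (simp add: turn_right_def as_Suc)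
next
  case Up
  have "eqv [Dn, Up] [(0, Cap Up), (1, crossing (\<not> s)), (2, Cup Dn), (0, Cup Up)]
     [(0, Cap Up), (1, crossing (\<not> s)), (0, Cup Up), (0, Cup Dn)]"
    by (rule eqv_sym, rule eqv_step[OF local_move.exchange[of n 0 "Cup Up" 0 "Cup Dn"], of _ "[(0, Cap Up), (1, crossing (\<not> s))]" 0
        "[]" _ _ "[]"])
       (simp_all add: as_Suc)
  moreover have "kills [Dn, Up] [(0, Cap Up), (1, crossing (\<not> s)), (0, Cup Up), (0, Cup Dn)] [[(0, Cup Dn)]]"
    by (rule kills_context[OF curl_kills[of "curl_left (crossing (\<not> s))" "\<not> s"], of _ "[]" "[]" "[(0, Cup Dn)]" _ "[Up]"])
       (simp_all add: curl_left_def as_Suc)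
  ultimately show ?thesis using Up kills_eqv_left by (simp add: turn_left_def as_Suc)
qed

lemma gstep:
  assumes "eqv x (realize L) (realize R)" "G = A @ gshift (length u) L @ B" "H = A @ gshift (length u) R @ B"
    "gtangle w A (u @ x @ v)" "gtangle w G w'"
  shows "eqv w (realize G) (realize H)"
  by (rule eqv_context[OF assms(1), of _ "realize A" u "realize B" _ _ v w'])
     (use assms(2,3) tangle_realize[OF assms(4)] tangle_realize[OF assms(5)] in simp_all)

lemma R2_realize: "eqv [d, e] (realize [(0, GX d e s), (0, GX e d (\<not> s))]) (realize [])"
  using R2_eqv[of d e s] by simp

lemma exchange_eqv:
  "eqv (gdom g @ m @ gdom h) (realize [(0, g), (length (gcod g) + length m, h)])
     (realize [(length (gdom g) + length m, h), (0, g)])"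
  using eqv_interchange[of "gdom g @ m" "realize_piece g" "gcod g @ m" "gdom h" "realize_piece h" "gcod h"]
    tangle_shift[OF tangle_real_piece[of n g], of "[]" m]
  by (simp add: tangle_real_piece vertex_free_real_piece)

section \<open>The third Reidemeister move for all directions\<close>

definition R3_at :: "dir \<Rightarrow> dir \<Rightarrow> dir \<Rightarrow> bool \<Rightarrow> bool \<Rightarrow> bool \<Rightarrow> bool" where
  "R3_at d e f a b c \<longleftrightarrow> eqv [d, e, f] (realize [(0, GX d e a), (1, GX d f b), (0, GX e f c)])
     (realize [(1, GX e f c), (0, GX d f b), (1, GX d e a)])"

lemma R3_down: "R3_at Dn Dn Dn True True True"
  unfolding R3_at_def
  by (rule eqv_step[OF local_move.R3, of _ "[]" 0 "[]" _ _ "[Dn, Dn, Dn]"]) (simp_all add: as_Suc)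

text \<open>Conjugation by the crossing of the first two strands: R2 creates a cancelling pair at
  the bottom, the given relation carries one crossing of it to the top, and there R2 cancels
  it.\<close>

lemma R3_swap:
  assumes "R3_at d e f a b c"
  shows "R3_at e d f (\<not> a) c b"
proof -
  have "eqv [e, d, f] (realize [(0, GX e d (\<not> a)), (1, GX e f c), (0, GX d f b)])
    (realize [(0, GX e d (\<not> a)), (1, GX e f c), (0, GX d f b), (1, GX d e a), (1, GX e d (\<not> a))])"
    by (rule eqv_sym, rule gstep[OF R2_realize[of d e a], of _ "[(0, GX e d (\<not> a)), (1, GX e f c), (0, GX d f b)]" "[f]" "[]" _ _ "[]" "[f, d, e]"])
       (simp_all add: as_Suc)
  also have "eqv [e, d, f] \<dots> (realize [(0, GX e d (\<not> a)), (0, GX d e a), (1, GX d f b), (0, GX e f c), (1, GX e d (\<not> a))])"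
    by (rule gstep[OF eqv_sym[OF assms[unfolded R3_at_def]], of _ "[(0, GX e d (\<not> a))]" "[]" "[(1, GX e d (\<not> a))]" _ _ "[]" "[f, d, e]"])
       (simp_all add: as_Suc)
  also have "eqv [e, d, f] \<dots> (realize [(1, GX d f b), (0, GX e f c), (1, GX e d (\<not> a))])"
    by (rule gstep[OF R2_realize[of e d "\<not> a"], of _ "[]" "[]" "[(1, GX d f b), (0, GX e f c), (1, GX e d (\<not> a))]" _ _ "[f]" "[f, d, e]"])
       (simp_all add: as_Suc)
  finally show ?thesis unfolding R3_at_def .
qed

lemma zigzag_left_realize: "eqv [d] (realize [(0, GCap d), (1, GCup (opp d))]) (realize [])"
  by (rule eqv_step[OF local_move.straighten_left[of n d], of _ "[]" 0 "[]" _ _ "[d]"]) (simp_all add: as_Suc)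

lemma zigzag_right_realize: "eqv [d] (realize [(1, GCap (opp d)), (0, GCup d)]) (realize [])"
  by (rule eqv_step[OF local_move.straighten_right[of n d], of _ "[]" 0 "[]" _ _ "[d]"]) (simp_all add: as_Suc)

text \<open>Both sides are rotated by a cap on the right and a cup on the left.\<close>

lemma R3_rot:
  assumes "R3_at d e f a b c"
  shows "R3_at (opp f) d e (\<not> b) (\<not> c) a"
proof -
  let ?o = "opp f" and ?w = "[opp f, d, e]" and ?w' = "[e, d, opp f]"
  have 1: "eqv ?w (realize [(3, GCap f), (1, GX d e a), (2, GX d f b), (1, GX e f c), (0, GCup ?o)])
      (realize [(1, GX d e a), (0, GX ?o e (\<not> c)), (1, GX ?o d (\<not> b))])"
  proof -
    have "eqv ?w (realize [(3, GCap f), (1, GX d e a), (2, GX d f b), (1, GX e f c), (0, GCup ?o)])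
       (realize [(3, GCap f), (1, GX d e a), (2, GX d f b), (0, GX ?o e (\<not> c)), (1, GCup ?o)])"
      by (rule gstep[OF eqv_sym[OF slide_cup_eqv[of ?o e "\<not> c"]], of _ "[(3, GCap f), (1, GX d e a), (2, GX d f b)]" "[]" "[]" _ _ "[d, ?o]" ?w'])
         (simp_all add: as_Suc)
    also have "eqv ?w \<dots> (realize [(1, GX d e a), (3, GCap f), (2, GX d f b), (0, GX ?o e (\<not> c)), (1, GCup ?o)])"
      by (rule gstep[OF eqv_sym[OF exchange_eqv[of "GX d e a" "[]" "GCap f"]], of _ "[]" "[?o]" "[(2, GX d f b), (0, GX ?o e (\<not> c)), (1, GCup ?o)]" _ _ "[]" ?w'])
         (simp_all add: as_Suc)
    also have "eqv ?w \<dots> (realize [(1, GX d e a), (2, GCap f), (3, GX ?o d (\<not> b)), (0, GX ?o e (\<not> c)), (1, GCup ?o)])"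
      by (rule gstep[OF eqv_sym[OF slide_cap_eqv[of d f "\<not> b"]], of _ "[(1, GX d e a)]" "[?o, e]" "[(0, GX ?o e (\<not> c)), (1, GCup ?o)]" _ _ "[]" ?w'])
         (simp_all add: as_Suc)
    also have "eqv ?w \<dots> (realize [(1, GX d e a), (2, GCap f), (0, GX ?o e (\<not> c)), (3, GX ?o d (\<not> b)), (1, GCup ?o)])"
      by (rule gstep[OF eqv_sym[OF exchange_eqv[of "GX ?o e (\<not> c)" "[f]" "GX ?o d (\<not> b)"]], of _ "[(1, GX d e a), (2, GCap f)]" "[]" "[(1, GCup ?o)]" _ _ "[]" ?w'])
         (simp_all add: as_Suc)
    also have "eqv ?w \<dots> (realize [(1, GX d e a), (0, GX ?o e (\<not> c)), (2, GCap f), (3, GX ?o d (\<not> b)), (1, GCup ?o)])"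
      by (rule gstep[OF eqv_sym[OF exchange_eqv[of "GX ?o e (\<not> c)" "[]" "GCap f"]], of _ "[(1, GX d e a)]" "[]" "[(3, GX ?o d (\<not> b)), (1, GCup ?o)]" _ _ "[d]" ?w'])
         (simp_all add: as_Suc)
    also have "eqv ?w \<dots> (realize [(1, GX d e a), (0, GX ?o e (\<not> c)), (2, GCap f), (1, GCup ?o), (1, GX ?o d (\<not> b))])"
      by (rule gstep[OF eqv_sym[OF exchange_eqv[of "GCup ?o" "[]" "GX ?o d (\<not> b)"]], of _ "[(1, GX d e a), (0, GX ?o e (\<not> c)), (2, GCap f)]" "[e]" "[]" _ _ "[]" ?w'])
         (simp_all add: as_Suc)
    also have "eqv ?w \<dots> (realize [(1, GX d e a), (0, GX ?o e (\<not> c)), (1, GX ?o d (\<not> b))])"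
      by (rule gstep[OF zigzag_right_realize[of ?o], of _ "[(1, GX d e a), (0, GX ?o e (\<not> c))]" "[e]" "[(1, GX ?o d (\<not> b))]" _ _ "[d]" ?w'])
         (simp_all add: as_Suc)
    finally show ?thesis .
  qed
  have 2: "eqv ?w (realize [(3, GCap f), (2, GX e f c), (1, GX d f b), (2, GX d e a), (0, GCup ?o)])
      (realize [(0, GX ?o d (\<not> b)), (1, GX ?o e (\<not> c)), (0, GX d e a)])"
  proof -
    have "eqv ?w (realize [(3, GCap f), (2, GX e f c), (1, GX d f b), (2, GX d e a), (0, GCup ?o)])
       (realize [(3, GCap f), (2, GX e f c), (1, GX d f b), (0, GCup ?o), (0, GX d e a)])"
      by (rule gstep[OF eqv_sym[OF exchange_eqv[of "GCup ?o" "[]" "GX d e a"]], of _ "[(3, GCap f), (2, GX e f c), (1, GX d f b)]" "[]" "[]" _ _ "[?o]" ?w'])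
         (simp_all add: as_Suc)
    also have "eqv ?w \<dots> (realize [(3, GCap f), (2, GX e f c), (0, GX ?o d (\<not> b)), (1, GCup ?o), (0, GX d e a)])"
      by (rule gstep[OF eqv_sym[OF slide_cup_eqv[of ?o d "\<not> b"]], of _ "[(3, GCap f), (2, GX e f c)]" "[]" "[(0, GX d e a)]" _ _ "[e, ?o]" ?w'])
         (simp_all add: as_Suc)
    also have "eqv ?w \<dots> (realize [(3, GCap f), (0, GX ?o d (\<not> b)), (2, GX e f c), (1, GCup ?o), (0, GX d e a)])"
      by (rule gstep[OF eqv_sym[OF exchange_eqv[of "GX ?o d (\<not> b)" "[]" "GX e f c"]], of _ "[(3, GCap f)]" "[]" "[(1, GCup ?o), (0, GX d e a)]" _ _ "[?o]" ?w'])
         (simp_all add: as_Suc)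
    also have "eqv ?w \<dots> (realize [(0, GX ?o d (\<not> b)), (3, GCap f), (2, GX e f c), (1, GCup ?o), (0, GX d e a)])"
      by (rule gstep[OF eqv_sym[OF exchange_eqv[of "GX ?o d (\<not> b)" "[e]" "GCap f"]], of _ "[]" "[]" "[(2, GX e f c), (1, GCup ?o), (0, GX d e a)]" _ _ "[]" ?w'])
         (simp_all add: as_Suc)
    also have "eqv ?w \<dots> (realize [(0, GX ?o d (\<not> b)), (2, GCap f), (3, GX ?o e (\<not> c)), (1, GCup ?o), (0, GX d e a)])"
      by (rule gstep[OF eqv_sym[OF slide_cap_eqv[of e f "\<not> c"]], of _ "[(0, GX ?o d (\<not> b))]" "[d, ?o]" "[(1, GCup ?o), (0, GX d e a)]" _ _ "[]" ?w'])
         (simp_all add: as_Suc)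
    also have "eqv ?w \<dots> (realize [(0, GX ?o d (\<not> b)), (2, GCap f), (1, GCup ?o), (1, GX ?o e (\<not> c)), (0, GX d e a)])"
      by (rule gstep[OF eqv_sym[OF exchange_eqv[of "GCup ?o" "[]" "GX ?o e (\<not> c)"]], of _ "[(0, GX ?o d (\<not> b)), (2, GCap f)]" "[d]" "[(0, GX d e a)]" _ _ "[]" ?w'])
         (simp_all add: as_Suc)
    also have "eqv ?w \<dots> (realize [(0, GX ?o d (\<not> b)), (1, GX ?o e (\<not> c)), (0, GX d e a)])"
      by (rule gstep[OF zigzag_right_realize[of ?o], of _ "[(0, GX ?o d (\<not> b))]" "[d]" "[(1, GX ?o e (\<not> c)), (0, GX d e a)]" _ _ "[e]" ?w'])
         (simp_all add: as_Suc)
    finally show ?thesis .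
  qed
  have 3: "eqv ?w (realize [(3, GCap f), (1, GX d e a), (2, GX d f b), (1, GX e f c), (0, GCup ?o)])
     (realize [(3, GCap f), (2, GX e f c), (1, GX d f b), (2, GX d e a), (0, GCup ?o)])"
    by (rule gstep[OF assms[unfolded R3_at_def], of _ "[(3, GCap f)]" "[?o]" "[(0, GCup ?o)]" _ _ "[?o]" ?w'])
       (simp_all add: as_Suc)
  show ?thesis
    unfolding R3_at_def by (rule eqv_trans[OF eqv_sym[OF 2] eqv_trans[OF eqv_sym[OF 3] 1]])
qed

text \<open>One triple of flags for each triple of directions suffices, because flags may be changed
  modulo diagrams with fewer crossings. Rotation sends \<open>(d, e, f)\<close> to
  \<open>(opp f, d, e)\<close> and leads from all strands downward through six of the eight triples;
  the two alternating triples form an orbit of their own and are reached by a swap.\<close>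

lemma R3_all: "\<exists>a b c. R3_at d e f a b c"
proof -
  have ddd: "\<exists>a b c. R3_at Dn Dn Dn a b c" using R3_down by blast
  have udd: "\<exists>a b c. R3_at Up Dn Dn a b c" using ddd R3_rot by fastforce
  have uud: "\<exists>a b c. R3_at Up Up Dn a b c" using udd R3_rot by fastforce
  have uuu: "\<exists>a b c. R3_at Up Up Up a b c" using uud R3_rot by fastforce
  have duu: "\<exists>a b c. R3_at Dn Up Up a b c" using uuu R3_rot by fastforce
  have ddu: "\<exists>a b c. R3_at Dn Dn Up a b c" using duu R3_rot by fastforce
  have dud: "\<exists>a b c. R3_at Dn Up Dn a b c" using udd R3_swap by fastforce
  have udu: "\<exists>a b c. R3_at Up Dn Up a b c" using duu R3_swap by fastforce
  show ?thesis using ddd udd uud uuu duu ddu dud udu by (cases d; cases e; cases f) auto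
qed

end

section \<open>Vanishing on link diagrams\<close>

fun kind_of :: "gpiece \<Rightarrow> kind" where
  "kind_of (GCap d) = KCap"
| "kind_of (GCup d) = KCup"
| "kind_of (GX d e s) = KX"

lemma kind_of_iff:
  "kind_of g = KCap \<longleftrightarrow> (\<exists>d. g = GCap d)"
  "kind_of g = KCup \<longleftrightarrow> (\<exists>d. g = GCup d)"
  "kind_of g = KX \<longleftrightarrow> (\<exists>d e s. g = GX d e s)"
  by (cases g; simp)+

lemma length_gdom: "length (gdom g) = kdom (kind_of g)" "length (gcod g) = kcod (kind_of g)"
  by (cases g; simp)+

definition shape :: "gdiagram \<Rightarrow> shadow" where
  "shape G = map (\<lambda>(k, g). (k, kind_of g)) G"

lemma shape_simps [simp]:
  "shape [] = []" "shape ((k, g) # G) = (k, kind_of g) # shape G"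
  "shape (G @ H) = shape G @ shape H"
  by (simp_all add: shape_def)

lemma shape_append_conv:
  "shape G = T @ U \<Longrightarrow> \<exists>A B. G = A @ B \<and> shape A = T \<and> shape B = U"
  unfolding shape_def by (auto simp: map_eq_append_conv)

lemma shape_Cons_conv:
  "shape G = (k, g) # U \<longleftrightarrow> (\<exists>p H. G = (k, p) # H \<and> kind_of p = g \<and> shape H = U)"
  unfolding shape_def by (auto simp: map_eq_Cons_conv)

lemma shape_Nil_conv [simp]: "shape G = [] \<longleftrightarrow> G = []"
  by (simp add: shape_def)

definition cross :: "shadow \<Rightarrow> nat" where
  "cross D = length (filter (\<lambda>(k, g). g = KX) D)"

lemma cross_simps [simp]:
  "cross [] = 0" "cross ((k, g) # D) = (if g = KX then 1 else 0) + cross D"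
  "cross (D @ E) = cross D + cross E"
  by (simp_all add: cross_def)

lemma cross_rule: "shadow_rule L R \<Longrightarrow> cross R \<le> cross L"
  by (induction rule: shadow_rule.induct) auto

lemma gtangle_Cons:
  "gtangle w ((k, g) # G) w' \<longleftrightarrow>
     (\<exists>u v. w = u @ gdom g @ v \<and> length u = k \<and> gtangle (u @ gcod g @ v) G w')"
proof
  assume *: "gtangle w ((k, g) # G) w'"
  let ?u = "take k w" and ?v = "drop (k + length (gdom g)) w"
  have "w = ?u @ gdom g @ ?v" "length ?u = k"
    using * by (auto simp: add.commute min_def) (metis append_take_drop_id drop_drop add.commute)
  moreover have "gtangle (?u @ gcod g @ ?v) G w'" using * by simp
  ultimately show "\<exists>u v. w = u @ gdom g @ v \<and> length u = k \<and> gtangle (u @ gcod g @ v) G w'"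
    by blast
qed auto

lemma gtangle_width: "gtangle w G w' \<Longrightarrow> width (length w) (shape G) (length w')"
proof (induction G arbitrary: w)
  case (Cons s G)
  obtain k g where s: "s = (k, g)" by (cases s)
  with Cons.prems obtain u v where uv: "w = u @ gdom g @ v" "length u = k" "gtangle (u @ gcod g @ v) G w'"
    by (auto simp: gtangle_Cons simp del: gtangle.simps)
  show ?case using Cons.IH[OF uv(3)] uv(1,2) s by (simp add: length_gdom ac_simps)
qed simp

lemma gtangle_det: "gtangle w G x \<Longrightarrow> gtangle w G y \<Longrightarrow> x = y"
  by (induction w G x rule: gtangle.induct) auto

lemma gtangle_shift: "gtangle w G w' \<Longrightarrow> gtangle (u @ w @ v) (gshift (length u) G) (u @ w' @ v)"
proof (induction G arbitrary: w)
  case (Cons s G)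
  obtain k g where s: "s = (k, g)" by (cases s)
  with Cons.prems obtain a b where ab: "w = a @ gdom g @ b" "length a = k" "gtangle (a @ gcod g @ b) G w'"
    by (auto simp: gtangle_Cons simp del: gtangle.simps)
  have "u @ w @ v = (u @ a) @ gdom g @ b @ v" "length (u @ a) = length u + k"
    "gtangle ((u @ a) @ gcod g @ b @ v) (gshift (length u) G) (u @ w' @ v)"
    using ab Cons.IH[OF ab(3)] by simp_all
  then show ?case
    unfolding s gshift_simps gtangle_Cons by blast
qed simp

lemma gtangle_replace:
  assumes "gtangle [] (A @ gshift (length u) L @ B) w" "gtangle [] A (u @ x @ v)"
    "gtangle x L y" "gtangle x R y"
  shows "gtangle [] (A @ gshift (length u) R @ B) w"
proof -
  obtain a b where ab: "gtangle [] A a" "gtangle a (gshift (length u) L) b" "gtangle b B w"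
    using assms(1) by (auto simp: gtangle_append)
  have "a = u @ x @ v" using ab(1) assms(2) by (rule gtangle_det)
  then have "b = u @ y @ v"
    using ab(2) gtangle_shift[OF assms(3), of u v] by (auto dest: gtangle_det)
  then show ?thesis
    using assms(2) ab(3) gtangle_shift[OF assms(4), of u v] unfolding gtangle_append by blast
qed

section \<open>Diagrams up to over/under information\<close>

fun same_piece :: "gpiece \<Rightarrow> gpiece \<Rightarrow> bool" where
  "same_piece (GX d e s) (GX d' e' s') \<longleftrightarrow> d = d' \<and> e = e'"
| "same_piece g h \<longleftrightarrow> g = h"

lemma same_piece_iff:
  "same_piece g h \<longleftrightarrow> g = h \<or> (\<exists>d e s. g = GX d e s \<and> h = GX d e (\<not> s))"
  by (cases "(g, h)" rule: same_piece.cases) auto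

definition same :: "gdiagram \<Rightarrow> gdiagram \<Rightarrow> bool" where
  "same = list_all2 (\<lambda>(j, g) (k, h). j = k \<and> same_piece g h)"

lemma same_simps [simp]:
  "same [] []" "same ((j, g) # G) ((k, h) # H) \<longleftrightarrow> j = k \<and> same_piece g h \<and> same G H"
  by (simp_all add: same_def)

lemma same_refl [simp]: "same G G"
  by (auto simp: same_def same_piece_iff intro!: list.rel_refl)

lemma same_append: "same G G' \<Longrightarrow> same H H' \<Longrightarrow> same (G @ H) (G' @ H')"
  unfolding same_def by (rule list_all2_appendI)

lemma same_piece_dom: "same_piece g h \<Longrightarrow> gdom g = gdom h \<and> gcod g = gcod h \<and> kind_of g = kind_of h"
  by (auto simp: same_piece_iff)

lemma same_gtangle: "same G H \<Longrightarrow> gtangle w G w' \<longleftrightarrow> gtangle w H w'"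
  unfolding same_def by (induction arbitrary: w rule: list_all2_induct) (auto dest: same_piece_dom)

lemma list_split_three:
  assumes "k + l \<le> length w"
  obtains u x v where "w = u @ x @ v" "length u = k" "length x = l"
proof
  show "w = take k w @ take l (drop k w) @ drop l (drop k w)"
    by (simp only: append_take_drop_id)
qed (use assms in auto)

context link_functional
begin

definition vanishes_below :: "nat \<Rightarrow> bool" where
  "vanishes_below c \<longleftrightarrow> (\<forall>G. gtangle [] G [] \<longrightarrow> cross (shape G) < c \<longrightarrow> F (realize G) = 0)"

definition vanishes :: "shadow \<Rightarrow> bool" where
  "vanishes D \<longleftrightarrow> (\<forall>G. gtangle [] G [] \<longrightarrow> shape G = D \<longrightarrow> F (realize G) = 0)"

lemma kills_realize:
  assumes "kills x (realize L) (map realize Rs)" "gtangle [] (A @ gshift (length u) L @ B) []"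
    "gtangle [] A (u @ x @ v)"
    "\<And>R. R \<in> set Rs \<Longrightarrow> F (realize (A @ gshift (length u) R @ B)) = 0"
  shows "F (realize (A @ gshift (length u) L @ B)) = 0"
proof -
  have "link_diagram n (realize A @ shift (length u) (realize L) @ realize B)"
    using tangle_realize[OF assms(2), of n] by (simp add: link_diagram_iff)
  then show ?thesis
    using killsD[OF assms(1), of "realize A" u "realize B" v] tangle_realize[OF assms(3), of n] assms(4)
    by auto
qed

text \<open>The values at the two signs are tied together by the smoothing, which has one crossing
  less and is therefore covered by \<open>vanishes_below c\<close>.\<close>

lemma flip_crossing:
  assumes "vanishes_below c" "gtangle [] (A @ [(k, GX d e s)] @ B) []"
    "cross (shape (A @ [(k, GX d e s)] @ B)) \<le> c"
    "F (realize (A @ [(k, GX d e (\<not> s))] @ B)) = 0"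
  shows "F (realize (A @ [(k, GX d e s)] @ B)) = 0"
proof -
  obtain u v where uv: "gtangle [] A (u @ [d, e] @ v)" "length u = k"
    using assms(2) by (auto simp: gtangle_append gtangle_Cons simp del: gtangle.simps)
  have "gtangle [d, e] (smoothing d e) [e, d]"
    by (cases d; cases e) (simp_all add: smoothing_def)
  with assms(2) uv have "gtangle [] (A @ gshift k (smoothing d e) @ B) []"
    using gtangle_replace[of A u "[(0, GX d e s)]" B "[]" "[d, e]" v "[e, d]" "smoothing d e"] by simp
  moreover have "cross (shape (A @ gshift k (smoothing d e) @ B)) < c"
    using assms(3) by (auto simp: smoothing_def)
  ultimately have "F (realize (A @ gshift k (smoothing d e) @ B)) = 0"
    using assms(1) unfolding vanishes_below_def by blast
  moreover have "F (realize (A @ gshift (length u) [(0, GX d e s)] @ B)) = 0"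
    if "\<And>R. R \<in> set [[(0, GX d e (\<not> s))], smoothing d e] \<Longrightarrow>
      F (realize (A @ gshift (length u) R @ B)) = 0"
    by (rule kills_realize[of "[d, e]" _ "[[(0, GX d e (\<not> s))], smoothing d e]", OF _ _ uv(1) that])
       (use skein_kills[of d e s] assms(2) uv(2) in simp_all)
  ultimately show ?thesis
    using assms(4) uv(2) by fastforce
qed

lemma flip_crossings:
  assumes "vanishes_below c" "same G H" "gtangle [] (A @ G) []" "cross (shape (A @ G)) \<le> c"
    "F (realize (A @ H)) = 0"
  shows "F (realize (A @ G)) = 0"
  using assms(2-)[unfolded same_def]
proof (induction arbitrary: A rule: list_all2_induct)
  case (Cons s G t H)
  obtain k g h where st: "s = (k, g)" "t = (k, h)" "same_piece g h"
    using Cons.hyps(1) by (cases s; cases t) auto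
  have GH: "same G H" using Cons.hyps(2) by (simp add: same_def)
  have closed: "gtangle [] ((A @ [t]) @ G) []" "cross (shape ((A @ [t]) @ G)) \<le> c"
    using Cons.prems st same_gtangle[OF same_append[of A A "s # G" "t # G"], of "[]" "[]"]
      same_piece_dom[OF st(3)] by simp_all
  have 0: "F (realize ((A @ [t]) @ G)) = 0"
    using Cons.prems by (intro Cons.IH closed) simp
  from st(3) consider "g = h" | d e s where "g = GX d e s" "h = GX d e (\<not> s)"
    unfolding same_piece_iff by blast
  then show ?case
  proof cases
    case 1
    then show ?thesis using 0 st by simp
  next
    case 2
    then show ?thesis
      using flip_crossing[OF assms(1), of A k _ _ _ G] Cons.prems st 0 by simp
  qed
qed simp

section \<open>Lifting the reduction rules to oriented diagrams\<close>

text \<open>The lift may adjust the over/under information: \<open>L'\<close> is a variant of the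
  given diagram for which a local relation holds, for instance a bigon with opposite flags in the
  case of R2.\<close>

definition realizes_rule :: "shadow \<Rightarrow> shadow \<Rightarrow> bool" where
  "realizes_rule L R \<longleftrightarrow> (\<forall>G w w'. shape G = L \<longrightarrow> gtangle w G w' \<longrightarrow>
     (\<exists>u x v y L' R'. w = u @ x @ v \<and> same G (gshift (length u) L') \<and> gtangle x L' y \<and>
        gtangle x R' y \<and> shape (gshift (length u) R') = R \<and> kills x (realize L') [realize R']))"

lemma realizes_ruleI:
  assumes "w = u @ x @ v" "same G (gshift (length u) L')" "gtangle x L' y" "gtangle x R' y"
    "shape (gshift (length u) R') = R" "kills x (realize L') [realize R']"
  shows "\<exists>u x v y L' R'. w = u @ x @ v \<and> same G (gshift (length u) L') \<and> gtangle x L' y \<and>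
        gtangle x R' y \<and> shape (gshift (length u) R') = R \<and> kills x (realize L') [realize R']"
  using assms by blast

text \<open>Flips lead from the given diagram to the variant \<open>L'\<close>, at the cost of
  diagrams with fewer crossings only; the local relation leads from \<open>L'\<close> to a diagram
  of the reduced shape.\<close>

lemma vanishes_rule:
  assumes "realizes_rule L R" "vanishes_below c" "cross (T @ L @ U) \<le> c" "vanishes (T @ R @ U)"
  shows "vanishes (T @ L @ U)"
  unfolding vanishes_def
proof (intro allI impI)
  fix G
  assume G: "gtangle [] G []" "shape G = T @ L @ U"
  then obtain A M B where G': "G = A @ M @ B" "shape A = T" "shape M = L" "shape B = U"
    by (metis shape_append_conv)
  obtain w w' where w: "gtangle [] A w" "gtangle w M w'"
    using G(1) G'(1) by (auto simp: gtangle_append)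
  obtain u x v y L' R' where *: "w = u @ x @ v" "same M (gshift (length u) L')" "gtangle x L' y"
    "gtangle x R' y" "shape (gshift (length u) R') = R" "kills x (realize L') [realize R']"
    using assms(1) G'(3) w(2) unfolding realizes_rule_def by blast
  have same: "same (M @ B) (gshift (length u) L' @ B)"
    by (rule same_append[OF *(2) same_refl])
  have closed: "gtangle [] (A @ gshift (length u) L' @ B) []"
    using same_gtangle[OF same_append[OF same_refl same], of "[]" A "[]"] G(1) G'(1) by simp
  have "gtangle [] (A @ gshift (length u) R' @ B) []"
    by (rule gtangle_replace[OF closed w(1)[unfolded *(1)] *(3,4)])
  then have "F (realize (A @ gshift (length u) R' @ B)) = 0"
    using assms(4)[unfolded vanishes_def, rule_format, of "A @ gshift (length u) R' @ B"] G' *(5)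
    by simp
  then have "F (realize (A @ gshift (length u) L' @ B)) = 0"
    using kills_realize[of x L' "[R']" A u B v] *(6) closed w(1)[unfolded *(1)] by simp
  then show "F (realize G) = 0"
    using flip_crossings[OF assms(2) same, of A] G G' assms(3) by simp
qed

text \<open>The exchange rules are treated apart from the others because the number of strands
  between the two pieces is arbitrary; these strands, \<open>x\<close>, are made part of the local
  word.\<close>

lemma realizes_exchange:
  "realizes_rule [(j, g), (j + kcod g + m, h)] [(j + kdom g + m, h), (j, g)]"
  unfolding realizes_rule_def
proof (intro allI impI, goal_cases)
  case G: (1 G w w')
  then obtain p q where pq: "G = [(j, p), (j + kcod g + m, q)]" "kind_of p = g" "kind_of q = h"
    by (auto simp: shape_Cons_conv)
  from G(2) obtain u a where u: "w = u @ gdom p @ a" "length u = j"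
    and "gtangle (u @ gcod p @ a) [(j + kcod g + m, q)] w'"
    unfolding pq(1) gtangle_Cons by blast
  then obtain b v where b: "u @ gcod p @ a = b @ gdom q @ v" "length b = length u + kcod g + m"
    unfolding gtangle_Cons by auto
  define x where "x = take m a"
  have a: "a = x @ gdom q @ v" "length x = m"
  proof -
    have "drop (length b) (u @ gcod p @ a) = gdom q @ v" using b(1) by simp
    then have d: "drop m a = gdom q @ v" using b(2) pq(2) length_gdom(2)[of p] by simp
    then show "a = x @ gdom q @ v" unfolding x_def by (metis append_take_drop_id)
    have "length (u @ gcod p @ a) = length (b @ gdom q @ v)" using b(1) by simp
    then show "length x = m" using b(2) pq(2) length_gdom(2)[of p] by (simp add: x_def)
  qed
  show ?case
  proof (rule realizes_ruleI)
    show "w = u @ (gdom p @ x @ gdom q) @ v" using u(1) a(1) by simp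
    show "same G (gshift (length u) [(0, p), (length (gcod p) + length x, q)])"
      using pq u(2) a(2) by (simp add: length_gdom same_piece_iff)
    show "kills (gdom p @ x @ gdom q) (realize [(0, p), (length (gcod p) + length x, q)])
        [realize [(length (gdom p) + length x, q), (0, p)]]"
      by (rule kills_of_eqv[OF exchange_eqv])
    show "gtangle (gdom p @ x @ gdom q) [(0, p), (length (gcod p) + length x, q)] (gcod p @ x @ gcod q)"
      by simp
    show "gtangle (gdom p @ x @ gdom q) [(length (gdom p) + length x, q), (0, p)] (gcod p @ x @ gcod q)"
      by simp
  qed (use pq u(2) a(2) in \<open>simp add: length_gdom\<close>)
qed

lemma realizes_exchange':
  "realizes_rule [(j + kdom g + m, h), (j, g)] [(j, g), (j + kcod g + m, h)]"
  unfolding realizes_rule_def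
proof (intro allI impI, goal_cases)
  case G: (1 G w w')
  then obtain p q where pq: "G = [(j + kdom g + m, q), (j, p)]" "kind_of p = g" "kind_of q = h"
    by (auto simp: shape_Cons_conv)
  from G(2) obtain c v where c: "w = c @ gdom q @ v" "length c = j + kdom g + m"
    and "gtangle (c @ gcod q @ v) [(j, p)] w'"
    unfolding pq(1) gtangle_Cons by blast
  then obtain u a where u: "c @ gcod q @ v = u @ gdom p @ a" "length u = j"
    unfolding gtangle_Cons by auto
  define x where "x = drop (length (u @ gdom p)) c"
  have x: "c = u @ gdom p @ x" "length x = m"
  proof -
    have "take (length (u @ gdom p)) (c @ gcod q @ v) = u @ gdom p" using u(1) by simp
    then have "take (length (u @ gdom p)) c = u @ gdom p"
      using c(2) u(2) pq(2) length_gdom(1)[of p] by simp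
    then show "c = u @ gdom p @ x" unfolding x_def by (metis append_assoc append_take_drop_id)
    show "length x = m" using c(2) u(2) pq(2) length_gdom(1)[of p] by (simp add: x_def)
  qed
  show ?case
  proof (rule realizes_ruleI)
    show "w = u @ (gdom p @ x @ gdom q) @ v" using c(1) x(1) by simp
    show "same G (gshift (length u) [(length (gdom p) + length x, q), (0, p)])"
      using pq u(2) x(2) by (simp add: length_gdom same_piece_iff)
    show "kills (gdom p @ x @ gdom q) (realize [(length (gdom p) + length x, q), (0, p)])
        [realize [(0, p), (length (gcod p) + length x, q)]]"
      by (rule kills_of_eqv[OF eqv_sym[OF exchange_eqv]])
    show "gtangle (gdom p @ x @ gdom q) [(0, p), (length (gcod p) + length x, q)] (gcod p @ x @ gcod q)"
      by simp
    show "gtangle (gdom p @ x @ gdom q) [(length (gdom p) + length x, q), (0, p)] (gcod p @ x @ gcod q)"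
      by simp
  qed (use pq u(2) x(2) in \<open>simp add: length_gdom\<close>)
qed

definition sshift :: "nat \<Rightarrow> shadow \<Rightarrow> shadow" where
  "sshift k D = map (\<lambda>(j, g). (k + j, g)) D"

lemma shape_gshift [simp]: "shape (gshift k G) = sshift k (shape G)"
  by (auto simp: shape_def gshift_def sshift_def)

lemma shape_eq_sshift: "shape G = sshift k D \<Longrightarrow> \<exists>H. G = gshift k H \<and> shape H = D"
proof (induction D arbitrary: G)
  case (Cons s D)
  obtain j g where s: "s = (j, g)" by (cases s)
  with Cons.prems obtain p H where "G = (k + j, p) # H" "kind_of p = g" "shape H = sshift k D"
    by (auto simp: sshift_def shape_Cons_conv)
  moreover from Cons.IH[OF this(3)] obtain H' where "H = gshift k H'" "shape H' = D" by blast
  ultimately have "G = gshift k ((j, p) # H')" "shape ((j, p) # H') = s # D"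
    using s by simp_all
  then show ?case by blast
qed (auto simp: sshift_def)

text \<open>The shift keeps the pieces away from \<open>u\<close> and the width condition keeps them
  away from \<open>v\<close>, so the typing restricts to \<open>x\<close>.\<close>

lemma gtangle_unshift:
  assumes "gtangle (u @ x @ v) (gshift (length u) G) w'" "width (length x) (shape G) l"
  shows "\<exists>y. gtangle x G y"
  using assms
proof (induction G arbitrary: x)
  case (Cons s G)
  obtain j p where s: "s = (j, p)" by (cases s)
  define x1 x2 where "x1 = take j x" and "x2 = drop (j + length (gdom p)) x"
  have j: "j + length (gdom p) \<le> length x" "width (length x - length (gdom p) + length (gcod p)) (shape G) l"
    using Cons.prems(2)[unfolded s shape_simps width.simps] unfolding length_gdom by blast+
  have "take (length (gdom p)) (drop (length u + j) (u @ x @ v)) = gdom p"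
    using Cons.prems(1) s by simp
  then have *: "take (length (gdom p)) (drop j x) = gdom p" using j(1) by simp
  have x: "x = x1 @ gdom p @ x2"
    unfolding x1_def x2_def using * by (metis append_take_drop_id drop_drop add.commute)
  have x1: "length x1 = j" using j(1) by (simp add: x1_def)
  have "gtangle (u @ (x1 @ gcod p @ x2) @ v) (gshift (length u) G) w'"
    using Cons.prems(1) s x1 by (simp add: x)
  moreover have "width (length (x1 @ gcod p @ x2)) (shape G) l"
  proof -
    have "length x - length (gdom p) + length (gcod p) = length (x1 @ gcod p @ x2)"
      by (subst x) simp
    with j(2) show ?thesis by simp
  qed
  ultimately obtain y where "gtangle (x1 @ gcod p @ x2) G y" using Cons.IH by blast
  then have "gtangle x (s # G) y" unfolding s using x1 by (simp add: x)
  then show ?case ..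
qed (metis gtangle.simps(1))

definition locally_realizes :: "dir list \<Rightarrow> gdiagram \<Rightarrow> dir list \<Rightarrow> shadow \<Rightarrow> bool" where
  "locally_realizes x G y B \<longleftrightarrow>
     (\<exists>L R. same G L \<and> gtangle x R y \<and> shape R = B \<and> kills x (realize L) [realize R])"

lemma locally_realizesI:
  "kills z (realize L) [realize R] \<Longrightarrow> x = z \<Longrightarrow> same G L \<Longrightarrow> gtangle z R y \<Longrightarrow>
     shape R = B \<Longrightarrow> locally_realizes x G y B"
  unfolding locally_realizes_def by blast

lemmas locally_realizes_eqv = locally_realizesI[OF kills_of_eqv]

text \<open>A rule on a fixed number \<open>l\<close> of strands needs to be lifted only at position
  0 and on words of length \<open>l\<close>, where the directions of all pieces can be decoded from
  the word and the shape.\<close>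

lemma realizes_local:
  assumes "\<And>x G y. length x = l \<Longrightarrow> shape G = A \<Longrightarrow> gtangle x G y \<Longrightarrow> locally_realizes x G y B"
    and "width l A l'" "\<And>m m'. width m (sshift k A) m' \<Longrightarrow> k + l \<le> m"
    and "L = sshift k A" "R = sshift k B"
  shows "realizes_rule L R"
  unfolding realizes_rule_def
proof (intro allI impI, goal_cases)
  case G: (1 G w w')
  from gtangle_width[OF G(2)] have "k + l \<le> length w" using assms(3,4) G(1) by simp
  then obtain u x v where w: "w = u @ x @ v" "length u = k" "length x = l" by (rule list_split_three)
  obtain H where H: "G = gshift k H" "shape H = A" using shape_eq_sshift G(1) assms(4) by blast
  obtain y where y: "gtangle x H y"
    using gtangle_unshift[of u x v H w' l'] G(2) H w assms(2) by auto
  from assms(1)[OF w(3) H(2) y] obtain M N where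
    LR: "same H M" "gtangle x N y" "shape N = B" "kills x (realize M) [realize N]"
    unfolding locally_realizes_def by blast
  have "same G (gshift (length u) M)"
    using LR(1) unfolding H(1) w(2) same_def gshift_def
    by (auto simp: list_all2_map1 list_all2_map2 elim!: list.rel_mono_strong)
  moreover have "gtangle x M y" using LR(1) y by (simp add: same_gtangle)
  ultimately show ?case
    using w LR assms(5) by (intro realizes_ruleI[of w u x v G M y N]) auto
qed

lemmas decode = shape_Cons_conv kind_of_iff length_Suc_conv as_Suc same_piece_iff

lemma shadow_rule_realizes: "shadow_rule L R \<Longrightarrow> realizes_rule L R"
proof (induction rule: shadow_rule.induct)
  case (straighten_left k)
  show ?case
  proof (rule realizes_local[where l = 1 and k = k and A = "[(0, KCap), (1, KCup)]" and B = "[]"], goal_cases)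
    case (1 x G y)
    then obtain d where "x = [d]" by (auto simp: length_Suc_conv)
    with 1 have "G = [(0, GCap d), (1, GCup (opp d))]" "x = [d]" "y = [d]" by (auto simp: decode)
    then show ?case by (intro locally_realizes_eqv[OF zigzag_left_realize[of d]]) simp_all
  qed (auto simp: sshift_def)
next
  case (straighten_right k)
  show ?case
  proof (rule realizes_local[where l = 1 and k = k and A = "[(1, KCap), (0, KCup)]" and B = "[]"], goal_cases)
    case (1 x G y)
    then obtain d where "x = [d]" by (auto simp: length_Suc_conv)
    with 1 have "G = [(1, GCap (opp d)), (0, GCup d)]" "x = [d]" "y = [d]" by (auto simp: decode)
    then show ?case by (intro locally_realizes_eqv[OF zigzag_right_realize[of d]]) simp_all
  qed (auto simp: sshift_def)
next
  case (circle k)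
  show ?case
  proof (rule realizes_local[where l = 0 and k = k and A = "[(0, KCap), (0, KCup)]" and B = "[]"], goal_cases)
    case (1 x G y)
    then obtain d where "x = []" "G = [(0, GCap d), (0, GCup d)]" "y = []" by (auto simp: decode)
    then show ?case by (intro locally_realizesI[OF circle_kills[of d]]) simp_all
  qed (auto simp: sshift_def)
next
  case (R2 k)
  show ?case
  proof (rule realizes_local[where l = 2 and k = k and A = "[(0, KX), (0, KX)]" and B = "[]"], goal_cases)
    case (1 x G y)
    then obtain d e s t where "x = [d, e]" "G = [(0, GX d e s), (0, GX e d t)]" "y = [d, e]"
      by (auto simp: decode)
    then show ?case
      by (intro locally_realizes_eqv[OF R2_realize[of d e s]]) (auto simp: same_piece_iff)
  qed (auto simp: sshift_def)
next
  case (R3 k)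
  show ?case
  proof (rule realizes_local[where l = 3 and k = k and A = "[(1, KX), (0, KX), (1, KX)]"
        and B = "[(0, KX), (1, KX), (0, KX)]"], goal_cases)
    case (1 x G y)
    then obtain d e f s t r where x: "x = [d, e, f]"
      "G = [(1, GX e f s), (0, GX d f t), (1, GX d e r)]" "y = [f, e, d]"
      by (auto simp: decode)
    \<comment> \<open>These flags need not agree with \<open>s\<close>, \<open>t\<close>,
      \<open>r\<close>: \<open>same\<close> disregards them.\<close>
    obtain a b c where R3: "R3_at d e f a b c" using R3_all by blast
    from x show ?case
      by (intro locally_realizes_eqv[OF eqv_sym[OF R3[unfolded R3_at_def]]]) (auto simp: same_piece_iff as_Suc)
  qed (auto simp: sshift_def as_Suc)
next
  case (slide_cap k)
  show ?case
  proof (rule realizes_local[where l = 1 and k = k and A = "[(0, KCap), (1, KX)]" and B = "[(1, KCap), (0, KX)]"], goal_cases)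
    case (1 x G y)
    then obtain z d s where "x = [z]" "G = [(0, GCap d), (1, GX (opp d) z s)]" "y = [d, z, opp d]"
      by (auto simp: decode)
    then show ?case by (intro locally_realizes_eqv[OF slide_cap_eqv[of z d s]]) (simp_all add: as_Suc)
  qed (auto simp: sshift_def)
next
  case (slide_cap' k)
  show ?case
  proof (rule realizes_local[where l = 1 and k = k and A = "[(1, KCap), (0, KX)]" and B = "[(0, KCap), (1, KX)]"], goal_cases)
    case (1 x G y)
    then obtain z d s where "x = [z]" "G = [(1, GCap d), (0, GX z d s)]" "y = [d, z, opp d]"
      by (auto simp: decode)
    then show ?case
      by (intro locally_realizes_eqv[OF eqv_sym[OF slide_cap_eqv[of z d "\<not> s"]]]) (simp_all add: as_Suc)
  qed (auto simp: sshift_def)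
next
  case (slide_cup k)
  show ?case
  proof (rule realizes_local[where l = 3 and k = k and A = "[(0, KX), (1, KCup)]" and B = "[(1, KX), (0, KCup)]"], goal_cases)
    case (1 x G y)
    from 1(2) obtain p q s r where G: "G = [(0, GX p q s), (1, GCup r)]"
      by (auto simp: shape_Cons_conv kind_of_iff)
    from 1(1) obtain a b c where x: "x = [a, b, c]" by (auto simp: length_Suc_conv numeral_3_eq_3)
    with 1(3) G have "p = a" "q = b" "r = a" "c = opp a" "y = [b]" by simp_all
    with x G show ?case by (intro locally_realizes_eqv[OF slide_cup_eqv[of a b s]]) (simp_all add: as_Suc)
  qed (auto simp: sshift_def)
next
  case (slide_cup' k)
  show ?case
  proof (rule realizes_local[where l = 3 and k = k and A = "[(1, KX), (0, KCup)]" and B = "[(0, KX), (1, KCup)]"], goal_cases)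
    case (1 x G y)
    from 1(2) obtain p q s r where G: "G = [(1, GX p q s), (0, GCup r)]"
      by (auto simp: shape_Cons_conv kind_of_iff)
    from 1(1) obtain a b c where x: "x = [a, b, c]" by (auto simp: length_Suc_conv numeral_3_eq_3)
    with 1(3) G have "p = b" "q = c" "r = a" "c = opp a" "y = [b]" by simp_all
    with x G show ?case
      by (intro locally_realizes_eqv[OF eqv_sym[OF slide_cup_eqv[of a b "\<not> s"]]]) (simp_all add: as_Suc)
  qed (auto simp: sshift_def)
next
  case (loop_cap k)
  show ?case
  proof (rule realizes_local[where l = 0 and k = k and A = "[(0, KCap), (0, KX)]" and B = "[(0, KCap)]"], goal_cases)
    case (1 x G y)
    then obtain d s where "x = []" "G = [(0, GCap d), (0, GX d (opp d) s)]" "y = [opp d, d]"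
      by (auto simp: decode)
    then show ?case by (intro locally_realizesI[OF loop_cap_kills[of d s]]) simp_all
  qed (auto simp: sshift_def)
next
  case (loop_cup k)
  show ?case
  proof (rule realizes_local[where l = 2 and k = k and A = "[(0, KX), (0, KCup)]" and B = "[(0, KCup)]"], goal_cases)
    case (1 x G y)
    from 1(2) obtain p q s d where G: "G = [(0, GX p q s), (0, GCup d)]"
      by (auto simp: shape_Cons_conv kind_of_iff)
    from 1(1) obtain a b where x: "x = [a, b]" by (auto simp: length_Suc_conv numeral_2_eq_2)
    with 1(3) G have "p = a" "q = b" "b = d" "a = opp d" "y = []" by simp_all
    with x G show ?case by (intro locally_realizesI[OF loop_cup_kills[of d s]]) (simp_all add: as_Suc)
  qed (auto simp: sshift_def)
qed (rule realizes_exchange realizes_exchange')+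

section \<open>Induction on the number of crossings\<close>

lemma cross_red1: "red1 D E \<Longrightarrow> cross E \<le> cross D"
  by (auto elim!: red1.cases dest!: cross_rule)

lemma vanishes_red:
  assumes "red D []" "vanishes_below c" "cross D \<le> c" "F [] = 0"
  shows "vanishes D"
  using assms(1,3)
proof (induction rule: converse_rtranclp_induct)
  case base
  then show ?case using assms(4) by (auto simp: vanishes_def)
next
  case (step D E)
  then have "vanishes E" using cross_red1[OF step.hyps(1)] by simp
  from step.hyps(1) show ?case
  proof cases
    case (red1 L R T U)
    then show ?thesis
      using vanishes_rule[OF shadow_rule_realizes assms(2)] \<open>vanishes E\<close> step.prems by simp
  qed
qed

text \<open>A reduction never adds crossings, so all shapes along it have at most \<open>c\<close>
  crossings, and the induction hypothesis allows free changes of over/under information all the way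
  down to the empty diagram.\<close>

lemma vanishes_below_all:
  assumes "F [] = 0"
  shows "vanishes_below c"
proof (induction c)
  case (Suc c)
  have "F (realize G) = 0" if "gtangle [] G []" "cross (shape G) < Suc c" for G
  proof -
    have "red (shape G) []"
      using gtangle_width[OF that(1)] by (intro closed_shadow_reduces) simp
    from vanishes_red[OF this Suc] that assms show ?thesis unfolding vanishes_def by simp
  qed
  then show ?case unfolding vanishes_below_def by blast
qed (simp add: vanishes_below_def)

text \<open>In a link diagram the primitive crossings have two downward strands. The last clause is
  meant for \<open>PosX\<close>; its value on discs is a default.\<close>

fun gpiece_of :: "piece \<Rightarrow> gpiece" where
  "gpiece_of (Cap d) = GCap d"
| "gpiece_of (Cup d) = GCup d"
| "gpiece_of NegX = GX Dn Dn False"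
| "gpiece_of _ = GX Dn Dn True"

theorem link_vanishes:
  assumes "link_diagram n D" "F [] = 0"
  shows "F D = 0"
proof -
  define G where "G = map (\<lambda>(k, g). (k, gpiece_of g)) D"
  have "gtangle w (map (\<lambda>(k, g). (k, gpiece_of g)) D) w' \<and> realize (map (\<lambda>(k, g). (k, gpiece_of g)) D) = D"
    if "tangle n w D w'" "vertex_free D" for w w'
    using that
  proof (induction D arbitrary: w)
    case (Cons s D)
    obtain k g where "s = (k, g)" by (cases s)
    with Cons show ?case by (cases g) (auto simp: as_Suc)
  qed simp
  from this[of "[]" "[]"] have "gtangle [] G []" "realize G = D"
    using assms(1) by (auto simp: link_diagram_iff G_def)
  then show ?thesis
    using vanishes_below_all[OF assms(2), of "Suc (cross (shape G))"] unfolding vanishes_below_def by auto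
qed

end

section \<open>The state sum\<close>

definition q_pow :: "nat \<Rightarrow> int \<Rightarrow> laurent" where
  "q_pow n k = q_root_pow (int n * k)"

lemma q_pow_mult: "q_pow n a * q_pow n b = q_pow n (a + b)"
  by (simp add: q_pow_def q_root_pow_mult distrib_left)

lemma q_pow_mult': "q_pow n a * (q_pow n b * x) = q_pow n (a + b) * x"
  by (simp add: q_pow_mult mult.assoc[symmetric])

lemma q_pow_zero [simp]: "q_pow n 0 = 1"
  by (simp add: q_pow_def q_root_pow_zero)

definition q_diff :: "nat \<Rightarrow> laurent" where
  "q_diff n = q_pow n 1 - q_pow n (- 1)"

fun invs :: "nat list \<Rightarrow> nat" where
  "invs [] = 0"
| "invs (x # xs) = length (filter (\<lambda>y. y < x) xs) + invs xs"

text \<open>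
  The weight \<open>q\<^bsup>n + 1 - 2a\<^esup>\<close> of a full turn is put on one of the two directions of a cap and of a cup,
  which avoids half-integer powers of \<open>q\<close>.
\<close>

fun cap_weight :: "nat \<Rightarrow> dir \<Rightarrow> nat \<Rightarrow> laurent" where
  "cap_weight n Dn a = q_pow n (int n + 1 - 2 * int a)"
| "cap_weight n Up a = 1"

fun cup_weight :: "nat \<Rightarrow> dir \<Rightarrow> nat \<Rightarrow> laurent" where
  "cup_weight n Dn a = 1"
| "cup_weight n Up a = q_pow n (2 * int a - int n - 1)"

text \<open>The row of the R-matrix at the top labels \<open>a\<close>, \<open>b\<close>, paired
  with a function \<open>f\<close> of the bottom labels from left to right. The factor
  \<open>q^(-1/n)\<close> is the normalization that the skein relation with roots of
  \<open>q\<close> requires; \<open>neg_op\<close> is the inverse matrix.\<close>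

definition pos_op :: "nat \<Rightarrow> nat \<Rightarrow> nat \<Rightarrow> (nat \<Rightarrow> nat \<Rightarrow> laurent) \<Rightarrow> laurent" where
  "pos_op n a b f = q_root_pow (- 1) *
     (if a < b then f b a else if a = b then q_pow n 1 * f a a else f b a + q_diff n * f a b)"

definition neg_op :: "nat \<Rightarrow> nat \<Rightarrow> nat \<Rightarrow> (nat \<Rightarrow> nat \<Rightarrow> laurent) \<Rightarrow> laurent" where
  "neg_op n a b f = q_root_pow 1 *
     (if a < b then f b a - q_diff n * f a b else if a = b then q_pow n (- 1) * f a a else f b a)"

definition perms :: "nat set \<Rightarrow> nat list set" where
  "perms A = {xs. distinct xs \<and> set xs = A}"

lemma finite_perms: "finite A \<Longrightarrow> finite (perms A)"
  by (rule finite_subset[OF _ finite_lists_length_eq[of A "card A"]])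
     (auto simp: perms_def distinct_card)

definition neg_q_inv :: "nat \<Rightarrow> laurent" where
  "neg_q_inv n = - q_pow n (- 1)"

text \<open>An operator takes a function of the labels below the piece to a function of the labels
  above it, so a diagram is evaluated from the bottom up. The factor \<open>q^(n(n-1))\<close> of
  the \<open>vertex\<close> axiom is given to the source alone; in the diagrams of interest each
  sink meets its source, and only the product of the two weights enters.\<close>

fun piece_op :: "nat \<Rightarrow> piece \<Rightarrow> (nat list \<Rightarrow> laurent) \<Rightarrow> nat list \<Rightarrow> laurent" where
  "piece_op n (Cap d) \<phi> xs = (\<Sum>a\<in>{1..n}. cap_weight n d a * \<phi> [a, a])"
| "piece_op n (Cup d) \<phi> xs = (if xs ! 0 = xs ! 1 then cup_weight n d (xs ! 0) * \<phi> [] else 0)"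
| "piece_op n PosX \<phi> xs = pos_op n (xs ! 0) (xs ! 1) (\<lambda>a b. \<phi> [a, b])"
| "piece_op n NegX \<phi> xs = neg_op n (xs ! 0) (xs ! 1) (\<lambda>a b. \<phi> [a, b])"
| "piece_op n Sink \<phi> xs = (if distinct xs then neg_q_inv n ^ invs xs * \<phi> [] else 0)"
| "piece_op n Source \<phi> xs =
     q_pow n (int n * (int n - 1)) * (\<Sum>ys\<in>perms {1..n}. neg_q_inv n ^ invs ys * \<phi> ys)"

fun step :: "nat \<Rightarrow> slice \<Rightarrow> (nat list \<Rightarrow> laurent) \<Rightarrow> nat list \<Rightarrow> laurent" where
  "step n (k, g) \<phi> c = piece_op n g
     (\<lambda>y. \<phi> (take k c @ y @ drop (k + length (piece_dom n g)) c))
     (take (length (piece_dom n g)) (drop k c))"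

fun amp :: "nat \<Rightarrow> diagram \<Rightarrow> (nat list \<Rightarrow> laurent) \<Rightarrow> nat list \<Rightarrow> laurent" where
  "amp n [] \<phi> = \<phi>"
| "amp n (s # D) \<phi> = step n s (amp n D \<phi>)"

definition vacuum :: "nat list \<Rightarrow> laurent" where
  "vacuum c = (if c = [] then 1 else 0)"

definition state_sum :: "nat \<Rightarrow> diagram \<Rightarrow> laurent" where
  "state_sum n D = amp n D vacuum []"

lemma amp_append: "amp n (D @ E) \<phi> = amp n D (amp n E \<phi>)"
  by (induction D) auto

lemma step_local:
  "length u = k \<Longrightarrow> length x = length (piece_dom n g) \<Longrightarrow>
     step n (k, g) \<phi> (u @ x @ v) = piece_op n g (\<lambda>y. \<phi> (u @ y @ v)) x"
  by simp

definition colors :: "nat \<Rightarrow> nat \<Rightarrow> nat list \<Rightarrow> bool" where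
  "colors n l x \<longleftrightarrow> length x = l \<and> set x \<subseteq> {1..n}"

text \<open>
  All operators above are finite linear combinations of evaluations at colourings of \<open>l\<close> strands.
  This gives linearity, the exchange of distant pieces and independence of junk values.
\<close>

definition repr :: "nat \<Rightarrow> nat \<Rightarrow> ((nat list \<Rightarrow> laurent) \<Rightarrow> laurent) \<Rightarrow> bool" where
  "repr n l T \<longleftrightarrow> (\<exists>Y M. finite Y \<and> (\<forall>y\<in>Y. colors n l y) \<and> (\<forall>\<phi>. T \<phi> = (\<Sum>y\<in>Y. M y * \<phi> y)))"

lemma reprI:
  "finite Y \<Longrightarrow> (\<And>y. y \<in> Y \<Longrightarrow> colors n l y) \<Longrightarrow> (\<And>\<phi>. T \<phi> = (\<Sum>y\<in>Y. M y * \<phi> y)) \<Longrightarrow> repr n l T"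
  unfolding repr_def by blast

lemma repr_zero: "repr n l (\<lambda>\<phi>. 0)"
  by (rule reprI[of "{}"]) auto

lemma repr_single: "colors n l y \<Longrightarrow> repr n l (\<lambda>\<phi>. c * \<phi> y)"
  by (rule reprI[of "{y}" _ _ _ "\<lambda>_. c"]) auto

lemma repr_add:
  assumes "repr n l S" "repr n l T"
  shows "repr n l (\<lambda>\<phi>. S \<phi> + T \<phi>)"
proof -
  obtain Y M where Y: "finite Y" "\<forall>y\<in>Y. colors n l y" "\<forall>\<phi>. S \<phi> = (\<Sum>y\<in>Y. M y * \<phi> y)"
    using assms(1) unfolding repr_def by blast
  obtain X N where X: "finite X" "\<forall>y\<in>X. colors n l y" "\<forall>\<phi>. T \<phi> = (\<Sum>y\<in>X. N y * \<phi> y)"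
    using assms(2) unfolding repr_def by blast
  let ?M = "\<lambda>y. (if y \<in> Y then M y else 0) + (if y \<in> X then N y else 0)"
  have "S \<phi> + T \<phi> = (\<Sum>y\<in>Y \<union> X. ?M y * \<phi> y)" for \<phi>
  proof -
    have "S \<phi> = (\<Sum>y\<in>Y \<union> X. (if y \<in> Y then M y else 0) * \<phi> y)"
      using Y(3) X(1) Y(1) by (simp, intro sum.mono_neutral_cong_left) auto
    moreover have "T \<phi> = (\<Sum>y\<in>Y \<union> X. (if y \<in> X then N y else 0) * \<phi> y)"
      using X(3) X(1) Y(1) by (simp, intro sum.mono_neutral_cong_left) auto
    ultimately show ?thesis by (simp add: distrib_right sum.distrib)
  qed
  then show ?thesis using X Y by (intro reprI[of "Y \<union> X" _ _ _ ?M]) auto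
qed

lemma repr_scale: "repr n l T \<Longrightarrow> repr n l (\<lambda>\<phi>. c * T \<phi>)"
proof -
  assume "repr n l T"
  then obtain Y M where Y: "finite Y" "\<forall>y\<in>Y. colors n l y" "\<forall>\<phi>. T \<phi> = (\<Sum>y\<in>Y. M y * \<phi> y)"
    unfolding repr_def by blast
  then show ?thesis by (intro reprI[of Y _ _ _ "\<lambda>y. c * M y"]) (auto simp: sum_distrib_left mult.assoc)
qed

lemma repr_sum:
  "finite I \<Longrightarrow> (\<And>i. i \<in> I \<Longrightarrow> repr n l (T i)) \<Longrightarrow> repr n l (\<lambda>\<phi>. \<Sum>i\<in>I. T i \<phi>)"
  by (induction rule: finite_induct) (auto intro: repr_zero repr_add)

lemma repr_compose:
  assumes "repr n l T" "\<And>y. colors n l y \<Longrightarrow> repr n m (S y)"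
  shows "repr n m (\<lambda>\<phi>. T (\<lambda>y. S y \<phi>))"
proof -
  obtain Y M where Y: "finite Y" "\<forall>y\<in>Y. colors n l y" "\<forall>\<phi>. T \<phi> = (\<Sum>y\<in>Y. M y * \<phi> y)"
    using assms(1) unfolding repr_def by blast
  have "repr n m (\<lambda>\<phi>. \<Sum>y\<in>Y. M y * S y \<phi>)"
    using Y assms(2) by (intro repr_sum repr_scale) auto
  then show ?thesis using Y(3) by simp
qed

lemma repr_cong:
  assumes "repr n l T" "\<And>y. colors n l y \<Longrightarrow> \<phi> y = \<psi> y"
  shows "T \<phi> = T \<psi>"
proof -
  obtain Y M where Y: "finite Y" "\<forall>y\<in>Y. colors n l y" "\<forall>\<phi>. T \<phi> = (\<Sum>y\<in>Y. M y * \<phi> y)"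
    using assms(1) unfolding repr_def by blast
  then show ?thesis using assms(2) by (auto intro!: sum.cong)
qed

lemma repr_linear:
  assumes "repr n l T"
  shows "T (\<lambda>y. \<Sum>i\<in>I. c i * \<phi> i y) = (\<Sum>i\<in>I. c i * T (\<phi> i))"
proof -
  obtain Y M where Y: "finite Y" "\<forall>\<phi>. T \<phi> = (\<Sum>y\<in>Y. M y * \<phi> y)"
    using assms(1) unfolding repr_def by blast
  have "T (\<lambda>y. \<Sum>i\<in>I. c i * \<phi> i y) = (\<Sum>y\<in>Y. \<Sum>i\<in>I. c i * (M y * \<phi> i y))"
    unfolding Y(2)[rule_format] by (simp add: sum_distrib_left ac_simps)
  also have "\<dots> = (\<Sum>i\<in>I. c i * T (\<phi> i))"
    unfolding Y(2)[rule_format] by (subst sum.swap) (simp add: sum_distrib_left)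
  finally show ?thesis .
qed

lemma repr_swap:
  assumes "repr n l S" "repr n m T"
  shows "S (\<lambda>x. T (\<lambda>y. \<phi> x y)) = T (\<lambda>y. S (\<lambda>x. \<phi> x y))"
proof -
  obtain Y M where Y: "finite Y" "\<forall>\<phi>. S \<phi> = (\<Sum>y\<in>Y. M y * \<phi> y)"
    using assms(1) unfolding repr_def by blast
  show ?thesis unfolding Y(2)[rule_format] by (rule repr_linear[OF assms(2), symmetric])
qed

lemma repr_piece:
  assumes "colors n (length (piece_dom n g)) x"
  shows "repr n (length (piece_cod n g)) (\<lambda>\<phi>. piece_op n g \<phi> x)"
proof (cases g)
  case (Cap d)
  show ?thesis unfolding Cap piece_op.simps
    by (intro repr_sum repr_single) (auto simp: colors_def)
next
  case (Cup d)
  then show ?thesis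
    using repr_zero repr_single[of n 0 "[]"] by (cases "x ! 0 = x ! 1") (auto simp: colors_def)
next
  case PosX
  with assms obtain a b where x: "x = [a, b]" "colors n 2 [a, b]" "colors n 2 [b, a]"
    by (auto simp: colors_def length_Suc_conv numeral_2_eq_2)
  consider "a < b" | "a = b" | "a > b" by linarith
  then show ?thesis
  proof cases
    case 1
    then show ?thesis using x PosX repr_single[OF x(3)] by (simp add: pos_op_def numeral_2_eq_2)
  next
    case 2
    then show ?thesis using x PosX repr_single[OF x(2), of "q_root_pow (- 1) * q_pow n 1"]
      by (simp add: pos_op_def numeral_2_eq_2 mult.assoc)
  next
    case 3
    then show ?thesis
      using x PosX repr_add[OF repr_single[OF x(3), of "q_root_pow (- 1)"] repr_single[OF x(2), of "q_root_pow (- 1) * q_diff n"]]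
      by (simp add: pos_op_def numeral_2_eq_2 mult.assoc distrib_left)
  qed
next
  case NegX
  with assms obtain a b where x: "x = [a, b]" "colors n 2 [a, b]" "colors n 2 [b, a]"
    by (auto simp: colors_def length_Suc_conv numeral_2_eq_2)
  consider "a < b" | "a = b" | "a > b" by linarith
  then show ?thesis
  proof cases
    case 3
    then show ?thesis using x NegX repr_single[OF x(3)] by (simp add: neg_op_def numeral_2_eq_2)
  next
    case 2
    then show ?thesis using x NegX repr_single[OF x(2), of "q_root_pow 1 * q_pow n (- 1)"]
      by (simp add: neg_op_def numeral_2_eq_2 mult.assoc)
  next
    case 1
    then show ?thesis
      using x NegX repr_add[OF repr_single[OF x(3), of "q_root_pow 1"] repr_single[OF x(2), of "- (q_root_pow 1 * q_diff n)"]]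
      by (simp add: neg_op_def numeral_2_eq_2 mult.assoc right_diff_distrib)
  qed
next
  case Sink
  then show ?thesis
    using repr_zero repr_single[of n 0 "[]"] by (cases "distinct x") (auto simp: colors_def)
next
  case Source
  show ?thesis unfolding Source piece_op.simps
    by (intro repr_scale repr_sum repr_single finite_perms)
       (auto simp: colors_def perms_def dest: distinct_card)
qed

section \<open>Locality of the state sum\<close>

fun dwidth :: "nat \<Rightarrow> nat \<Rightarrow> diagram \<Rightarrow> nat \<Rightarrow> bool" where
  "dwidth n m [] m' \<longleftrightarrow> m = m'"
| "dwidth n m ((k, g) # D) m' \<longleftrightarrow> k + length (piece_dom n g) \<le> m \<and>
     dwidth n (m - length (piece_dom n g) + length (piece_cod n g)) D m'"

lemma dwidth_append: "dwidth n m (D @ E) m' \<longleftrightarrow> (\<exists>l. dwidth n m D l \<and> dwidth n l E m')"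
  by (induction n m D m' rule: dwidth.induct) auto

lemma tangle_dwidth: "tangle n w D w' \<Longrightarrow> dwidth n (length w) D (length w')"
proof (induction D arbitrary: w)
  case (Cons s D)
  obtain k g where s: "s = (k, g)" by (cases s)
  have *: "k \<le> length w" "take (length (piece_dom n g)) (drop k w) = piece_dom n g"
    using Cons.prems s by auto
  have le: "k + length (piece_dom n g) \<le> length w"
    using arg_cong[OF *(2), of length] *(1) by (auto simp: min_def split: if_splits)
  have "dwidth n (length (slice_out n w (k, g))) D (length w')"
    by (rule Cons.IH) (use Cons.prems s in simp)
  moreover have "length (slice_out n w (k, g)) = length w - length (piece_dom n g) + length (piece_cod n g)"
    using le by simp
  ultimately show ?case using le s by simp
qed simp

lemma colors_split:
  assumes "colors n l c" "k + d \<le> l"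
  obtains u x v where "c = u @ x @ v" "length u = k" "colors n d x" "colors n (l - (k + d)) v" "colors n k u"
proof
  show "c = take k c @ take d (drop k c) @ drop d (drop k c)"
    by (simp only: append_take_drop_id)
qed (use assms in \<open>auto simp: colors_def subset_iff dest!: in_set_takeD in_set_dropD\<close>)

lemma repr_amp:
  "dwidth n m D m' \<Longrightarrow> colors n m c \<Longrightarrow> repr n m' (\<lambda>\<phi>. amp n D \<phi> c)"
proof (induction D arbitrary: m c)
  case Nil
  then show ?case using repr_single[of n m' c 1] by simp
next
  case (Cons s D)
  obtain k g where s: "s = (k, g)" by (cases s)
  obtain u x v where c: "c = u @ x @ v" "length u = k" "colors n (length (piece_dom n g)) x"
    "colors n (m - (k + length (piece_dom n g))) v" "colors n k u"
    using colors_split[OF Cons.prems(2), of k "length (piece_dom n g)"] Cons.prems(1) s by auto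
  have D: "dwidth n (m - length (piece_dom n g) + length (piece_cod n g)) D m'"
    using Cons.prems(1)[unfolded s dwidth.simps] by blast
  have "repr n m' (\<lambda>\<phi>. piece_op n g (\<lambda>y. amp n D \<phi> (u @ y @ v)) x)"
  proof (rule repr_compose[OF repr_piece[OF c(3)]])
    fix y assume "colors n (length (piece_cod n g)) y"
    then have "colors n (m - length (piece_dom n g) + length (piece_cod n g)) (u @ y @ v)"
      using c Cons.prems(1) s by (auto simp: colors_def)
    from Cons.IH[OF D this] show "repr n m' (\<lambda>\<phi>. amp n D \<phi> (u @ y @ v))" .
  qed
  moreover have "amp n (s # D) \<phi> c = piece_op n g (\<lambda>y. amp n D \<phi> (u @ y @ v)) x" for \<phi>
    unfolding amp.simps s c(1) using c(2,3) by (intro step_local) (auto simp: colors_def)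
  ultimately show ?case by simp
qed

lemma amp_shift:
  "dwidth n l L l' \<Longrightarrow> colors n l x \<Longrightarrow> length u = k \<Longrightarrow>
     amp n (shift k L) \<phi> (u @ x @ v) = amp n L (\<lambda>y. \<phi> (u @ y @ v)) x"
proof (induction L arbitrary: l x)
  case (Cons s L)
  obtain j g where s: "s = (j, g)" by (cases s)
  obtain a b d where x: "x = a @ b @ d" "length a = j" "colors n (length (piece_dom n g)) b"
    "colors n (l - (j + length (piece_dom n g))) d" "colors n j a"
    using colors_split[OF Cons.prems(2), of j "length (piece_dom n g)"] Cons.prems(1) s by auto
  have L: "dwidth n (l - length (piece_dom n g) + length (piece_cod n g)) L l'"
    using Cons.prems(1)[unfolded s dwidth.simps] by blast
  have lb: "length b = length (piece_dom n g)" using x(3) by (simp add: colors_def)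
  have "amp n (shift k (s # L)) \<phi> (u @ x @ v) =
      step n (k + j, g) (amp n (shift k L) \<phi>) ((u @ a) @ b @ (d @ v))"
    by (simp add: s x(1))
  also have "\<dots> = piece_op n g (\<lambda>y. amp n (shift k L) \<phi> ((u @ a) @ y @ (d @ v))) b"
    using Cons.prems(3) x(2) lb by (intro step_local) auto
  also have "\<dots> = piece_op n g (\<lambda>y. amp n L (\<lambda>y. \<phi> (u @ y @ v)) (a @ y @ d)) b"
  proof (rule repr_cong[OF repr_piece[OF x(3)]])
    fix y assume "colors n (length (piece_cod n g)) y"
    then have "colors n (l - length (piece_dom n g) + length (piece_cod n g)) (a @ y @ d)"
      using x Cons.prems(1) s by (auto simp: colors_def)
    with Cons.IH[OF L this Cons.prems(3)]
    show "amp n (shift k L) \<phi> ((u @ a) @ y @ (d @ v)) = amp n L (\<lambda>y. \<phi> (u @ y @ v)) (a @ y @ d)"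
      by simp
  qed
  also have "\<dots> = step n (j, g) (amp n L (\<lambda>y. \<phi> (u @ y @ v))) (a @ b @ d)"
    using x(2) lb by (intro step_local[symmetric]) auto
  finally show ?case by (simp add: s x(1))
qed simp

text \<open>The part below the place is a common argument of the local operators and the part above
  acts linearly, so a relation between the operators passes to the state sums. The second hypothesis
  extracts from the typing of \<open>shift k L\<close> that the place fits into its line.\<close>

lemma state_sum_local:
  assumes "dwidth n l L l'" "\<And>m m'. dwidth n m (shift k L) m' \<Longrightarrow> k + l \<le> m"
    and "\<And>i. i \<in> I \<Longrightarrow> dwidth n l (R i) l'"
    and "\<And>x \<phi>. colors n l x \<Longrightarrow> amp n L \<phi> x = (\<Sum>i\<in>I. c i * amp n (R i) \<phi> x)"
    and "tangle n [] (T @ shift k L @ U) w"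
  shows "state_sum n (T @ shift k L @ U) = (\<Sum>i\<in>I. c i * state_sum n (T @ shift k (R i) @ U))"
proof -
  define \<phi> where "\<phi> = amp n U vacuum"
  obtain m m' where m: "dwidth n 0 T m" "dwidth n m (shift k L) m'"
    using tangle_dwidth[OF assms(5)] by (auto simp: dwidth_append)
  have r: "repr n m (\<lambda>\<phi>. amp n T \<phi> [])"
    using repr_amp[OF m(1)] by (simp add: colors_def)
  have "amp n (shift k L) \<phi> y = (\<Sum>i\<in>I. c i * amp n (shift k (R i)) \<phi> y)" if col: "colors n m y" for y
  proof -
    obtain u x v where y: "y = u @ x @ v" "length u = k" "colors n l x"
      "colors n (m - (k + l)) v" "colors n k u"
      by (rule colors_split[OF col assms(2)[OF m(2)]])
    have "amp n (shift k L) \<phi> y = amp n L (\<lambda>y. \<phi> (u @ y @ v)) x"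
      using amp_shift[OF assms(1) y(3,2)] y(1) by simp
    also have "\<dots> = (\<Sum>i\<in>I. c i * amp n (R i) (\<lambda>y. \<phi> (u @ y @ v)) x)"
      using assms(4) y(3) by blast
    also have "\<dots> = (\<Sum>i\<in>I. c i * amp n (shift k (R i)) \<phi> y)"
      using amp_shift[OF assms(3) y(3,2)] y(1) by (intro sum.cong) auto
    finally show ?thesis .
  qed
  then have "amp n T (amp n (shift k L) \<phi>) [] =
      amp n T (\<lambda>y. \<Sum>i\<in>I. c i * amp n (shift k (R i)) \<phi> y) []"
    by (intro repr_cong[OF r]) auto
  also have "\<dots> = (\<Sum>i\<in>I. c i * amp n T (amp n (shift k (R i)) \<phi>) [])"
    by (rule repr_linear[OF r])
  finally show ?thesis
    by (simp add: state_sum_def amp_append \<phi>_def)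
qed

lemma state_sum_local_eq:
  assumes "dwidth n l L l'" "\<And>m m'. dwidth n m (shift k L) m' \<Longrightarrow> k + l \<le> m"
    and "dwidth n l R l'"
    and "\<And>x \<phi>. colors n l x \<Longrightarrow> amp n L \<phi> x = c * amp n R \<phi> x"
    and "tangle n [] (T @ shift k L @ U) w"
  shows "state_sum n (T @ shift k L @ U) = c * state_sum n (T @ shift k R @ U)"
  using state_sum_local[of n l L l' k "{()}" "\<lambda>_. R" "\<lambda>_. c" T U w] assms by simp

section \<open>Invariance of the state sum\<close>

lemma colors_cases:
  "colors n 0 x \<longleftrightarrow> x = []"
  "colors n (Suc l) x \<longleftrightarrow> (\<exists>a y. x = a # y \<and> a \<in> {1..n} \<and> colors n l y)"
  by (auto simp: colors_def length_Suc_conv)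

lemma mult_if_zero: "c * (if P then x else 0) = (if P then c * x else (0 :: 'a :: mult_zero))"
  by simp

lemma sum_delta_eq:
  "a \<in> {1..n :: nat} \<Longrightarrow> (\<Sum>b\<in>{1..n}. if a = b then f b else 0) = (f a :: laurent)"
  "a \<in> {1..n :: nat} \<Longrightarrow> (\<Sum>b\<in>{1..n}. if b = a then f b else 0) = (f a :: laurent)"
  by simp_all

lemma step_Suc: "step n (Suc k, g) \<phi> (x # c) = step n (k, g) (\<lambda>y. \<phi> (x # y)) c"
  by simp

lemma step_zero:
  "step n (0, Cap d) \<phi> c = (\<Sum>a\<in>{1..n}. cap_weight n d a * \<phi> (a # a # c))"
  "step n (0, Cup d) \<phi> (a # b # c) = (if a = b then cup_weight n d a * \<phi> c else 0)"
  "step n (0, PosX) \<phi> (a # b # c) = pos_op n a b (\<lambda>x y. \<phi> (x # y # c))"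
  "step n (0, NegX) \<phi> (a # b # c) = neg_op n a b (\<lambda>x y. \<phi> (x # y # c))"
  by (simp_all add: numeral_2_eq_2)

lemmas step_list = step_Suc step_zero numeral_2_eq_2 numeral_3_eq_3

declare step.simps [simp del]

lemma straighten_right_amp:
  assumes "a \<in> {1..n}"
  shows "amp n [(1, Cap (opp d)), (0, Cup d)] \<phi> [a] = \<phi> [a]"
  using assms by (cases d) (simp_all add: mult_if_zero sum_delta_eq q_pow_mult' step_list)

lemma straighten_left_amp:
  assumes "a \<in> {1..n}"
  shows "amp n [(0, Cap d), (1, Cup (opp d))] \<phi> [a] = \<phi> [a]"
  using assms by (cases d) (simp_all add: mult_if_zero sum_delta_eq q_pow_mult' step_list)

lemma root_cancel: "q_root_pow (- 1) * (q_root_pow 1 * x) = x" "q_root_pow 1 * (q_root_pow (- 1) * x) = x"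
  by (simp_all add: mult.assoc[symmetric] q_root_pow_mult q_root_pow_zero)

lemma q_pow_cancel: "q_pow n 1 * (q_pow n (- 1) * x) = x" "q_pow n (- 1) * (q_pow n 1 * x) = x"
  "q_pow n 1 * q_pow n (- 1) = 1" "q_pow n (- 1) * q_pow n 1 = 1"
  by (simp_all add: q_pow_mult q_pow_mult')

lemma R2_ops:
  "pos_op n a b (\<lambda>x y. neg_op n x y f) = f a b"
  "neg_op n a b (\<lambda>x y. pos_op n x y f) = f a b"
  by (simp_all add: pos_op_def neg_op_def q_diff_def algebra_simps root_cancel q_pow_cancel)

lemma skein_ops:
  "q_root_pow 1 * pos_op n a b f = q_root_pow (- 1) * neg_op n a b f + q_diff n * f a b"
  by (simp add: pos_op_def neg_op_def q_diff_def root_cancel) (simp add: algebra_simps)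

text \<open>The Yang-Baxter equation for the R-matrix, checked for each relative order of the three
  labels. Only \<open>p * q = 1\<close> is used about the scalars, hence the abbreviations.\<close>

lemma R3_ops:
  "pos_op n a b (\<lambda>x y. pos_op n y c (\<lambda>z w. pos_op n x z (\<lambda>u v. f u v w))) =
   pos_op n b c (\<lambda>x y. pos_op n a x (\<lambda>z w. pos_op n w y (\<lambda>u v. f z u v)))"
proof -
  define p q Q where "p = q_pow n (- 1)" and "q = q_pow n 1" and "Q = q_root_pow (- 1)"
  have pq: "p * q = 1" "p * (q * x) = x" for x
    by (simp_all add: p_def q_def q_pow_cancel)
  have op: "pos_op n a b f = Q *
     (if a < b then f b a else if a = b then q * f a a else f b a + (q - p) * f a b)" for a b f
    by (simp add: pos_op_def q_diff_def p_def q_def Q_def)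
  show ?thesis
    by (cases rule: linorder_cases[of a b]; cases rule: linorder_cases[of b c];
        cases rule: linorder_cases[of a c]; (linarith | (simp add: op, (simp add: algebra_simps pq)?)))
qed

lemma sum_only:
  assumes "a \<in> {1..n :: nat}" "\<And>b. b \<in> {1..n} \<Longrightarrow> b \<noteq> a \<Longrightarrow> f b = (0 :: laurent)"
  shows "(\<Sum>b\<in>{1..n}. f b) = f a"
  using sum.remove[of "{1..n}" a f] assms by (simp add: sum.neutral)

lemma sum_split3:
  fixes f :: "nat \<Rightarrow> laurent"
  assumes "x \<in> {1..n}"
  shows "(\<Sum>b\<in>{1..n}. f b) = (\<Sum>b\<in>{1..<x}. f b) + f x + (\<Sum>b\<in>{x<..n}. f b)"
proof -
  have "{1..n} = insert x ({1..<x} \<union> {x<..n})" using assms by auto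
  then have "(\<Sum>b\<in>{1..n}. f b) = f x + (\<Sum>b\<in>{1..<x} \<union> {x<..n}. f b)" by simp
  also have "(\<Sum>b\<in>{1..<x} \<union> {x<..n}. f b) = (\<Sum>b\<in>{1..<x}. f b) + (\<Sum>b\<in>{x<..n}. f b)"
    by (rule sum.union_disjoint) auto
  finally show ?thesis by simp
qed


text \<open>
  A crossing of antiparallel strands exchanges two different labels. Equal labels are
  mapped to pairs of equal labels by the following triangular operators.
\<close>

fun diag_left :: "nat \<Rightarrow> piece \<Rightarrow> (nat \<Rightarrow> laurent) \<Rightarrow> nat \<Rightarrow> laurent" where
  "diag_left n PosX f x = q_pow n 1 * f x + q_diff n * (\<Sum>a\<in>{x<..n}. f a)"
| "diag_left n g f x = q_pow n (- 1) * f x - q_diff n * (\<Sum>a\<in>{1..<x}. f a)"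

text \<open>The left turn uses a cap \<open>Up\<close> and a cup \<open>Dn\<close>, both of weight
  1. In the right turn the cap contributes \<open>q^(n+1-2a)\<close> and the cup
  \<open>q^(2x-n-1)\<close>, which explains the factor \<open>q^(2x-2a)\<close>.\<close>

fun diag_right :: "nat \<Rightarrow> piece \<Rightarrow> (nat \<Rightarrow> laurent) \<Rightarrow> nat \<Rightarrow> laurent" where
  "diag_right n PosX f x = q_pow n 1 * f x + q_diff n * (\<Sum>a\<in>{1..<x}. q_pow n (2 * int x - 2 * int a) * f a)"
| "diag_right n g f x = q_pow n (- 1) * f x - q_diff n * (\<Sum>a\<in>{x<..n}. q_pow n (2 * int x - 2 * int a) * f a)"

fun crossing_root :: "piece \<Rightarrow> laurent" where
  "crossing_root PosX = q_root_pow (- 1)"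
| "crossing_root g = q_root_pow 1"

lemma diag_scale:
  "diag_left n g (\<lambda>a. c * f a) x = c * diag_left n g f x"
  "diag_right n g (\<lambda>a. c * f a) x = c * diag_right n g f x"
  by (cases g; simp add: algebra_simps sum_distrib_left)+

text \<open>The cup forces the right label below the crossing to be \<open>y\<close>. If
  \<open>x\<close> and \<open>y\<close> differ, only the cap label \<open>a = y\<close> survives. If
  they agree, \<open>a = x\<close> survives, and through the term with \<open>q - q^(-1)\<close>
  also the labels on one side of \<open>x\<close>.\<close>

lemma turn_left_amp:
  assumes "g = PosX \<or> g = NegX" "x \<in> {1..n}" "y \<in> {1..n}"
  shows "amp n (turn_left g) \<phi> [x, y] =
    crossing_root g * (if x = y then diag_left n g (\<lambda>a. \<phi> [a, a]) x else \<phi> [y, x])"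
proof -
  let ?op = "if g = PosX then pos_op else neg_op"
  have "amp n (turn_left g) \<phi> [x, y] =
      (\<Sum>a\<in>{1..n}. ?op n a x (\<lambda>p r. if r = y then \<phi> [a, p] else 0))"
    using assms(1) by (auto simp: turn_left_def step_list cong: if_cong)
  also have "\<dots> = crossing_root g * (if x = y then diag_left n g (\<lambda>a. \<phi> [a, a]) x else \<phi> [y, x])"
  proof (cases "x = y")
    case True
    then show ?thesis
      unfolding sum_split3[OF assms(2)] using assms(1)
      by (auto simp: pos_op_def neg_op_def distrib_left right_diff_distrib sum_distrib_left sum_negf
          cong: if_cong sum.cong_simp)
  next
    case False
    then show ?thesis
      using assms(1) by (subst sum_only[OF assms(3)]) (auto simp: pos_op_def neg_op_def)
  qed
  finally show ?thesis .
qed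

lemma pos_op_scale: "c * pos_op n a b f = pos_op n a b (\<lambda>x y. c * f x y)"
  by (simp add: pos_op_def algebra_simps)

lemma neg_op_scale: "c * neg_op n a b f = neg_op n a b (\<lambda>x y. c * f x y)"
  by (simp add: neg_op_def algebra_simps)

lemma turn_right_amp:
  assumes "g = PosX \<or> g = NegX" "x \<in> {1..n}" "y \<in> {1..n}"
  shows "amp n (turn_right g) \<phi> [x, y] =
    crossing_root g * (if x = y then diag_right n g (\<lambda>a. \<phi> [a, a]) x else \<phi> [y, x])"
proof -
  let ?op = "if g = PosX then pos_op else neg_op"
  have "amp n (turn_right g) \<phi> [x, y] = (\<Sum>b\<in>{1..n}.
      ?op n y b (\<lambda>r t. if x = r then q_pow n (2 * int x - 2 * int b) * \<phi> [t, b] else 0))"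
    using assms(1)
    by (auto simp: turn_right_def step_list pos_op_scale neg_op_scale mult_if_zero q_pow_mult' cong: if_cong)
  also have "\<dots> = crossing_root g * (if x = y then diag_right n g (\<lambda>a. \<phi> [a, a]) x else \<phi> [y, x])"
  proof (cases "x = y")
    case True
    then show ?thesis
      unfolding sum_split3[OF assms(2)] using assms(1)
      by (auto simp: pos_op_def neg_op_def distrib_left right_diff_distrib sum_distrib_left sum_negf
          cong: if_cong sum.cong_simp)
  next
    case False
    then show ?thesis
      using assms(1) by (subst sum_only[OF assms(2)]) (auto simp: pos_op_def neg_op_def)
  qed
  finally show ?thesis .
qed

lemma above_Suc: "x < n \<Longrightarrow> {x<..n} = insert (Suc x) {Suc x<..n}" for x n :: nat
  by auto

lemma weighted_above:
  "x \<le> n \<Longrightarrow> (\<Sum>b\<in>{x<..n}. q_pow n (2 * int x - 2 * int b) * f b) =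
     (if x < n then q_pow n (- 2) * (f (Suc x) + (\<Sum>b\<in>{Suc x<..n}. q_pow n (2 * int (Suc x) - 2 * int b) * f b)) else 0)"
  by (simp add: above_Suc sum_distrib_left distrib_left q_pow_mult')

lemma weighted_below:
  "1 \<le> x \<Longrightarrow> (\<Sum>b\<in>{1..<Suc x}. q_pow n (2 * int (Suc x) - 2 * int b) * f b) =
     q_pow n 2 * (f x + (\<Sum>b\<in>{1..<x}. q_pow n (2 * int x - 2 * int b) * f b))"
  by (simp add: atLeastLessThanSuc sum_distrib_left distrib_left q_pow_mult')
     (simp add: algebra_simps)

lemma q_pow_two: "q_pow n 2 = q_pow n 1 * q_pow n 1" "q_pow n (- 2) = q_pow n (- 1) * q_pow n (- 1)"
  by (simp_all add: q_pow_mult)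

text \<open>\<open>V\<close>, \<open>V'\<close> are the weighted sums above and below
  \<open>x\<close>, and \<open>W\<close>, \<open>W'\<close> the plain ones. These identities cancel
  the off-diagonal terms when a triangular operator is composed with its inverse. All sums obey
  one-step recurrences, so the induction starts at the end where they are empty.\<close>

lemma triangular_inverse:
  fixes f :: "nat \<Rightarrow> laurent" and n :: nat
  defines "V \<equiv> \<lambda>x f. \<Sum>b\<in>{x<..n}. q_pow n (2 * int x - 2 * int b) * f b"
    and "V' \<equiv> \<lambda>x f. \<Sum>b\<in>{1..<x}. q_pow n (2 * int x - 2 * int b) * f b"
    and "W \<equiv> \<lambda>x f. \<Sum>b\<in>{x<..n}. f b" and "W' \<equiv> \<lambda>x f. \<Sum>b\<in>{1..<x}. f b"
  shows "x \<le> n \<Longrightarrow> W x (\<lambda>a. q_pow n (- 1) * f a - q_diff n * V a f) = q_pow n 1 * V x f"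
    and "1 \<le> x \<Longrightarrow> W' x (\<lambda>a. q_pow n 1 * f a + q_diff n * V' a f) = q_pow n (- 1) * V' x f"
    and "1 \<le> x \<Longrightarrow> V' x (\<lambda>a. q_pow n (- 1) * f a - q_diff n * W' a f) = q_pow n 1 * W' x f"
    and "x \<le> n \<Longrightarrow> V x (\<lambda>a. q_pow n 1 * f a + q_diff n * W a f) = q_pow n (- 1) * W x f"
proof -
  have V: "V n f = 0" "x < n \<Longrightarrow> V x f = q_pow n (- 2) * (f (Suc x) + V (Suc x) f)" for x f
    unfolding V_def using weighted_above[of x n f] by auto
  have V': "V' 1 f = 0" "1 \<le> x \<Longrightarrow> V' (Suc x) f = q_pow n 2 * (f x + V' x f)" for x f
    unfolding V'_def using weighted_below[of x n f] by auto
  have W: "W n f = 0" "x < n \<Longrightarrow> W x f = f (Suc x) + W (Suc x) f" for x f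
    unfolding W_def by (auto simp: above_Suc)
  have W': "W' 1 f = 0" "1 \<le> x \<Longrightarrow> W' (Suc x) f = f x + W' x f" for x f
    unfolding W'_def by (auto simp: atLeastLessThanSuc)
  show "x \<le> n \<Longrightarrow> W x (\<lambda>a. q_pow n (- 1) * f a - q_diff n * V a f) = q_pow n 1 * V x f"
    by (induction rule: inc_induct) (simp_all add: V W q_pow_two q_diff_def algebra_simps q_pow_cancel)
  show "x \<le> n \<Longrightarrow> V x (\<lambda>a. q_pow n 1 * f a + q_diff n * W a f) = q_pow n (- 1) * W x f"
    by (induction rule: inc_induct) (simp_all add: V W q_pow_two q_diff_def algebra_simps q_pow_cancel)
  show "1 \<le> x \<Longrightarrow> W' x (\<lambda>a. q_pow n 1 * f a + q_diff n * V' a f) = q_pow n (- 1) * V' x f"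
    by (induction rule: dec_induct) (simp_all add: V' W' q_pow_two q_diff_def algebra_simps q_pow_cancel del: One_nat_def)
  show "1 \<le> x \<Longrightarrow> V' x (\<lambda>a. q_pow n (- 1) * f a - q_diff n * W' a f) = q_pow n 1 * W' x f"
    by (induction rule: dec_induct) (simp_all add: V' W' q_pow_two q_diff_def algebra_simps q_pow_cancel del: One_nat_def)
qed

lemma diag_cong:
  "x \<in> {1..n} \<Longrightarrow> (\<And>a. a \<in> {1..n} \<Longrightarrow> f a = f' a) \<Longrightarrow> diag_left n g f x = diag_left n g f' x"
  "x \<in> {1..n} \<Longrightarrow> (\<And>a. a \<in> {1..n} \<Longrightarrow> f a = f' a) \<Longrightarrow> diag_right n g f x = diag_right n g f' x"
  by (cases g; force intro!: sum.cong arg_cong2[of _ _ _ _ "(+)"] arg_cong2[of _ _ _ _ "(-)"] arg_cong[of _ _ "\<lambda>t. _ * t"])+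

lemma antiparallel_amp:
  assumes "(g, h) = (PosX, NegX) \<or> (g, h) = (NegX, PosX)" "x \<in> {1..n}" "y \<in> {1..n}"
  shows "amp n (turn_left g @ turn_right h) \<phi> [x, y] = \<phi> [x, y]"
    and "amp n (turn_right g @ turn_left h) \<phi> [x, y] = \<phi> [x, y]"
proof -
  have xn: "x \<le> n" "1 \<le> x" using assms by auto
  note tri = triangular_inverse(1)[OF xn(1)] triangular_inverse(2)[OF xn(2)]
    triangular_inverse(3)[OF xn(2)] triangular_inverse(4)[OF xn(1)]
  have inverse: "diag_left n g (diag_right n h f) x = f x" "diag_right n g (diag_left n h f) x = f x" for f
    using assms(1)
    by (auto simp: tri simp del: One_nat_def) (simp_all add: algebra_simps q_pow_cancel)
  have root: "crossing_root g * (crossing_root h * c) = c" for c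
    using assms(1) by (auto simp: mult.assoc[symmetric] q_root_pow_mult q_root_pow_zero)
  have gh: "g = PosX \<or> g = NegX" "h = PosX \<or> h = NegX" using assms(1) by auto
  have "diag_left n g (\<lambda>a. amp n (turn_right h) \<phi> [a, a]) x =
      diag_left n g (\<lambda>a. crossing_root h * diag_right n h (\<lambda>a. \<phi> [a, a]) a) x"
    by (rule diag_cong) (use assms(2) in \<open>simp_all add: turn_right_amp[OF gh(2)]\<close>)
  then show "amp n (turn_left g @ turn_right h) \<phi> [x, y] = \<phi> [x, y]"
    using assms(2,3) turn_right_amp[OF gh(2)]
    by (cases "y = x") (simp_all add: amp_append turn_left_amp[OF gh(1)] root diag_scale inverse)
  have "diag_right n g (\<lambda>a. amp n (turn_left h) \<phi> [a, a]) x =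
      diag_right n g (\<lambda>a. crossing_root h * diag_left n h (\<lambda>a. \<phi> [a, a]) a) x"
    by (rule diag_cong) (use assms(2) in \<open>simp_all add: turn_left_amp[OF gh(2)]\<close>)
  then show "amp n (turn_right g @ turn_left h) \<phi> [x, y] = \<phi> [x, y]"
    using assms(2,3) turn_left_amp[OF gh(2)]
    by (cases "y = x") (simp_all add: amp_append turn_right_amp[OF gh(1)] root diag_scale inverse)
qed

lemma turn_crossing_amp:
  assumes "g = PosX \<or> g = NegX"
  shows "amp n [(2, Cap Dn), (3, Cap Dn), (2, g), (1, Cup Up), (0, Cup Up)] \<phi> [x, y] =
    amp n [(0, Cap Up), (1, Cap Up), (2, g), (3, Cup Dn), (2, Cup Dn)] \<phi> [x, y]"
proof -
  let ?w = "\<lambda>x y a b. q_pow n (2 * (int x + int y - int a - int b))"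
  have e: "q_pow n (int n + 1 - 2 * int a) * (q_pow n (int n + 1 - 2 * int b) * (q_pow n (2 * int y - int n - 1) *
      (q_pow n (2 * int x - int n - 1) * c))) = ?w x y a b * c" for a b c and x y :: nat
    unfolding q_pow_mult' by (simp add: algebra_simps)
  let ?h = "\<lambda>a b p r. if p = y \<and> r = x then \<phi> [b, a] else 0"
  let ?op = "if g = PosX then pos_op else neg_op"
  \<comment> \<open>A crossing preserves the pair of labels, so \<open>a + b = x + y\<close>
    wherever \<open>?h\<close> is nonzero, and the collected weight of caps and cups is
    \<open>q^0\<close>.\<close>
  have w: "?op n a b (\<lambda>p r. ?w x y a b * ?h a b p r) = ?op n a b (?h a b)" for a b
    using assms by (auto simp: pos_op_def neg_op_def)
  have "amp n [(2, Cap Dn), (3, Cap Dn), (2, g), (1, Cup Up), (0, Cup Up)] \<phi> [x, y] =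
      (\<Sum>a\<in>{1..n}. \<Sum>b\<in>{1..n}. ?op n a b (\<lambda>p r. ?w x y a b * ?h a b p r))"
    using assms
    by (auto simp add: step_list sum_distrib_left pos_op_scale neg_op_scale mult_if_zero e
        intro!: sum.cong arg_cong[of _ _ "pos_op n _ _"] arg_cong[of _ _ "neg_op n _ _"] ext cong: if_cong)
  also have "\<dots> = (\<Sum>a\<in>{1..n}. \<Sum>b\<in>{1..n}. ?op n a b (?h a b))"
    unfolding w ..
  also have "\<dots> = (\<Sum>b\<in>{1..n}. \<Sum>a\<in>{1..n}. ?op n a b (?h a b))"
    by (rule sum.swap)
  also have "\<dots> = amp n [(0, Cap Up), (1, Cap Up), (2, g), (3, Cup Dn), (2, Cup Dn)] \<phi> [x, y]"
    using assms
    by (auto simp add: step_list intro!: sum.cong arg_cong[of _ _ "pos_op n _ _"] arg_cong[of _ _ "neg_op n _ _"] ext cong: if_cong)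
  finally show ?thesis .
qed

section \<open>Curls and circles\<close>

lemma telescope_below:
  "1 \<le> x \<Longrightarrow> q_diff n * (\<Sum>a\<in>{1..<x}. q_pow n (int n + 1 - 2 * int a)) = q_pow n (int n) - q_pow n (int n + 2 - 2 * int x)"
  "1 \<le> x \<Longrightarrow> q_diff n * (\<Sum>a\<in>{1..<x}. q_pow n (2 * int a - int n - 1)) = q_pow n (2 * int x - 2 - int n) - q_pow n (- int n)"
  by (induction rule: dec_induct)
    (simp_all add: distrib_left q_diff_def left_diff_distrib q_pow_mult algebra_simps del: One_nat_def)

lemma telescope_above:
  "x \<le> n \<Longrightarrow> q_diff n * (\<Sum>a\<in>{x<..n}. q_pow n (int n + 1 - 2 * int a)) = q_pow n (int n - 2 * int x) - q_pow n (- int n)"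
  "x \<le> n \<Longrightarrow> q_diff n * (\<Sum>a\<in>{x<..n}. q_pow n (2 * int a - int n - 1)) = q_pow n (int n) - q_pow n (2 * int x - int n)"
  by (induction rule: inc_induct)
    (simp_all add: above_Suc distrib_left q_diff_def left_diff_distrib q_pow_mult algebra_simps)

text \<open>The off-diagonal terms telescope to a difference whose second term depends on
  \<open>x\<close>; the diagonal term cancels it, and \<open>q^n\<close> or \<open>q^(-n)\<close>
  remains for every label. In powers of \<open>q^(1/n)\<close>, the exponent
  \<open>n * n - 1\<close> stands for \<open>n - 1/n\<close>.\<close>

lemma curl_amp:
  assumes "x \<in> {1..n}"
  shows "amp n (curl_right PosX) \<phi> [x] = q_root_pow (int n * int n - 1) * \<phi> [x]"
    and "amp n (curl_left PosX) \<phi> [x] = q_root_pow (int n * int n - 1) * \<phi> [x]"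
    and "amp n (curl_right NegX) \<phi> [x] = q_root_pow (1 - int n * int n) * \<phi> [x]"
    and "amp n (curl_left NegX) \<phi> [x] = q_root_pow (1 - int n * int n) * \<phi> [x]"
proof -
  have xn: "1 \<le> x" "x \<le> n" using assms by auto
  have p: "q_root_pow (int n * int n - 1) = q_root_pow (- 1) * q_pow n (int n)"
    "q_root_pow (1 - int n * int n) = q_root_pow 1 * q_pow n (- int n)"
    by (simp_all add: q_pow_def q_root_pow_mult)
  have r: "amp n (curl_right PosX) \<phi> [x] = (\<Sum>a\<in>{1..n}. q_pow n (int n + 1 - 2 * int a) *
      pos_op n x a (\<lambda>p r. if r = a then \<phi> [p] else 0))"
    "amp n (curl_right NegX) \<phi> [x] = (\<Sum>a\<in>{1..n}. q_pow n (int n + 1 - 2 * int a) *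
      neg_op n x a (\<lambda>p r. if r = a then \<phi> [p] else 0))"
    by (simp_all add: curl_right_def step_list cong: if_cong)
  have l: "amp n (curl_left PosX) \<phi> [x] = (\<Sum>a\<in>{1..n}.
      pos_op n a x (\<lambda>p r. if a = p then q_pow n (2 * int a - int n - 1) * \<phi> [r] else 0))"
    "amp n (curl_left NegX) \<phi> [x] = (\<Sum>a\<in>{1..n}.
      neg_op n a x (\<lambda>p r. if a = p then q_pow n (2 * int a - int n - 1) * \<phi> [r] else 0))"
    by (simp_all add: curl_left_def step_list cong: if_cong)
  have "amp n (curl_right PosX) \<phi> [x] = q_root_pow (- 1) *
      (q_diff n * (\<Sum>a\<in>{1..<x}. q_pow n (int n + 1 - 2 * int a)) + q_pow n 1 * q_pow n (int n + 1 - 2 * int x)) * \<phi> [x]"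
    unfolding r sum_split3[OF assms]
    by (simp add: pos_op_def distrib_left distrib_right sum_distrib_left sum_distrib_right ac_simps cong: if_cong sum.cong_simp)
  then show "amp n (curl_right PosX) \<phi> [x] = q_root_pow (int n * int n - 1) * \<phi> [x]"
    unfolding telescope_below(1)[OF xn(1)] p by (simp add: q_pow_mult, (simp add: algebra_simps)?)
  have "amp n (curl_left PosX) \<phi> [x] = q_root_pow (- 1) *
      (q_diff n * (\<Sum>a\<in>{x<..n}. q_pow n (2 * int a - int n - 1)) + q_pow n 1 * q_pow n (2 * int x - int n - 1)) * \<phi> [x]"
    unfolding l sum_split3[OF assms]
    by (simp add: pos_op_def distrib_left distrib_right sum_distrib_left sum_distrib_right ac_simps cong: if_cong sum.cong_simp)
  then show "amp n (curl_left PosX) \<phi> [x] = q_root_pow (int n * int n - 1) * \<phi> [x]"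
    unfolding telescope_above(2)[OF xn(2)] p by (simp add: q_pow_mult, (simp add: algebra_simps)?)
  have "amp n (curl_right NegX) \<phi> [x] = q_root_pow 1 *
      (q_pow n (- 1) * q_pow n (int n + 1 - 2 * int x) - q_diff n * (\<Sum>a\<in>{x<..n}. q_pow n (int n + 1 - 2 * int a))) * \<phi> [x]"
    unfolding r sum_split3[OF assms]
    by (simp add: neg_op_def left_diff_distrib right_diff_distrib sum_distrib_left sum_distrib_right sum_negf ac_simps cong: if_cong sum.cong_simp)
  then show "amp n (curl_right NegX) \<phi> [x] = q_root_pow (1 - int n * int n) * \<phi> [x]"
    unfolding telescope_above(1)[OF xn(2)] p by (simp add: q_pow_mult, (simp add: algebra_simps)?)
  have "amp n (curl_left NegX) \<phi> [x] = q_root_pow 1 *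
      (q_pow n (- 1) * q_pow n (2 * int x - int n - 1) - q_diff n * (\<Sum>a\<in>{1..<x}. q_pow n (2 * int a - int n - 1))) * \<phi> [x]"
    unfolding l sum_split3[OF assms]
    by (simp add: neg_op_def left_diff_distrib right_diff_distrib sum_distrib_left sum_distrib_right sum_negf ac_simps cong: if_cong sum.cong_simp)
  then show "amp n (curl_left NegX) \<phi> [x] = q_root_pow (1 - int n * int n) * \<phi> [x]"
    unfolding telescope_below(2)[OF xn(1)] p by (simp add: q_pow_mult, (simp add: algebra_simps)?)
qed

lemma circle_amp: "amp n [(0, Cap d), (0, Cup d)] \<phi> [] = quantum_int n * \<phi> []"
proof -
  have down: "(\<Sum>a\<in>{1..n}. q_pow n (int n + 1 - 2 * int a)) = quantum_int n"
    unfolding quantum_int_def q_pow_def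
    by (rule sum.reindex_bij_witness[of _ Suc "\<lambda>a. a - 1"]) (auto simp: of_nat_diff algebra_simps)
  have up: "(\<Sum>a\<in>{1..n}. q_pow n (2 * int a - int n - 1)) = (\<Sum>a\<in>{1..n}. q_pow n (int n + 1 - 2 * int a))"
    by (rule sum.reindex_bij_witness[of _ "\<lambda>a. n + 1 - a" "\<lambda>a. n + 1 - a"]) (auto simp: of_nat_diff algebra_simps)
  show ?thesis
    using down up by (cases d) (simp_all add: step_list sum_distrib_right[symmetric])
qed

lemma exchange_amp:
  assumes "colors n (j + length (piece_dom n g) + m + length (piece_dom n h)) c"
  shows "amp n [(j, g), (j + length (piece_cod n g) + m, h)] \<phi> c =
     amp n [(j + length (piece_dom n g) + m, h), (j, g)] \<phi> c"
proof -
  have le: "j + length (piece_dom n g) \<le> j + length (piece_dom n g) + m + length (piece_dom n h)"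
    by simp
  obtain u x v where c: "c = u @ x @ v" "length u = j" "colors n (length (piece_dom n g)) x"
    "colors n (j + length (piece_dom n g) + m + length (piece_dom n h) - (j + length (piece_dom n g))) v"
    "colors n j u"
    by (rule colors_split[OF assms le])
  then have cv: "colors n (m + length (piece_dom n h)) v" by simp
  obtain z y v' where v: "v = z @ y @ v'" "length z = m" "colors n (length (piece_dom n h)) y"
    "colors n (m + length (piece_dom n h) - (m + length (piece_dom n h))) v'" "colors n m z"
    by (rule colors_split[OF cv order_refl])
  have c': "c = u @ x @ (z @ y)" using c(1) v(1,4) by (simp add: colors_def)
  have l: "length x = length (piece_dom n g)" "length y = length (piece_dom n h)"
    using c(3) v(3) by (auto simp: colors_def)
  have "amp n [(j, g), (j + length (piece_cod n g) + m, h)] \<phi> c =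
      piece_op n g (\<lambda>x'. step n (j + length (piece_cod n g) + m, h) \<phi> (u @ x' @ z @ y)) x"
    unfolding c' using step_local[OF c(2) l(1)] by simp
  also have "\<dots> = piece_op n g (\<lambda>x'. piece_op n h (\<lambda>y'. \<phi> (u @ x' @ z @ y')) y) x"
  proof (rule repr_cong[OF repr_piece[OF c(3)]])
    fix x' assume "colors n (length (piece_cod n g)) x'"
    then have "length (u @ x' @ z) = j + length (piece_cod n g) + m"
      using c(2) v(2) by (simp add: colors_def)
    from step_local[OF this l(2), of \<phi> "[]"]
    show "step n (j + length (piece_cod n g) + m, h) \<phi> (u @ x' @ z @ y) =
        piece_op n h (\<lambda>y'. \<phi> (u @ x' @ z @ y')) y" by simp
  qed
  also have "\<dots> = piece_op n h (\<lambda>y'. piece_op n g (\<lambda>x'. \<phi> (u @ x' @ z @ y')) x) y"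
    by (rule repr_swap[OF repr_piece[OF c(3)] repr_piece[OF v(3)]])
  also have "\<dots> = piece_op n h (\<lambda>y'. step n (j, g) \<phi> (u @ x @ z @ y')) y"
    using step_local[OF c(2) l(1)] by simp
  also have "\<dots> = amp n [(j + length (piece_dom n g) + m, h), (j, g)] \<phi> c"
    using step_local[of "u @ x @ z" "j + length (piece_dom n g) + m" y n h _ "[]"] c(2) v(2) l
    by (simp add: c')
  finally show ?thesis .
qed

lemma state_sum_invariant:
  assumes "local_move n L R" "link_diagram n (T @ shift k L @ U)"
  shows "state_sum n (T @ shift k L @ U) = state_sum n (T @ shift k R @ U)"
proof -
  have t: "tangle n [] (T @ shift k L @ U) []" and vf: "vertex_free L"
    using assms(2) by (auto simp: link_diagram_iff)
  have main: ?thesis if "dwidth n l L l'" "\<And>m m'. dwidth n m (shift k L) m' \<Longrightarrow> k + l \<le> m"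
    "dwidth n l R l'" "\<And>x \<phi>. colors n l x \<Longrightarrow> amp n L \<phi> x = amp n R \<phi> x" for l l'
    using state_sum_local_eq[of n l L l' k R 1 T U "[]"] that t by simp
  from assms(1) show ?thesis
  proof cases
    case (exchange j g m h)
    show ?thesis
    proof (rule main[of "j + length (piece_dom n g) + m + length (piece_dom n h)"
            "j + length (piece_cod n g) + m + length (piece_cod n h)"])
      fix x \<phi>
      assume "colors n (j + length (piece_dom n g) + m + length (piece_dom n h)) x"
      then show "amp n L \<phi> x = amp n R \<phi> x" unfolding exchange by (rule exchange_amp)
    qed (auto simp: exchange)
  next
    case (straighten_right d)
    show ?thesis
      by (rule main[of 1 1]) (use straighten_right_amp[of _ n d] in \<open>auto simp: straighten_right colors_cases One_nat_def\<close>)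
  next
    case (straighten_left d)
    show ?thesis
      by (rule main[of 1 1]) (use straighten_left_amp[of _ n d] in \<open>auto simp: straighten_left colors_cases One_nat_def\<close>)
  next
    case (turn_crossing g)
    show ?thesis
      by (rule main[of 2 2])
         (use turn_crossing turn_crossing_amp[OF turn_crossing(3)] in \<open>auto simp: colors_cases as_Suc\<close>)
  next
    case (R1 g)
    show ?thesis
      by (rule main[of 1 1]) (use R1 curl_amp in \<open>auto simp: colors_cases curl_left_def curl_right_def\<close>)
  next
    case (R2 g h)
    show ?thesis
      by (rule main[of 2 2]) (use R2 in \<open>auto simp: colors_cases as_Suc step_list R2_ops\<close>)
  next
    case (R2_antiparallel g h)
    show ?thesis
      by (rule main[of 2 2]) (use R2_antiparallel antiparallel_amp(1)[OF R2_antiparallel(3)] in \<open>auto simp: colors_cases as_Suc turn_left_def turn_right_def\<close>)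
  next
    case (R2_antiparallel' g h)
    show ?thesis
      by (rule main[of 2 2]) (use R2_antiparallel' antiparallel_amp(2)[OF R2_antiparallel'(3)] in \<open>auto simp: colors_cases as_Suc turn_left_def turn_right_def\<close>)
  next
    case R3
    show ?thesis
      by (rule main[of 3 3]) (auto simp: R3 colors_cases as_Suc step_list R3_ops)
  \<comment> \<open>The remaining moves turn or slide a disc, which \<open>L\<close> does not
    contain.\<close>
  qed (use vf in auto)
qed

lemma state_sum_link_functional: "link_functional n (state_sum n)"
proof
  fix L R T k U
  assume "local_move n L R" "link_diagram n (T @ shift k L @ U)"
  then show "state_sum n (T @ shift k L @ U) = state_sum n (T @ shift k R @ U)"
    by (rule state_sum_invariant)
next
  fix T k U
  assume *: "link_diagram n (T @ [(k, PosX)] @ U)"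
  have t: "tangle n [] (T @ shift k [(0, PosX)] @ U) []" using * by (simp add: link_diagram_iff)
  \<comment> \<open>The two terms of the skein relation, solved for the positive crossing, are
    indexed by a boolean to fit the sum in \<open>state_sum_local\<close>. Solving costs the
    additional factor \<open>q^(-1/n)\<close> in both coefficients.\<close>
  let ?R = "\<lambda>i :: bool. if i then [(0, NegX)] else []"
  let ?c = "\<lambda>i :: bool. if i then q_root_pow (- 1) * q_root_pow (- 1) else q_root_pow (- 1) * q_diff n"
  have "state_sum n (T @ shift k [(0, PosX)] @ U) =
     (\<Sum>i\<in>UNIV. ?c i * state_sum n (T @ shift k (?R i) @ U))"
  proof (rule state_sum_local[of n 2 _ 2 k _ _ _ _ _ "[]", OF _ _ _ _ t])
    fix x \<phi> assume "colors n 2 x"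
    then obtain a b where x: "x = [a, b]" by (auto simp: colors_cases as_Suc)
    have "q_root_pow (- 1) * (q_root_pow 1 * pos_op n a b (\<lambda>a b. \<phi> [a, b])) =
       q_root_pow (- 1) * (q_root_pow (- 1) * neg_op n a b (\<lambda>a b. \<phi> [a, b]) + q_diff n * \<phi> [a, b])"
      unfolding skein_ops ..
    then show "amp n [(0, PosX)] \<phi> x = (\<Sum>i\<in>UNIV. ?c i * amp n (?R i) \<phi> x)"
      by (simp add: x step_list UNIV_bool root_cancel algebra_simps)
  qed auto
  then have "q_root_pow 1 * state_sum n (T @ [(k, PosX)] @ U) =
      q_root_pow 1 * (q_root_pow (- 1) * (q_root_pow (- 1) * state_sum n (T @ [(k, NegX)] @ U) + q_diff n * state_sum n (T @ U)))"
    by (simp add: UNIV_bool algebra_simps)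
  then show "q_root_pow 1 * state_sum n (T @ [(k, PosX)] @ U) - q_root_pow (- 1) * state_sum n (T @ [(k, NegX)] @ U) =
      (q_root_pow (int n) - q_root_pow (- int n)) * state_sum n (T @ U)"
    by (simp add: root_cancel q_diff_def q_pow_def)
next
  fix T k C U
  assume *: "link_diagram n (T @ shift k C @ U)" "C = curl_right PosX \<or> C = curl_left PosX"
  have "state_sum n (T @ shift k C @ U) = q_root_pow (int n * int n - 1) * state_sum n (T @ shift k [] @ U)"
    by (rule state_sum_local_eq[of n 1 _ 1 k _ _ _ _ "[]"])
       (use * curl_amp in \<open>auto simp: link_diagram_iff colors_cases curl_right_def curl_left_def\<close>)
  then show "state_sum n (T @ shift k C @ U) = q_root_pow (int n * int n - 1) * state_sum n (T @ U)"
    by simp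
next
  fix T k C U
  assume *: "link_diagram n (T @ shift k C @ U)" "C = curl_right NegX \<or> C = curl_left NegX"
  have "state_sum n (T @ shift k C @ U) = q_root_pow (1 - int n * int n) * state_sum n (T @ shift k [] @ U)"
    by (rule state_sum_local_eq[of n 1 _ 1 k _ _ _ _ "[]"])
       (use * curl_amp in \<open>auto simp: link_diagram_iff colors_cases curl_right_def curl_left_def\<close>)
  then show "state_sum n (T @ shift k C @ U) = q_root_pow (1 - int n * int n) * state_sum n (T @ U)"
    by simp
next
  fix T k d U
  assume *: "link_diagram n (T @ [(k, Cap d), (k, Cup d)] @ U)"
  have "state_sum n (T @ shift k [(0, Cap d), (0, Cup d)] @ U) = quantum_int n * state_sum n (T @ shift k [] @ U)"
    by (rule state_sum_local_eq[of n 0 _ 0 k _ _ _ _ "[]"])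
       (use * circle_amp in \<open>auto simp: link_diagram_iff colors_cases\<close>)
  then show "state_sum n (T @ [(k, Cap d), (k, Cup d)] @ U) = quantum_int n * state_sum n (T @ U)"
    by simp
qed

section \<open>The state sum near a sink and a source\<close>

text \<open>The number of inversions gained by writing \<open>x\<close> in front of a
  repetition-free word with letters \<open>A\<close>.\<close>

definition rank :: "nat set \<Rightarrow> nat \<Rightarrow> nat" where
  "rank A x = card {y \<in> A. y < x}"

lemma length_filter_rank: "distinct xs \<Longrightarrow> length (filter (\<lambda>y. y < x) xs) = rank (set xs) x"
  by (simp add: rank_def distinct_length_filter Int_def conj_commute)

lemma invs_perms_Cons: "ys \<in> perms (A - {y}) \<Longrightarrow> finite A \<Longrightarrow> invs (y # ys) = rank A y + invs ys"
  by (auto simp: perms_def length_filter_rank rank_def intro!: arg_cong[of _ _ card])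

lemma sum_perms:
  assumes "finite A" "A \<noteq> {}"
  shows "(\<Sum>ys\<in>perms A. f ys) = (\<Sum>y\<in>A. \<Sum>ys\<in>perms (A - {y}). f (y # ys))"
proof -
  have "perms A = (\<Union>y\<in>A. (#) y ` perms (A - {y}))"
  proof (intro equalityI subsetI)
    fix xs assume "xs \<in> perms A"
    with assms(2) show "xs \<in> (\<Union>y\<in>A. (#) y ` perms (A - {y}))"
      by (cases xs) (auto simp: perms_def)
  next
    fix xs assume "xs \<in> (\<Union>y\<in>A. (#) y ` perms (A - {y}))"
    then obtain y ys where "y \<in> A" "xs = y # ys" "distinct ys" "set ys = A - {y}"
      by (auto simp: perms_def)
    then show "xs \<in> perms A" by (simp add: perms_def insert_absorb)
  qed
  also have "(\<Sum>ys\<in>\<dots>. f ys) = (\<Sum>y\<in>A. \<Sum>ys\<in>(#) y ` perms (A - {y}). f ys)"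
    using assms by (intro sum.UNION_disjoint) (auto simp: finite_perms)
  also have "\<dots> = (\<Sum>y\<in>A. \<Sum>ys\<in>perms (A - {y}). f (y # ys))"
    by (simp add: sum.reindex)
  finally show ?thesis .
qed

lemma sum_rank:
  assumes "finite A"
  shows "(\<Sum>y\<in>A. f (rank A y)) = (\<Sum>i<card A. f i :: laurent)"
  using assms
proof (induction rule: finite_linorder_max_induct)
  case (insert b A)
  have "rank (insert b A) b = card A"
    unfolding rank_def using insert.hyps by (intro arg_cong[of _ _ card]) auto
  moreover have "rank (insert b A) y = rank A y" if "y \<in> A" for y
    unfolding rank_def using insert.hyps that by (intro arg_cong[of _ _ card]) auto
  moreover have "b \<notin> A" using insert.hyps by auto
  ultimately show ?case using insert by simp
qed simp

lemma sum_rank_below: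
  assumes "finite A"
  shows "(\<Sum>y\<in>{y \<in> A. y < x}. f (rank A y)) = (\<Sum>i<rank A x. f i :: laurent)"
proof -
  have "rank A y = rank {y \<in> A. y < x} y" if "y < x" for y
    unfolding rank_def using that by (intro arg_cong[of _ _ card]) auto
  then have "(\<Sum>y\<in>{y \<in> A. y < x}. f (rank A y)) = (\<Sum>y\<in>{y \<in> A. y < x}. f (rank {y \<in> A. y < x} y))"
    by (intro sum.cong) auto
  also have "\<dots> = (\<Sum>i<card {y \<in> A. y < x}. f i)"
    using assms by (intro sum_rank) simp
  finally show ?thesis by (simp add: rank_def)
qed

section \<open>Inserting one strand into an antisymmetrized word\<close>

definition vertex_coeff :: "nat \<Rightarrow> laurent" where
  "vertex_coeff n = - q_root_pow (1 - int n)"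

lemma vertex_coeff_pos_op:
  "vertex_coeff n * pos_op n a b f =
     neg_q_inv n * (if a < b then f b a else if a = b then q_pow n 1 * f a a else f b a + q_diff n * f a b)"
proof -
  have "vertex_coeff n * q_root_pow (- 1) = neg_q_inv n"
    by (simp add: vertex_coeff_def neg_q_inv_def q_pow_def q_root_pow_mult)
  then show ?thesis by (simp add: pos_op_def mult.assoc[symmetric])
qed

lemma neg_q_inv_relations: "neg_q_inv n * q_pow n 1 = - 1" "neg_q_inv n * q_diff n = neg_q_inv n * neg_q_inv n - 1"
  by (simp_all add: neg_q_inv_def q_diff_def q_pow_cancel algebra_simps)

lemma neg_q_inv_cancel: "neg_q_inv n * (q_pow n 1 * x) = - x"
  using neg_q_inv_relations(1)[of n] by (simp add: mult.assoc[symmetric])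

text \<open>For \<open>c = -q^(-1)\<close> one has \<open>c (q - q^(-1)) = c^2 - 1\<close>, so this
  is the geometric sum in \<open>c^2\<close>.\<close>

lemma neg_q_inv_telescope: "1 + neg_q_inv n * q_diff n * (\<Sum>i<p. neg_q_inv n ^ i * neg_q_inv n ^ i) = neg_q_inv n ^ p * neg_q_inv n ^ p"
proof (induction p)
  case (Suc p)
  have "1 + neg_q_inv n * q_diff n * (\<Sum>i<Suc p. neg_q_inv n ^ i * neg_q_inv n ^ i) =
      neg_q_inv n ^ p * neg_q_inv n ^ p + neg_q_inv n * q_diff n * (neg_q_inv n ^ p * neg_q_inv n ^ p)"
    using Suc by (simp add: algebra_simps)
  also have "\<dots> = neg_q_inv n ^ Suc p * neg_q_inv n ^ Suc p"
    unfolding neg_q_inv_relations by (simp add: algebra_simps)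
  finally show ?case .
qed simp

text \<open>
  The sum over all ways to move the first strand to the right. The antisymmetrizer on
  \<open>l + 1\<close> strands is the one on the last \<open>l\<close> strands followed by this operator.
\<close>

fun insert_op :: "nat \<Rightarrow> nat \<Rightarrow> (nat list \<Rightarrow> laurent) \<Rightarrow> nat list \<Rightarrow> laurent" where
  "insert_op n 0 \<phi> xs = \<phi> xs"
| "insert_op n (Suc l) \<phi> (x # y # ys) = \<phi> (x # y # ys) +
     vertex_coeff n * pos_op n x y (\<lambda>p r. insert_op n l (\<lambda>zs. \<phi> (p # zs)) (r # ys))"

text \<open>Let \<open>c = -q^(-1)\<close>. When the first letter \<open>y\<close> of the word is
  split off, a crossing leaves \<open>x\<close> to be inserted into the other letters, or
  \<open>y\<close> itself through the term with \<open>q - q^(-1)\<close>. The latter terms,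
  \<open>y < x\<close>, are multiples of \<open>G\<close>, the sum of words that begin with
  \<open>x\<close>; with the uncrossed term they add up to \<open>c^(2 rank) G\<close>. If
  \<open>x\<close> is in \<open>Y\<close>, the letter \<open>y = x\<close> contributes exactly the
  negative of this, because \<open>c q = -1\<close>. Otherwise the plain crossings supply the words
  that begin with the other letters.\<close>

lemma insert_op_antisymmetric:
  assumes "finite Y" "card Y = l"
  shows "(\<Sum>ys\<in>perms Y. neg_q_inv n ^ invs ys * insert_op n l \<phi> (x # ys)) =
    (if x \<in> Y then 0
     else neg_q_inv n ^ rank Y x * (\<Sum>zs\<in>perms (insert x Y). neg_q_inv n ^ invs zs * \<phi> zs))"
  using assms
proof (induction l arbitrary: Y x \<phi>)
  case 0
  then have "Y = {}" by simp
  moreover have "perms {} = {[]}" "perms {x} = {[x]}"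
  proof -
    show "perms {} = {[]}" by (auto simp: perms_def)
    have "xs = [x]" if "distinct xs" "set xs = {x}" for xs
      using that by (cases xs; cases "tl xs") auto
    then show "perms {x} = {[x]}" by (auto simp: perms_def)
  qed
  ultimately show ?case by (simp add: rank_def)
next
  case (Suc l)
  let ?c = "neg_q_inv n"
  have ne: "Y \<noteq> {}" and fin: "finite Y" using Suc.prems by auto
  have card: "card (Y - {y}) = l" if "y \<in> Y" for y using Suc.prems that by simp
  define G where "G = (\<Sum>ys\<in>perms Y. ?c ^ invs ys * \<phi> (x # ys))"
  define H where "H y = (\<Sum>zs\<in>perms (insert x (Y - {y})). ?c ^ invs zs * \<phi> (y # zs))" for y
  define E where "E y r p = (\<Sum>ys\<in>perms (Y - {y}). ?c ^ invs ys * insert_op n l (\<lambda>zs. \<phi> (p # zs)) (r # ys))" for y r p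
  have E: "E y r p = (if r \<in> Y - {y} then 0 else
      ?c ^ rank (Y - {y}) r * (\<Sum>zs\<in>perms (insert r (Y - {y})). ?c ^ invs zs * \<phi> (p # zs)))"
    if "y \<in> Y" for y r p
    unfolding E_def using Suc.IH[of "Y - {y}" "\<lambda>zs. \<phi> (p # zs)" r] fin card[OF that] by simp
  have rank_remove: "rank (Y - {y}) y = rank Y y" for y
    unfolding rank_def by (intro arg_cong[of _ _ card]) auto
  have E1: "E y y p = ?c ^ rank Y y * (\<Sum>zs\<in>perms Y. ?c ^ invs zs * \<phi> (p # zs))" if "y \<in> Y" for y p
    using E[OF that, of y p] that by (simp add: rank_remove insert_absorb)
  have E2: "E y x y = (if x \<in> Y then 0 else ?c ^ rank (Y - {y}) x * H y)" if "y \<in> Y" "x \<noteq> y" for y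
    using E[OF that(1), of x y] that by (simp add: H_def)
  have G: "G = (\<Sum>y\<in>Y. ?c ^ rank Y y * (\<Sum>ys\<in>perms (Y - {y}). ?c ^ invs ys * \<phi> (x # y # ys)))"
    unfolding G_def sum_perms[OF fin ne]
    by (intro sum.cong refl) (simp add: sum_distrib_left invs_perms_Cons fin power_add mult.assoc del: invs.simps)
  have "(\<Sum>ys\<in>perms Y. ?c ^ invs ys * insert_op n (Suc l) \<phi> (x # ys)) =
      (\<Sum>y\<in>Y. ?c ^ rank Y y * ((\<Sum>ys\<in>perms (Y - {y}). ?c ^ invs ys * \<phi> (x # y # ys)) +
        ?c * (if x < y then E y x y else if x = y then q_pow n 1 * E y x x else E y x y + q_diff n * E y y x)))"
    unfolding sum_perms[OF fin ne]
  proof (intro sum.cong refl)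
    fix y assume y: "y \<in> Y"
    have "(\<Sum>ys\<in>perms (Y - {y}). ?c ^ invs (y # ys) * insert_op n (Suc l) \<phi> (x # y # ys)) =
        ?c ^ rank Y y * (\<Sum>ys\<in>perms (Y - {y}). ?c ^ invs ys * insert_op n (Suc l) \<phi> (x # y # ys))"
      by (simp add: sum_distrib_left invs_perms_Cons fin power_add mult.assoc del: invs.simps insert_op.simps)
    also have "(\<Sum>ys\<in>perms (Y - {y}). ?c ^ invs ys * insert_op n (Suc l) \<phi> (x # y # ys)) =
        (\<Sum>ys\<in>perms (Y - {y}). ?c ^ invs ys * \<phi> (x # y # ys)) +
        ?c * (if x < y then E y x y else if x = y then q_pow n 1 * E y x x else E y x y + q_diff n * E y y x)"
      by (auto simp: vertex_coeff_pos_op E_def distrib_left sum.distrib sum_distrib_left ac_simps)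
    finally show "(\<Sum>ys\<in>perms (Y - {y}). ?c ^ invs (y # ys) * insert_op n (Suc l) \<phi> (x # y # ys)) =
        ?c ^ rank Y y * ((\<Sum>ys\<in>perms (Y - {y}). ?c ^ invs ys * \<phi> (x # y # ys)) +
        ?c * (if x < y then E y x y else if x = y then q_pow n 1 * E y x x else E y x y + q_diff n * E y y x))" .
  qed
  also have "\<dots> = G + (\<Sum>y\<in>Y. ?c ^ rank Y y * (?c *
      (if x < y then E y x y else if x = y then q_pow n 1 * E y x x else E y x y + q_diff n * E y y x)))"
    unfolding G by (simp add: distrib_left sum.distrib)
  also have "(\<Sum>y\<in>Y. ?c ^ rank Y y * (?c *
      (if x < y then E y x y else if x = y then q_pow n 1 * E y x x else E y x y + q_diff n * E y y x))) =
     (\<Sum>y\<in>Y. if y < x then ?c * q_diff n * (?c ^ rank Y y * ?c ^ rank Y y) * G else 0) +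
     (\<Sum>y\<in>Y. if x = y then ?c ^ rank Y y * (?c * (q_pow n 1 * E y x x)) else ?c ^ rank Y y * (?c * E y x y))"
    unfolding sum.distrib[symmetric]
    by (intro sum.cong refl) (auto simp: E1 G_def distrib_left ac_simps)
  also have "(\<Sum>y\<in>Y. if y < x then ?c * q_diff n * (?c ^ rank Y y * ?c ^ rank Y y) * G else 0) =
      ?c * q_diff n * (\<Sum>y\<in>{y \<in> Y. y < x}. ?c ^ rank Y y * ?c ^ rank Y y) * G"
    using fin by (simp add: sum.inter_filter[symmetric] sum_distrib_left sum_distrib_right)
  also have "(\<Sum>y\<in>{y \<in> Y. y < x}. ?c ^ rank Y y * ?c ^ rank Y y) = (\<Sum>i<rank Y x. ?c ^ i * ?c ^ i)"
    by (rule sum_rank_below[OF fin, of "\<lambda>i. ?c ^ i * ?c ^ i"])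
  finally have total: "(\<Sum>ys\<in>perms Y. ?c ^ invs ys * insert_op n (Suc l) \<phi> (x # ys)) =
      (1 + ?c * q_diff n * (\<Sum>i<rank Y x. ?c ^ i * ?c ^ i)) * G +
      (\<Sum>y\<in>Y. if x = y then ?c ^ rank Y y * (?c * (q_pow n 1 * E y x x)) else ?c ^ rank Y y * (?c * E y x y))"
    by (simp add: distrib_right)
  show ?case
  proof (cases "x \<in> Y")
    case True
    then have "(\<Sum>y\<in>Y. if x = y then ?c ^ rank Y y * (?c * (q_pow n 1 * E y x x)) else ?c ^ rank Y y * (?c * E y x y)) =
        ?c ^ rank Y x * (?c * (q_pow n 1 * E x x x))"
      using fin by (subst sum.remove[of _ x]) (auto simp: E2 intro!: sum.neutral)
    also have "\<dots> = - (?c ^ rank Y x * ?c ^ rank Y x * G)"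
      using E1[OF True, of x] by (simp add: G_def[symmetric] neg_q_inv_cancel mult.assoc)
    finally show ?thesis using True total unfolding neg_q_inv_telescope by simp
  next
    case False
    have "(\<Sum>y\<in>Y. if x = y then ?c ^ rank Y y * (?c * (q_pow n 1 * E y x x)) else ?c ^ rank Y y * (?c * E y x y)) =
        (\<Sum>y\<in>Y. ?c ^ rank Y x * (?c ^ rank (insert x Y) y * H y))"
    proof (intro sum.cong refl)
      fix y assume y: "y \<in> Y"
      with False have xy: "x \<noteq> y" by auto
      \<comment> \<open>Exactly one of two shifts occurs: deleting \<open>y\<close> lowers the rank
        of \<open>x\<close> if \<open>y < x\<close>, and adding \<open>x\<close> raises the rank of
        \<open>y\<close> if \<open>x < y\<close>.\<close>
      have "rank Y y + Suc (rank (Y - {y}) x) = rank Y x + rank (insert x Y) y"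
      proof (cases "y < x")
        case True
        have "{z \<in> Y. z < x} = insert y {z \<in> Y - {y}. z < x}" using True y by auto
        then have "rank Y x = Suc (rank (Y - {y}) x)" unfolding rank_def using fin by simp
        moreover have "rank (insert x Y) y = rank Y y"
          unfolding rank_def using True by (intro arg_cong[of _ _ card]) auto
        ultimately show ?thesis by simp
      next
        case False
        have "{z \<in> insert x Y. z < y} = insert x {z \<in> Y. z < y}" using False xy by auto
        then have "rank (insert x Y) y = Suc (rank Y y)"
          unfolding rank_def using fin \<open>x \<notin> Y\<close> by simp
        moreover have "rank (Y - {y}) x = rank Y x"
          unfolding rank_def using False by (intro arg_cong[of _ _ card]) auto
        ultimately show ?thesis by simp
      qed
      then have "?c ^ rank Y y * (?c * ?c ^ rank (Y - {y}) x) = ?c ^ rank Y x * ?c ^ rank (insert x Y) y"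
        by (metis power_Suc power_add)
      then show "(if x = y then ?c ^ rank Y y * (?c * (q_pow n 1 * E y x x)) else ?c ^ rank Y y * (?c * E y x y)) =
          ?c ^ rank Y x * (?c ^ rank (insert x Y) y * H y)"
        using xy y \<open>x \<notin> Y\<close> by (simp add: E2 mult.assoc[symmetric])
    qed
    moreover have "(\<Sum>zs\<in>perms (insert x Y). ?c ^ invs zs * \<phi> zs) =
        ?c ^ rank Y x * G + (\<Sum>y\<in>Y. ?c ^ rank (insert x Y) y * H y)"
    proof -
      have rx: "rank (insert x Y) x = rank Y x"
        unfolding rank_def by (intro arg_cong[of _ _ card]) auto
      have "(\<Sum>zs\<in>perms (insert x Y). ?c ^ invs zs * \<phi> zs) =
          (\<Sum>y\<in>insert x Y. ?c ^ rank (insert x Y) y * (\<Sum>zs\<in>perms (insert x Y - {y}). ?c ^ invs zs * \<phi> (y # zs)))"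
        using fin by (subst sum_perms)
          (auto simp: sum_distrib_left invs_perms_Cons power_add mult.assoc simp del: invs.simps intro!: sum.cong)
      also have "\<dots> = ?c ^ rank Y x * G + (\<Sum>y\<in>Y. ?c ^ rank (insert x Y) y * H y)"
      proof -
        have "insert x Y - {y} = insert x (Y - {y})" if "y \<in> Y" for y using that False by auto
        then show ?thesis using False fin by (simp add: rx G_def H_def)
      qed
      finally show ?thesis .
    qed
    ultimately show ?thesis
      using total False unfolding neg_q_inv_telescope by (simp add: distrib_left sum_distrib_left mult.assoc)
  qed
qed

lemma amp_shift_Suc: "amp n (shift (Suc 0) D) \<phi> (p # zs) = amp n D (\<lambda>ys. \<phi> (p # ys)) zs"
proof (induction D arbitrary: zs)
  case (Cons s D)
  obtain k g where s: "s = (k, g)" by (cases s)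
  have "(\<lambda>y. amp n (shift (Suc 0) D) \<phi> (p # y)) = amp n D (\<lambda>ys. \<phi> (p # ys))"
    using Cons.IH by auto
  then show ?case by (simp add: s step_Suc)
qed simp

lemma braid_simps [simp]: "braid [] = []" "braid (k # ks) = (k - 1, PosX) # braid ks"
  "braid (ks @ ls) = braid ks @ braid ls"
  by (simp_all add: braid_def)

lemma braid_Suc: "set ks \<subseteq> {1..<m} \<Longrightarrow> braid (map Suc ks) = shift (Suc 0) (braid ks)"
  by (induction ks) auto

lemma upt_Suc_Suc: "[Suc a..<Suc b] = map Suc [a..<b]"
  by (simp add: map_Suc_upt)

text \<open>The braid \<open>[1..<j]\<close> takes the first strand to place \<open>j\<close> with
  \<open>j - 1\<close> crossings. The recursion of \<open>insert_op\<close> either stops or crosses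
  once more, which enumerates all \<open>j\<close>.\<close>

lemma insert_op_braids:
  "length xs = Suc l \<Longrightarrow> insert_op n l \<phi> xs =
     (\<Sum>j\<in>{1..Suc l}. vertex_coeff n ^ (j - 1) * amp n (braid [1..<j]) \<phi> xs)"
proof (induction l arbitrary: xs \<phi>)
  case (Suc l)
  then obtain x y ys where xs: "xs = x # y # ys" "length ys = l"
    by (metis length_Suc_conv)
  let ?V = "vertex_coeff n"
  have b: "braid [1..<Suc (Suc j)] = (0, PosX) # shift (Suc 0) (braid [1..<Suc j])" for j
  proof -
    have "[1..<Suc (Suc j)] = 1 # map Suc [1..<Suc j]"
      unfolding upt_Suc_Suc[symmetric] by (simp add: upt_conv_Cons)
    then show ?thesis using braid_Suc[of "[1..<Suc j]" "Suc j"] by (simp del: upt_Suc)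
  qed
  have s: "(\<Sum>j\<in>{1..Suc m}. f j) = (\<Sum>j\<le>m. f (Suc j))" for f :: "nat \<Rightarrow> laurent" and m
    by (rule sum.reindex_bij_witness[of _ Suc "\<lambda>j. j - 1"]) auto
  have IH: "insert_op n l \<psi> (r # ys) = (\<Sum>j\<le>l. ?V ^ j * amp n (braid [1..<Suc j]) \<psi> (r # ys))" for \<psi> r
    using Suc.IH[of "r # ys" \<psi>] xs(2) unfolding s by (simp del: upt_Suc)
  have "pos_op n x y (\<lambda>p r. insert_op n l (\<lambda>zs. \<phi> (p # zs)) (r # ys)) =
      pos_op n x y (\<lambda>p r. \<Sum>j\<le>l. ?V ^ j * amp n (braid [1..<Suc j]) (\<lambda>zs. \<phi> (p # zs)) (r # ys))"
    by (simp only: IH)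
  also have "\<dots> = (\<Sum>j\<le>l. ?V ^ j * pos_op n x y (\<lambda>p r. amp n (braid [1..<Suc j]) (\<lambda>zs. \<phi> (p # zs)) (r # ys)))"
    by (simp add: pos_op_def distrib_left sum_distrib_left sum.distrib ac_simps)
  also have "\<dots> = (\<Sum>j\<le>l. ?V ^ j * amp n (braid [1..<Suc (Suc j)]) \<phi> (x # y # ys))"
    unfolding b by (simp add: step_zero amp_shift_Suc)
  finally have "?V * pos_op n x y (\<lambda>p r. insert_op n l (\<lambda>zs. \<phi> (p # zs)) (r # ys)) =
      (\<Sum>j\<le>l. ?V ^ Suc j * amp n (braid [1..<Suc (Suc j)]) \<phi> (x # y # ys))"
    by (simp add: sum_distrib_left mult.assoc)
  then show ?case
    unfolding xs(1) s by (simp add: sum.atMost_Suc_shift del: upt_Suc sum.atMost_Suc)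
qed simp

section \<open>Reduced words by recursion on the number of strands\<close>

text \<open>A permutation is split into the place \<open>\<sigma> 1\<close> of the first strand and
  the permutation of the other strands, whose places are renumbered after \<open>\<sigma> 1\<close>
  has been deleted. \<open>insert_perm\<close> reverses this.\<close>

definition tail_perm :: "nat \<Rightarrow> (nat \<Rightarrow> nat) \<Rightarrow> nat \<Rightarrow> nat" where
  "tail_perm m \<sigma> i = (if i \<in> {1..m} then if \<sigma> (Suc i) < \<sigma> 1 then \<sigma> (Suc i) else \<sigma> (Suc i) - 1 else i)"

definition insert_perm :: "nat \<Rightarrow> nat \<Rightarrow> (nat \<Rightarrow> nat) \<Rightarrow> nat \<Rightarrow> nat" where
  "insert_perm m j \<tau> i = (if i = 1 then j else if i \<in> {2..Suc m} then
     if \<tau> (i - 1) < j then \<tau> (i - 1) else Suc (\<tau> (i - 1)) else i)"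

lemma permutesI:
  assumes "finite A" "inj_on f A" "f ` A \<subseteq> A" "\<And>x. x \<notin> A \<Longrightarrow> f x = x"
  shows "f permutes A"
  using assms endo_inj_surj[OF assms(1,3,2)] by (intro bij_imp_permutes) (auto simp: bij_betw_def)

lemma tail_perm_permutes:
  assumes "\<sigma> permutes {1..Suc m}"
  shows "tail_perm m \<sigma> permutes {1..m}"
proof (rule permutesI)
  have inj: "\<sigma> x = \<sigma> y \<longleftrightarrow> x = y" for x y using permutes_inj[OF assms] by (auto dest: injD)
  have ran: "\<sigma> x \<in> {1..Suc m}" if "x \<in> {1..Suc m}" for x using permutes_in_image[OF assms] that by simp
  have *: "\<sigma> (Suc i) \<noteq> \<sigma> 1" if "i \<in> {1..m}" for i using inj that by simp
  show "inj_on (tail_perm m \<sigma>) {1..m}"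
  proof (rule inj_onI)
    fix x y assume xy: "x \<in> {1..m}" "y \<in> {1..m}" "tail_perm m \<sigma> x = tail_perm m \<sigma> y"
    then have "\<sigma> (Suc x) = \<sigma> (Suc y)"
      using *[OF xy(1)] *[OF xy(2)] by (auto simp: tail_perm_def split: if_splits)
    then show "x = y" using inj by simp
  qed
  show "tail_perm m \<sigma> ` {1..m} \<subseteq> {1..m}"
  proof
    fix z assume "z \<in> tail_perm m \<sigma> ` {1..m}"
    then obtain x where x: "x \<in> {1..m}" "z = tail_perm m \<sigma> x" by auto
    show "z \<in> {1..m}"
      using ran[of 1] ran[of "Suc x"] *[OF x(1)] x by (auto simp: tail_perm_def)
  qed
qed (auto simp: tail_perm_def)

lemma insert_perm_permutes:
  assumes "\<tau> permutes {1..m}" "j \<in> {1..Suc m}"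
  shows "insert_perm m j \<tau> permutes {1..Suc m}"
proof (rule permutesI)
  have inj: "\<tau> x = \<tau> y \<longleftrightarrow> x = y" for x y using permutes_inj[OF assms(1)] by (auto dest: injD)
  have ran: "\<tau> x \<in> {1..m}" if "x \<in> {1..m}" for x using permutes_in_image[OF assms(1)] that by simp
  show "inj_on (insert_perm m j \<tau>) {1..Suc m}"
  proof (rule inj_onI)
    fix x y assume "x \<in> {1..Suc m}" "y \<in> {1..Suc m}" "insert_perm m j \<tau> x = insert_perm m j \<tau> y"
    then show "x = y"
      using inj[of "x - 1" "y - 1"] by (auto simp: insert_perm_def split: if_splits)
  qed
  show "insert_perm m j \<tau> ` {1..Suc m} \<subseteq> {1..Suc m}"
  proof
    fix z assume "z \<in> insert_perm m j \<tau> ` {1..Suc m}"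
    then obtain x where x: "x \<in> {1..Suc m}" "z = insert_perm m j \<tau> x" by auto
    have "x = 1 \<or> x - 1 \<in> {1..m}" using x(1) by auto
    then show "z \<in> {1..Suc m}"
      using ran[of "x - 1"] x assms(2) by (auto simp: insert_perm_def)
  qed
qed (auto simp: insert_perm_def)

lemma tail_insert_perm:
  assumes "\<tau> permutes {1..m}"
  shows "tail_perm m (insert_perm m j \<tau>) = \<tau>"
proof
  fix i show "tail_perm m (insert_perm m j \<tau>) i = \<tau> i"
    using permutes_not_in[OF assms, of i] by (auto simp: tail_perm_def insert_perm_def)
qed

lemma insert_tail_perm:
  assumes "\<sigma> permutes {1..Suc m}"
  shows "insert_perm m (\<sigma> 1) (tail_perm m \<sigma>) = \<sigma>"
proof
  fix i
  have inj: "\<sigma> x = \<sigma> y \<longleftrightarrow> x = y" for x y using permutes_inj[OF assms] by (auto dest: injD)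
  show "insert_perm m (\<sigma> 1) (tail_perm m \<sigma>) i = \<sigma> i"
    using permutes_not_in[OF assms, of i] inj[of i 1]
    by (cases i) (auto simp: tail_perm_def insert_perm_def)
qed

lemma sum_permutes_Suc:
  "(\<Sum>\<sigma> | \<sigma> permutes {1..Suc m}. f \<sigma>) =
     (\<Sum>j\<in>{1..Suc m}. \<Sum>\<tau> | \<tau> permutes {1..m}. f (insert_perm m j \<tau>) :: laurent)"
  unfolding sum.cartesian_product
proof (rule sum.reindex_bij_witness[of _ "\<lambda>(j, \<tau>). insert_perm m j \<tau>" "\<lambda>\<sigma>. (\<sigma> 1, tail_perm m \<sigma>)"])
  fix \<sigma> :: "nat \<Rightarrow> nat" assume "\<sigma> \<in> {\<sigma>. \<sigma> permutes {1..Suc m}}"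
  then have \<sigma>: "\<sigma> permutes {1..Suc m}" by simp
  show "(\<sigma> 1, tail_perm m \<sigma>) \<in> {1..Suc m} \<times> {\<tau>. \<tau> permutes {1..m}}"
    using tail_perm_permutes[OF \<sigma>] permutes_in_image[OF \<sigma>, of 1] by simp
qed (auto simp: insert_tail_perm tail_insert_perm insert_perm_permutes insert_perm_def[of _ _ _ 1]
    simp del: One_nat_def)

text \<open>The other strands are permuted among themselves, and below that the first strand crosses
  the \<open>\<sigma> 1 - 1\<close> strands that end to the left of it. This choice of a reduced
  word matches the recursion of the antisymmetrizer.\<close>

fun reduced_word :: "nat \<Rightarrow> (nat \<Rightarrow> nat) \<Rightarrow> nat list" where
  "reduced_word 0 \<sigma> = []"
| "reduced_word (Suc m) \<sigma> = map Suc (reduced_word m (tail_perm m \<sigma>)) @ [1..<\<sigma> 1]"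

abbreviation act :: "nat list \<Rightarrow> nat \<Rightarrow> nat" where
  "act ks \<equiv> fold (\<lambda>k. Transposition.transpose k (Suc k)) ks"

lemma act_upt:
  "1 \<le> j \<Longrightarrow> act [1..<j] i = (if i = 1 then j else if 1 < i \<and> i \<le> j then i - 1 else i)"
  by (induction rule: dec_induct) (auto simp: Transposition.transpose_def)

lemma act_map_Suc: "act (map Suc ks) (Suc i) = Suc (act ks i)"
proof (induction ks arbitrary: i)
  case (Cons k ks)
  have "Transposition.transpose (Suc k) (Suc (Suc k)) (Suc i) = Suc (Transposition.transpose k (Suc k) i)"
    by (auto simp: Transposition.transpose_def)
  then show ?case using Cons.IH by simp
qed simp

lemma act_fixes: "0 \<notin> set ks \<Longrightarrow> act ks 0 = 0"
  by (induction ks) (auto simp: Transposition.transpose_def)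

lemma invs_conv_card: "invs xs = card {(i, j). i < j \<and> j < length xs \<and> xs ! i > xs ! j}"
proof (induction xs)
  case (Cons x xs)
  let ?A = "{(i, j). i < j \<and> j < length xs \<and> xs ! i > xs ! j}"
  have "{(i, j). i < j \<and> j < length (x # xs) \<and> (x # xs) ! i > (x # xs) ! j} =
      (\<lambda>j. (0, Suc j)) ` {j. j < length xs \<and> xs ! j < x} \<union> map_prod Suc Suc ` ?A" (is "?L = ?R")
  proof (rule set_eqI, clarify)
    fix i j show "(i, j) \<in> ?L \<longleftrightarrow> (i, j) \<in> ?R"
      by (cases i; cases j) (auto simp: image_iff)
  qed
  moreover have "finite ?A"
    by (rule finite_subset[of _ "{..<length xs} \<times> {..<length xs}"]) auto
  ultimately have "card ?L = card ((\<lambda>j. (0 :: nat, Suc j)) ` {j. j < length xs \<and> xs ! j < x}) + card (map_prod Suc Suc ` ?A)"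
    by (simp, intro card_Un_disjoint) auto
  also have "\<dots> = card {j. j < length xs \<and> xs ! j < x} + card ?A"
    by (simp add: card_image inj_on_def)
  finally show ?case using Cons.IH by (simp add: length_filter_conv_card)
qed simp

lemma inversions_conv_invs: "inversions n \<sigma> = invs (map \<sigma> [1..<Suc n])"
proof -
  have "{(i, j). 1 \<le> i \<and> i < j \<and> j \<le> n \<and> \<sigma> j < \<sigma> i} = map_prod Suc Suc `
      {(i, j). i < j \<and> j < n \<and> \<sigma> (Suc j) < \<sigma> (Suc i)}" (is "?L = ?R")
  proof (rule set_eqI, clarify)
    fix i j show "(i, j) \<in> ?L \<longleftrightarrow> (i, j) \<in> ?R"
      by (cases i; cases j) (auto simp: image_iff)
  qed
  moreover have "{(i, j). i < j \<and> j < length (map \<sigma> [1..<Suc n]) \<and> map \<sigma> [1..<Suc n] ! i > map \<sigma> [1..<Suc n] ! j} =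
     {(i, j). i < j \<and> j < n \<and> \<sigma> (Suc j) < \<sigma> (Suc i)}"
    by (auto simp del: upt_Suc)
  ultimately show ?thesis
    unfolding inversions_def invs_conv_card by (simp add: card_image inj_on_def)
qed

lemma invs_map_mono:
  "(\<And>x y. x \<in> set xs \<Longrightarrow> y \<in> set xs \<Longrightarrow> f x < f y \<longleftrightarrow> x < y) \<Longrightarrow> invs (map f xs) = invs xs"
  by (induction xs) (auto simp: filter_map comp_def intro!: arg_cong[of _ _ length] filter_cong)

text \<open>The first strand is inverted with the \<open>j - 1\<close> strands that end to the left
  of \<open>j\<close>, and the renumbering of the other places is monotone.\<close>

lemma inversions_insert_perm:
  assumes "\<tau> permutes {1..m}" "j \<in> {1..Suc m}"
  shows "inversions (Suc m) (insert_perm m j \<tau>) = (j - 1) + inversions m \<tau>"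
proof -
  let ?f = "\<lambda>t. if t < j then t else Suc t"
  let ?xs = "map \<tau> [1..<Suc m]"
  have "map (insert_perm m j \<tau>) [1..<Suc (Suc m)] = j # map ?f ?xs"
  proof -
    have "[1..<Suc (Suc m)] = 1 # map Suc [1..<Suc m]"
      unfolding upt_Suc_Suc[symmetric] by (simp add: upt_conv_Cons)
    then show ?thesis by (auto simp: insert_perm_def simp del: upt_Suc)
  qed
  then have "inversions (Suc m) (insert_perm m j \<tau>) = length (filter (\<lambda>y. y < j) (map ?f ?xs)) + invs (map ?f ?xs)"
    unfolding inversions_conv_invs by simp
  also have "invs (map ?f ?xs) = inversions m \<tau>"
    unfolding inversions_conv_invs by (rule invs_map_mono) auto
  also have "length (filter (\<lambda>y. y < j) (map ?f ?xs)) = length (filter (\<lambda>y. y < j) ?xs)"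
    by (simp add: filter_map comp_def if_distrib cong: if_cong del: upt_Suc)
  also have "\<dots> = j - 1"
  proof -
    have d: "distinct ?xs"
      using permutes_inj[OF assms(1)] by (simp add: distinct_map inj_on_def inj_def del: upt_Suc)
    have "set ?xs = {1..m}"
      using permutes_image[OF assms(1)] by (simp add: atLeastLessThanSuc_atLeastAtMost del: upt_Suc)
    then have "length (filter (\<lambda>y. y < j) ?xs) = card {y \<in> {1..m}. y < j}"
      using length_filter_rank[OF d] by (simp add: rank_def)
    also have "{y \<in> {1..m}. y < j} = {1..<j}" using assms(2) by auto
    finally show ?thesis by simp
  qed
  finally show ?thesis .
qed

lemma reduced_word_insert_perm:
  "\<tau> permutes {1..m} \<Longrightarrow> reduced_word (Suc m) (insert_perm m j \<tau>) = map Suc (reduced_word m \<tau>) @ [1..<j]"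
  by (simp add: tail_insert_perm) (simp add: insert_perm_def)

lemma reduced_word_positive_braid:
  "\<sigma> permutes {1..m} \<Longrightarrow> positive_braid_word m \<sigma> (reduced_word m \<sigma>)"
proof (induction m arbitrary: \<sigma>)
  case 0
  then show ?case by (simp add: positive_braid_word_def inversions_conv_invs)
next
  case (Suc m)
  define \<tau> j where "\<tau> = tail_perm m \<sigma>" and "j = \<sigma> 1"
  have \<sigma>: "\<sigma> = insert_perm m j \<tau>" using insert_tail_perm[OF Suc.prems] by (simp add: \<tau>_def j_def)
  have \<tau>: "\<tau> permutes {1..m}" unfolding \<tau>_def by (rule tail_perm_permutes[OF Suc.prems])
  have j: "j \<in> {1..Suc m}" unfolding j_def using permutes_in_image[OF Suc.prems, of 1] by simp
  from Suc.IH[OF \<tau>] have IH: "set (reduced_word m \<tau>) \<subseteq> {1..<m}" "length (reduced_word m \<tau>) = inversions m \<tau>"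
    "\<And>i. i \<in> {1..m} \<Longrightarrow> act (reduced_word m \<tau>) i = \<tau> i"
    unfolding positive_braid_word_def by auto
  have word: "reduced_word (Suc m) \<sigma> = map Suc (reduced_word m \<tau>) @ [1..<j]"
    unfolding \<sigma> by (rule reduced_word_insert_perm[OF \<tau>])
  show ?case
    unfolding positive_braid_word_def word
  proof (intro conjI ballI)
    show "set (map Suc (reduced_word m \<tau>) @ [1..<j]) \<subseteq> {1..<Suc m}"
      using IH(1) j by auto
    show "length (map Suc (reduced_word m \<tau>) @ [1..<j]) = inversions (Suc m) \<sigma>"
      unfolding \<sigma> inversions_insert_perm[OF \<tau> j] using IH(2) by simp
    fix i assume i: "i \<in> {1..Suc m}"
    show "act (map Suc (reduced_word m \<tau>) @ [1..<j]) i = \<sigma> i"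
    proof (cases "i = 1")
      case True
      have "act (map Suc (reduced_word m \<tau>)) 1 = 1"
        using act_map_Suc[of "reduced_word m \<tau>" 0] act_fixes[of "reduced_word m \<tau>"] IH(1)
        by (force simp: subset_iff)
      then show ?thesis using True j by (simp add: act_upt \<sigma> insert_perm_def del: One_nat_def)
    next
      case False
      then obtain i' where i': "i = Suc i'" "i' \<in> {1..m}" using i by (cases i) auto
      have "\<tau> i' \<in> {1..m}" using permutes_in_image[OF \<tau>] i'(2) by simp
      moreover have "act (map Suc (reduced_word m \<tau>)) i = Suc (\<tau> i')"
        using act_map_Suc[of "reduced_word m \<tau>" i'] IH(3)[OF i'(2)] i'(1) by simp
      ultimately show ?thesis
        using j i' by (auto simp: act_upt \<sigma> insert_perm_def simp del: One_nat_def)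
    qed
  qed
qed

lemma dwidth_braid: "set ks \<subseteq> {1..<m} \<Longrightarrow> dwidth n m (braid ks) m"
  by (induction ks) (auto simp: Suc_diff_Suc numeral_2_eq_2)

text \<open>On colourings by a fixed set of labels the antisymmetrizer has rank one. Each braid is a
  braid of the last \<open>m\<close> strands with some \<open>[1..<j]\<close> below it, and the sum
  over \<open>j\<close> is \<open>insert_op\<close>. The induction hypothesis antisymmetrizes the
  tail; inserting the first strand then completes the word, or gives 0 if its label is
  repeated.\<close>

lemma antisymmetrizer_amp:
  assumes "colors n m xs"
  shows "(\<Sum>\<sigma> | \<sigma> permutes {1..m}. vertex_coeff n ^ inversions m \<sigma> * amp n (braid (reduced_word m \<sigma>)) \<phi> xs) =
     (if distinct xs then neg_q_inv n ^ invs xs * (\<Sum>ys\<in>perms (set xs). neg_q_inv n ^ invs ys * \<phi> ys) else 0)"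
  using assms
proof (induction m arbitrary: xs \<phi>)
  case 0
  moreover have "perms {} = {[]}" by (auto simp: perms_def)
  ultimately show ?case
    by (simp add: colors_cases inversions_conv_invs)
next
  case (Suc m)
  then obtain x ys where xs: "xs = x # ys" "colors n m ys" and l: "length ys = m"
    by (auto simp: colors_def length_Suc_conv)
  let ?V = "vertex_coeff n"
  have word: "set (reduced_word m \<tau>) \<subseteq> {1..<m}" if "\<tau> permutes {1..m}" for \<tau>
    using reduced_word_positive_braid[OF that] by (simp add: positive_braid_word_def)
  have "(\<Sum>\<sigma> | \<sigma> permutes {1..Suc m}. ?V ^ inversions (Suc m) \<sigma> * amp n (braid (reduced_word (Suc m) \<sigma>)) \<phi> xs) =
      (\<Sum>j\<in>{1..Suc m}. \<Sum>\<tau> | \<tau> permutes {1..m}. ?V ^ inversions m \<tau> *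
         (?V ^ (j - 1) * amp n (braid (reduced_word m \<tau>)) (\<lambda>zs. amp n (braid [1..<j]) \<phi> (x # zs)) ys))"
    unfolding sum_permutes_Suc
  proof (intro sum.cong refl)
    fix j \<tau> assume j: "j \<in> {1..Suc m}" and "\<tau> \<in> {\<tau>. \<tau> permutes {1..m}}"
    then have \<tau>: "\<tau> permutes {1..m}" by simp
    show "?V ^ inversions (Suc m) (insert_perm m j \<tau>) * amp n (braid (reduced_word (Suc m) (insert_perm m j \<tau>))) \<phi> xs =
        ?V ^ inversions m \<tau> * (?V ^ (j - 1) * amp n (braid (reduced_word m \<tau>)) (\<lambda>zs. amp n (braid [1..<j]) \<phi> (x # zs)) ys)"
      unfolding inversions_insert_perm[OF \<tau> j] reduced_word_insert_perm[OF \<tau>] xs(1)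
      by (simp add: amp_append braid_Suc[OF word[OF \<tau>]] amp_shift_Suc power_add ac_simps del: reduced_word.simps)
  qed
  also have "\<dots> = (\<Sum>\<tau> | \<tau> permutes {1..m}. ?V ^ inversions m \<tau> *
      (\<Sum>j\<in>{1..Suc m}. ?V ^ (j - 1) * amp n (braid (reduced_word m \<tau>)) (\<lambda>zs. amp n (braid [1..<j]) \<phi> (x # zs)) ys))"
    by (subst sum.swap) (simp add: sum_distrib_left del: sum.cl_ivl_Suc)
  also have "\<dots> = (\<Sum>\<tau> | \<tau> permutes {1..m}. ?V ^ inversions m \<tau> *
      amp n (braid (reduced_word m \<tau>)) (\<lambda>zs. insert_op n m \<phi> (x # zs)) ys)"
  proof (intro sum.cong refl arg_cong[of _ _ "\<lambda>t. _ * t"])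
    fix \<tau> assume "\<tau> \<in> {\<tau>. \<tau> permutes {1..m}}"
    then have r: "repr n m (\<lambda>\<phi>. amp n (braid (reduced_word m \<tau>)) \<phi> ys)"
      by (intro repr_amp[OF dwidth_braid xs(2)] word) simp
    have "(\<Sum>j\<in>{1..Suc m}. ?V ^ (j - 1) * amp n (braid (reduced_word m \<tau>)) (\<lambda>zs. amp n (braid [1..<j]) \<phi> (x # zs)) ys) =
        amp n (braid (reduced_word m \<tau>)) (\<lambda>zs. \<Sum>j\<in>{1..Suc m}. ?V ^ (j - 1) * amp n (braid [1..<j]) \<phi> (x # zs)) ys"
      by (rule repr_linear[OF r, symmetric])
    also have "\<dots> = amp n (braid (reduced_word m \<tau>)) (\<lambda>zs. insert_op n m \<phi> (x # zs)) ys"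
      by (rule repr_cong[OF r]) (simp add: insert_op_braids colors_def del: sum.cl_ivl_Suc)
    finally show "(\<Sum>j\<in>{1..Suc m}. ?V ^ (j - 1) * amp n (braid (reduced_word m \<tau>)) (\<lambda>zs. amp n (braid [1..<j]) \<phi> (x # zs)) ys) =
      amp n (braid (reduced_word m \<tau>)) (\<lambda>zs. insert_op n m \<phi> (x # zs)) ys" .
  qed
  also have "\<dots> = (if distinct ys then neg_q_inv n ^ invs ys *
      (\<Sum>zs\<in>perms (set ys). neg_q_inv n ^ invs zs * insert_op n m \<phi> (x # zs)) else 0)"
    by (rule Suc.IH[OF xs(2)])
  also have "\<dots> = (if distinct xs then neg_q_inv n ^ invs xs * (\<Sum>ys\<in>perms (set xs). neg_q_inv n ^ invs ys * \<phi> ys) else 0)"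
  proof (cases "distinct ys")
    case True
    then have "card (set ys) = m" using l by (simp add: distinct_card)
    from insert_op_antisymmetric[OF _ this, of n \<phi> x] True show ?thesis
      by (simp add: xs(1) length_filter_rank power_add ac_simps)
  qed (simp add: xs(1))
  finally show ?case .
qed

text \<open>A repetition-free colouring of \<open>n\<close> strands uses all \<open>n\<close>
  labels, so the lower factor of the antisymmetrizer does not depend on the colouring above. The two
  factors are the weights of sink and source.\<close>

lemma sink_source_amp:
  assumes "colors n n xs"
  shows "amp n [(0, Sink), (0, Source)] \<phi> xs =
    (\<Sum>\<sigma> | \<sigma> permutes {1..n}. q_root_pow (int n * (int n * (int n - 1))) *
       vertex_coeff n ^ inversions n \<sigma> * amp n (braid (reduced_word n \<sigma>)) \<phi> xs)"
proof -
  have "set xs = {1..n}" if "distinct xs"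
    using assms distinct_card[OF that] by (intro card_subset_eq) (auto simp: colors_def)
  moreover have "amp n [(0, Sink), (0, Source)] \<phi> xs = (if distinct xs then neg_q_inv n ^ invs xs *
      (q_pow n (int n * (int n - 1)) * (\<Sum>ys\<in>perms {1..n}. neg_q_inv n ^ invs ys * \<phi> ys)) else 0)"
    using assms by (simp add: step.simps colors_def)
  ultimately have "amp n [(0, Sink), (0, Source)] \<phi> xs = q_pow n (int n * (int n - 1)) *
      (if distinct xs then neg_q_inv n ^ invs xs * (\<Sum>ys\<in>perms (set xs). neg_q_inv n ^ invs ys * \<phi> ys) else 0)"
    by (simp add: ac_simps)
  then show ?thesis
    unfolding antisymmetrizer_amp[OF assms, symmetric]
    by (simp add: q_pow_def sum_distrib_left mult.assoc)
qed

lemma state_sum_vertex: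
  assumes "tangle n [] (T @ [(k, Sink), (k, Source)] @ U) w"
  shows "state_sum n (T @ [(k, Sink), (k, Source)] @ U) =
    q_root_pow (int n * (int n * (int n - 1))) *
    (\<Sum>\<sigma> | \<sigma> permutes {1..n}. (- q_root_pow (1 - int n)) ^ inversions n \<sigma> *
       state_sum n (T @ shift k (braid (reduced_word n \<sigma>)) @ U))"
proof -
  have word: "set (reduced_word n \<tau>) \<subseteq> {1..<n}" if "\<tau> permutes {1..n}" for \<tau>
    using reduced_word_positive_braid[OF that] by (simp add: positive_braid_word_def)
  have "state_sum n (T @ shift k [(0, Sink), (0, Source)] @ U) =
    (\<Sum>\<sigma> | \<sigma> permutes {1..n}. q_root_pow (int n * (int n * (int n - 1))) *
       vertex_coeff n ^ inversions n \<sigma> * state_sum n (T @ shift k (braid (reduced_word n \<sigma>)) @ U))"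
  proof (rule state_sum_local[of n n _ n k _ "\<lambda>\<sigma>. braid (reduced_word n \<sigma>)" _ _ _ w])
    fix \<sigma> assume "\<sigma> \<in> {\<sigma>. \<sigma> permutes {1..n}}"
    then show "dwidth n n (braid (reduced_word n \<sigma>)) n" by (intro dwidth_braid word) simp
  next
    fix x \<phi> assume "colors n n x"
    then show "amp n [(0, Sink), (0, Source)] \<phi> x =
      (\<Sum>\<sigma> | \<sigma> permutes {1..n}. q_root_pow (int n * (int n * (int n - 1))) *
       vertex_coeff n ^ inversions n \<sigma> * amp n (braid (reduced_word n \<sigma>)) \<phi> x)"
      by (rule sink_source_amp)
  qed (use assms in auto)
  then show ?thesis
    by (simp add: sum_distrib_left mult.assoc vertex_coeff_def)
qed

section \<open>Positivity\<close>

lemma bracket_link_functional: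
  assumes "web_bracket n B"
  shows "link_functional n B"
proof -
  interpret web_bracket n B by fact
  have web: "web_diagram n D" if "link_diagram n D" for D
    using that by (simp add: link_diagram_def)
  show ?thesis
  proof
    fix L R T k U
    assume "local_move n L R" "link_diagram n (T @ shift k L @ U)" "link_diagram n (T @ shift k R @ U)"
    then have "move n (T @ shift k L @ U) (T @ shift k R @ U)" by (intro move.intros web)
    then show "B (T @ shift k L @ U) = B (T @ shift k R @ U)"
      by (intro invariant) (simp add: isotopic_def r_into_equivclp)
  qed (use web skein positive_curl negative_curl trivial_knot in blast)+
qed

lemma link_functional_diff:
  assumes "link_functional n B" "link_functional n Z"
  shows "link_functional n (\<lambda>D. B D - Z D)"
proof -
  interpret B: link_functional n B by fact
  interpret Z: link_functional n Z by fact
  show ?thesis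
  proof
    fix T k U assume "link_diagram n (T @ [(k, PosX)] @ U)"
    from arg_cong2[OF B.skein[OF this] Z.skein[OF this], of "(-)"]
    show "q_root_pow 1 * (B (T @ [(k, PosX)] @ U) - Z (T @ [(k, PosX)] @ U)) -
        q_root_pow (- 1) * (B (T @ [(k, NegX)] @ U) - Z (T @ [(k, NegX)] @ U)) =
      (q_root_pow (int n) - q_root_pow (- int n)) * (B (T @ U) - Z (T @ U))"
      by (simp only: right_diff_distrib) (simp only: diff_diff_eq2 diff_diff_eq diff_add_eq algebra_simps)
  qed (simp_all add: B.invariant Z.invariant B.positive_curl Z.positive_curl B.negative_curl Z.negative_curl
      B.trivial_knot[simplified] Z.trivial_knot[simplified] right_diff_distrib)
qed

text \<open>Every \<open>X_n\<close> has its source directly below its sink, at the same place. Webs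
  are treated by induction along this predicate, where such a pair is one step; between the two
  discs no statement about signs is required.\<close>

inductive matched :: "diagram \<Rightarrow> bool" where
  Nil: "matched []"
| piece: "matched D \<Longrightarrow> g \<noteq> Sink \<Longrightarrow> g \<noteq> Source \<Longrightarrow> matched ((k, g) # D)"
| pair: "matched D \<Longrightarrow> matched ((k, Sink) # (k, Source) # D)"

lemma matched_append: "vertex_free A \<Longrightarrow> matched D \<Longrightarrow> matched (A @ D)"
  by (induction A rule: vertex_free.induct) (auto intro: matched.intros)

lemma matched_resolution:
  "resolution n D G \<Longrightarrow> vertex_free D \<Longrightarrow> matched G"
proof (induction rule: resolution.induct)
  case (vertices D G g k)
  define A where "A = shift k (map (\<lambda>j. (j, Cap Dn)) [2..<n])"
  define C where "C = shift k (map (\<lambda>j. (j, Cup Dn)) (rev [2..<n]))"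
  have "vertex_free (map (\<lambda>j. (j, Cap Dn)) js)" "vertex_free (map (\<lambda>j. (j, Cup Dn)) js)" for js
    by (induction js) auto
  then have "vertex_free A" "vertex_free C"
    by (simp_all add: A_def C_def)
  moreover have "matched G" using vertices by simp
  ultimately have "matched (A @ (k, Sink) # (k, Source) # C @ G)"
    by (intro matched_append matched.pair)
  then show ?case by (simp add: sink_source_def shift_append A_def C_def)
qed (auto intro: matched.intros)

lemma vertex_free_braid: "vertex_free (braid ks)"
  by (induction ks) auto

lemma tangle_braid:
  "set ks \<subseteq> {1..<n} \<Longrightarrow> tangle n (replicate n Dn) (braid ks) (replicate n Dn)"
proof (induction ks)
  case (Cons k ks)
  then have k: "1 \<le> k" "k < n" by auto
  have "take 2 (drop (k - 1) (replicate n Dn)) = [Dn, Dn]"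
    using k by (simp add: numeral_2_eq_2 Suc_diff_Suc)
  moreover have "take (k - 1) (replicate n Dn) @ [Dn, Dn] @ drop (k - 1 + 2) (replicate n Dn) = replicate n Dn"
  proof -
    have "[Dn, Dn] = replicate 2 Dn" by (simp add: numeral_2_eq_2)
    then show ?thesis using k by (simp add: replicate_add[symmetric] del: replicate.simps)
  qed
  ultimately show ?case using Cons k by (simp add: numeral_2_eq_2)
qed simp

lemma tangle_vertex_pair:
  assumes "tangle n w ((k, Sink) # (k, Source) # D) w'"
  obtains u v where "w = u @ replicate n Dn @ v" "length u = k" "tangle n w D w'"
proof -
  have *: "k \<le> length w" "take n (drop k w) = replicate n Dn"
    using assms by auto
  have w: "w = take k w @ replicate n Dn @ drop (k + n) w"
    using *(2) by (metis append_take_drop_id add.commute drop_drop)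
  have "tangle n (take k w @ replicate n Dn @ drop (k + n) w) D w'"
    using assms * by (simp add: min_def)
  then show thesis using that[of "take k w" "drop (k + n) w"] w * by simp
qed

text \<open>\<open>T\<close> is the part of the diagram in which no disc is left. Resolving the
  topmost pair yields braids that join \<open>T\<close>, so the remaining part \<open>D\<close>
  shrinks until the diagram is a link, where the difference of the two functionals vanishes.\<close>

lemma bracket_eq_state_sum:
  assumes "web_bracket n B" "matched D" "vertex_free T" "web_diagram n (T @ D)"
  shows "B (T @ D) = state_sum n (T @ D)"
  using assms(2-)
proof (induction arbitrary: T rule: matched.induct)
  case Nil
  interpret link_functional n "\<lambda>D. B D - state_sum n D"
    by (intro link_functional_diff bracket_link_functional assms(1) state_sum_link_functional)
  have "B [] - state_sum n [] = 0"
    using web_bracket.empty[OF assms(1)] by (simp add: state_sum_def vacuum_def)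
  then show ?case
    using link_vanishes[of T] Nil by (simp add: link_diagram_iff web_diagram_def)
next
  case (piece D g k)
  then show ?case using piece.IH[of "T @ [(k, g)]"] by simp
next
  case (pair D k)
  interpret web_bracket n B by fact
  have web: "web_diagram n (T @ [(k, Sink), (k, Source)] @ D)" using pair.prems by simp
  \<comment> \<open>The axiom admits any positive braids of minimal length; these are the ones for
    which the state sum has been computed.\<close>
  have braid: "positive_braid_word n \<sigma> (reduced_word n \<sigma>)" if "\<sigma> permutes {1..n}" for \<sigma>
    using that by (rule reduced_word_positive_braid)
  have eq: "B (T @ shift k (braid (reduced_word n \<sigma>)) @ D) =
      state_sum n (T @ shift k (braid (reduced_word n \<sigma>)) @ D)" if "\<sigma> permutes {1..n}" for \<sigma>
  proof -
    obtain w where w: "tangle n [] T w" "tangle n w ((k, Sink) # (k, Source) # D) []"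
      using pair.prems(2) by (auto simp: web_diagram_def tangle_append)
    obtain u v where uv: "w = u @ replicate n Dn @ v" "length u = k" "tangle n w D []"
      by (rule tangle_vertex_pair[OF w(2)])
    have "tangle n w (shift k (braid (reduced_word n \<sigma>))) w"
      using tangle_shift[OF tangle_braid, of "reduced_word n \<sigma>" n u v] braid[OF that] uv
      by (simp add: positive_braid_word_def)
    then have "web_diagram n ((T @ shift k (braid (reduced_word n \<sigma>))) @ D)"
      using w(1) uv(3) by (auto simp: web_diagram_def tangle_append)
    moreover have "vertex_free (T @ shift k (braid (reduced_word n \<sigma>)))"
      using pair.prems(1) by (simp add: vertex_free_braid)
    ultimately show ?thesis
      using pair.IH[of "T @ shift k (braid (reduced_word n \<sigma>))"] by simp
  qed
  have "B (T @ [(k, Sink), (k, Source)] @ D) = q_root_pow (int n * (int n * (int n - 1))) *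
     (\<Sum>\<sigma> | \<sigma> permutes {1..n}. (- q_root_pow (1 - int n)) ^ inversions n \<sigma> *
        B (T @ shift k (braid (reduced_word n \<sigma>)) @ D))"
    by (rule vertex[OF web braid])
  also have "\<dots> = state_sum n (T @ [(k, Sink), (k, Source)] @ D)"
    using web by (simp add: eq state_sum_vertex[simplified] web_diagram_def)
  finally show ?case by simp
qed

text \<open>A list of exponents, with repetitions, is a Laurent polynomial in \<open>q\<close>
  itself with natural coefficients. Integrality of the exponents and non-negativity are thus proved
  together.\<close>

definition power_sum :: "nat \<Rightarrow> laurent \<Rightarrow> bool" where
  "power_sum n p \<longleftrightarrow> (\<exists>es. p = sum_list (map (q_pow n) es))"

lemma power_sum_zero: "power_sum n 0"
  unfolding power_sum_def by (intro exI[of _ "[]"]) simp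

lemma power_sum_one: "power_sum n 1"
  unfolding power_sum_def by (intro exI[of _ "[0]"]) simp

lemma power_sum_add: "power_sum n p \<Longrightarrow> power_sum n q \<Longrightarrow> power_sum n (p + q)"
  unfolding power_sum_def by (auto intro: exI[of _ "_ @ _"])

lemma power_sum_sum: "(\<And>i. i \<in> I \<Longrightarrow> power_sum n (f i)) \<Longrightarrow> power_sum n (\<Sum>i\<in>I. f i)"
  by (induction I rule: infinite_finite_induct) (auto intro: power_sum_zero power_sum_add)

lemma power_sum_qp: "power_sum n p \<Longrightarrow> power_sum n (q_pow n a * p)"
proof -
  assume "power_sum n p"
  then obtain es where "p = sum_list (map (q_pow n) es)" unfolding power_sum_def by blast
  then have "q_pow n a * p = sum_list (map (q_pow n) (map ((+) a) es))"
    by (simp add: sum_list_const_mult[symmetric] q_pow_mult comp_def)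
  then show ?thesis unfolding power_sum_def by blast
qed

lemma power_sum_lookup:
  assumes "power_sum n p"
  shows "\<not> int n dvd k \<Longrightarrow> Poly_Mapping.lookup p k = 0" "0 \<le> Poly_Mapping.lookup p k"
proof -
  obtain es where p: "p = sum_list (map (q_pow n) es)" using assms unfolding power_sum_def by blast
  show "\<not> int n dvd k \<Longrightarrow> Poly_Mapping.lookup p k = 0"
    unfolding p by (induction es) (auto simp: lookup_add q_pow_def q_root_pow_def lookup_single when_def)
  show "0 \<le> Poly_Mapping.lookup p k"
    unfolding p by (induction es) (auto simp: lookup_add q_pow_def q_root_pow_def lookup_single when_def)
qed

section \<open>Inversions of words under local replacement\<close>

definition cross_invs :: "nat list \<Rightarrow> nat list \<Rightarrow> nat" where
  "cross_invs xs ys = sum_list (map (\<lambda>x. length (filter (\<lambda>y. y < x) ys)) xs)"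

lemma invs_append: "invs (xs @ ys) = invs xs + invs ys + cross_invs xs ys"
  by (induction xs) (auto simp: cross_invs_def)

lemma cross_invs_append:
  "cross_invs (xs @ ys) zs = cross_invs xs zs + cross_invs ys zs"
  "cross_invs zs (xs @ ys) = cross_invs zs xs + cross_invs zs ys"
  by (auto simp: cross_invs_def sum_list_addf)

lemma cross_invs_mset:
  assumes "mset xs = mset ys"
  shows "cross_invs xs zs = cross_invs ys zs" "cross_invs zs xs = cross_invs zs ys"
proof -
  show "cross_invs xs zs = cross_invs ys zs"
    unfolding cross_invs_def by (metis assms mset_map sum_mset_sum_list)
  have "length (filter P xs) = length (filter P ys)" for P
    by (metis assms mset_filter size_mset)
  then show "cross_invs zs xs = cross_invs zs ys" by (simp add: cross_invs_def)
qed

text \<open>Inversions between a factor and its surroundings depend only on the multiset of letters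
  in the factor, so only the inner inversions change.\<close>

lemma invs_replace:
  assumes "mset xs = mset ys"
  shows "invs (u @ xs @ v) + invs ys = invs (u @ ys @ v) + invs xs"
  using cross_invs_mset[OF assms] by (simp add: invs_append cross_invs_append)

text \<open>Every other letter is inverted with both of the equal letters or with neither.\<close>

lemma invs_insert_pair: "even (invs (u @ [a, a] @ v)) \<longleftrightarrow> even (invs (u @ v))"
proof -
  have "cross_invs u [a, a] = 2 * cross_invs u [a]"
    by (induction u) (auto simp: cross_invs_def)
  then have "cross_invs u (a # a # v) = 2 * cross_invs u [a] + cross_invs u v"
    using cross_invs_append(2)[of u "[a, a]" v] by simp
  then show ?thesis by (auto simp: invs_append)
qed

lemma minus_one_power_parity:
  "even m \<longleftrightarrow> even l \<Longrightarrow> (- 1) ^ m = ((- 1) ^ l :: laurent)"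
  by (simp add: minus_one_power_iff)

lemma neg_q_inv_power: "neg_q_inv n ^ l = (- 1) ^ l * q_pow n (- int l)"
  by (induction l) (simp_all add: neg_q_inv_def q_pow_mult algebra_simps)

lemma mset_of_bijection:
  "distinct xs \<Longrightarrow> distinct ys \<Longrightarrow> set xs = set ys \<Longrightarrow> mset xs = mset ys"
  by (simp add: set_eq_iff_mset_eq_distinct)

text \<open>The sign of the line above the diagram makes the induction work: a cap or a cup
  preserves it, and a sink with its source changes it by the product of the signs of the two
  weights. Over the empty line it is 1.\<close>

lemma state_sum_positive:
  assumes "matched D" "\<forall>(k, g)\<in>set D. g \<noteq> PosX \<and> g \<noteq> NegX" "dwidth n m D 0" "colors n m c"
  shows "power_sum n ((- 1) ^ invs c * amp n D vacuum c)"
  using assms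
proof (induction arbitrary: m c rule: matched.induct)
  case Nil
  then show ?case by (simp add: colors_def vacuum_def power_sum_one)
next
  case (piece D g k)
  let ?A = "amp n D vacuum"
  have D: "\<forall>(k, g)\<in>set D. g \<noteq> PosX \<and> g \<noteq> NegX" using piece.prems(1) by auto
  have le: "k + length (piece_dom n g) \<le> m"
    and w: "dwidth n (m - length (piece_dom n g) + length (piece_cod n g)) D 0"
    using piece.prems(2)[unfolded dwidth.simps] by blast+
  obtain u x v where c: "c = u @ x @ v" "length u = k" "colors n (length (piece_dom n g)) x"
    "colors n (m - (k + length (piece_dom n g))) v" "colors n k u"
    by (rule colors_split[OF piece.prems(3) le])
  have amp: "amp n ((k, g) # D) vacuum c = piece_op n g (\<lambda>y. ?A (u @ y @ v)) x"
    using c step_local[of u k x n g ?A v] by (simp add: colors_def)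
  have col: "colors n (m - length (piece_dom n g) + length (piece_cod n g)) (u @ y @ v)"
    if "colors n (length (piece_cod n g)) y" for y
    using that c le by (auto simp: colors_def)
  have IH: "power_sum n ((- 1) ^ invs (u @ y @ v) * ?A (u @ y @ v))"
    if "colors n (length (piece_cod n g)) y" for y
    by (rule piece.IH[OF D w col[OF that]])
  show ?case
  proof (cases g)
    case (Cap d)
    have x: "x = []" using c(3) Cap by (simp add: colors_def)
    have eq: "(- 1) ^ invs c * amp n ((k, g) # D) vacuum c =
        (\<Sum>a\<in>{1..n}. cap_weight n d a * ((- 1) ^ invs (u @ [a, a] @ v) * ?A (u @ [a, a] @ v)))"
      unfolding amp unfolding Cap minus_one_power_parity[OF invs_insert_pair]
      by (simp add: c(1) x sum_distrib_left ac_simps)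
    have "power_sum n (cap_weight n d a * ((- 1) ^ invs (u @ [a, a] @ v) * ?A (u @ [a, a] @ v)))"
      if "a \<in> {1..n}" for a
      using IH[of "[a, a]"] that Cap power_sum_qp by (cases d) (auto simp: colors_def)
    then show ?thesis unfolding eq by (rule power_sum_sum)
  next
    case (Cup d)
    then obtain a b where x: "x = [a, b]" using c(3) by (auto simp: colors_def length_Suc_conv)
    show ?thesis
    proof (cases "a = b")
      case True
      have "(- 1) ^ invs c = (- 1 :: laurent) ^ invs (u @ v)"
        unfolding c(1) x True by (rule minus_one_power_parity[OF invs_insert_pair])
      then have "(- 1) ^ invs c * amp n ((k, g) # D) vacuum c =
          cup_weight n d a * ((- 1) ^ invs (u @ v) * ?A (u @ v))"
        unfolding amp unfolding Cup by (simp add: x True ac_simps)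
      then show ?thesis
        using IH[of "[]"] Cup power_sum_qp by (cases d) (auto simp: colors_def)
    next
      case False
      then show ?thesis unfolding amp unfolding Cup by (simp add: x power_sum_zero)
    qed
  qed (use piece in auto)
next
  case (pair D k)
  let ?A = "amp n D vacuum"
  have D: "\<forall>(k, g)\<in>set D. g \<noteq> PosX \<and> g \<noteq> NegX" using pair.prems(1) by auto
  have le: "k + n \<le> m" and w: "dwidth n m D 0"
    using pair.prems(2) by auto
  obtain u x v where c: "c = u @ x @ v" "length u = k" "colors n n x"
    "colors n (m - (k + n)) v" "colors n k u"
    by (rule colors_split[OF pair.prems(3) le])
  have amp: "amp n ((k, Sink) # (k, Source) # D) vacuum c =
      amp n [(0, Sink), (0, Source)] (\<lambda>y. ?A (u @ y @ v)) x"
  proof -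
    have "amp n (shift k [(0, Sink), (0, Source)]) ?A (u @ x @ v) =
        amp n [(0, Sink), (0, Source)] (\<lambda>y. ?A (u @ y @ v)) x"
      by (rule amp_shift[of n n _ n]) (use c in auto)
    then show ?thesis by (simp add: c(1))
  qed
  show ?case
  proof (cases "distinct x")
    case True
    have set: "set x = {1..n}"
      using c(3) distinct_card[OF True] by (intro card_subset_eq) (auto simp: colors_def)
    have "(- 1) ^ invs c * amp n ((k, Sink) # (k, Source) # D) vacuum c =
        (\<Sum>y\<in>perms {1..n}. (- 1) ^ invs c * (neg_q_inv n ^ invs x * (q_pow n (int n * (int n - 1)) *
          (neg_q_inv n ^ invs y * ?A (u @ y @ v)))))"
      unfolding amp using c(3) True
      by (simp add: step.simps colors_def sum_distrib_left)
    also have "\<dots> = (\<Sum>y\<in>perms {1..n}. q_pow n (int n * (int n - 1) - int (invs x) - int (invs y)) *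
        ((- 1) ^ invs (u @ y @ v) * ?A (u @ y @ v)))"
    proof (intro sum.cong refl)
      fix y assume y: "y \<in> perms {1..n}"
      have "mset x = mset y"
        by (rule mset_of_bijection) (use True set y in \<open>auto simp: perms_def\<close>)
      from invs_replace[OF this, of u v]
      have "even (invs c + invs x + invs y) \<longleftrightarrow> even (invs (u @ y @ v))"
        unfolding c(1) by presburger
      \<comment> \<open>The signs of the two discs turn the sign of the line above them into the
        sign of the line below them.\<close>
      then have e: "(- 1) ^ invs c * (- 1) ^ invs x * (- 1) ^ invs y = ((- 1) ^ invs (u @ y @ v) :: laurent)"
        unfolding power_add[symmetric] by (rule minus_one_power_parity)
      have "(- 1) ^ invs c * (neg_q_inv n ^ invs x * (q_pow n (int n * (int n - 1)) * (neg_q_inv n ^ invs y * ?A (u @ y @ v)))) =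
         (q_pow n (- int (invs x)) * (q_pow n (int n * (int n - 1)) * q_pow n (- int (invs y)))) *
         ((- 1) ^ invs c * (- 1) ^ invs x * (- 1) ^ invs y * ?A (u @ y @ v))"
        unfolding neg_q_inv_power by (simp only: ac_simps)
      then show "(- 1) ^ invs c * (neg_q_inv n ^ invs x * (q_pow n (int n * (int n - 1)) * (neg_q_inv n ^ invs y * ?A (u @ y @ v)))) =
        q_pow n (int n * (int n - 1) - int (invs x) - int (invs y)) * ((- 1) ^ invs (u @ y @ v) * ?A (u @ y @ v))"
        unfolding e by (simp add: q_pow_mult algebra_simps)
    qed
    finally show ?thesis
    proof (simp only:, intro power_sum_sum power_sum_qp pair.IH[OF D w])
      fix y assume "y \<in> perms {1..n}"
      then show "colors n m (u @ y @ v)"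
        using c le distinct_card[of y] by (auto simp: colors_def perms_def)
    qed
  next
    case False
    then show ?thesis
      unfolding amp using c(3) by (simp add: step.simps colors_def power_sum_zero)
  qed
qed

section \<open>Parity\<close>

lemma level_Suc: "i < length D \<Longrightarrow> level n D (Suc i) = slice_out n (level n D i) (D ! i)"
  by (simp add: level_def take_Suc_conv_app_nth)

lemma level_append: "tangle n [] (T @ D) w' \<Longrightarrow> tangle n (level n (T @ D) (length T)) D w'"
proof -
  have *: "tangle n w A w'' \<Longrightarrow> fold (\<lambda>s w. slice_out n w s) A w = w''" for w A w''
    by (induction A arbitrary: w) auto
  assume "tangle n [] (T @ D) w'"
  then obtain w where w: "tangle n [] T w" "tangle n w D w'" by (auto simp: tangle_append)
  have "level n (T @ D) (length T) = w" using *[OF w(1)] by (simp add: level_def)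
  with w(2) show ?thesis by simp
qed

lemma slice_joins_joined:
  "i < length D \<Longrightarrow> (p, q) \<in> slice_joins n (length (level n D i)) i (D ! i) \<Longrightarrow> (p, q) \<in> joined n D"
  unfolding joined_def by blast

lemma edge_of_joined:
  assumes "(p, q) \<in> joined n D"
  shows "edge_of n D p = edge_of n D q"
proof -
  let ?R = "joined n D \<union> (joined n D)\<inverse>"
  have "sym ?R" by (auto simp: sym_def)
  then have s: "sym (?R\<^sup>*)" by (rule sym_rtrancl)
  have pq: "(p, q) \<in> ?R\<^sup>*" using assms by auto
  then have "(q, p) \<in> ?R\<^sup>*" using s by (auto dest: symD)
  with pq show ?thesis unfolding edge_of_def by (auto intro: rtrancl_trans)
qed

definition coloring :: "nat \<Rightarrow> diagram \<Rightarrow> ((nat \<times> nat) set \<Rightarrow> nat) \<Rightarrow> nat \<Rightarrow> nat list" where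
  "coloring n D S i = map (\<lambda>j. S (edge_of n D (i, j))) [0..<length (level n D i)]"

text \<open>A vertical strand beside the piece is joined to its continuation, so it lies on the same
  edge and has the same label on both lines. Only the factor at the piece changes.\<close>

lemma coloring_slice:
  fixes S :: "(nat \<times> nat) set \<Rightarrow> nat" and n i k :: nat and D :: diagram and g :: piece
  assumes "i < length D" "D ! i = (k, g)" "k + length (piece_dom n g) \<le> length (level n D i)"
  defines "x \<equiv> map (\<lambda>j. S (edge_of n D (i, k + j))) [0..<length (piece_dom n g)]"
    and "y \<equiv> map (\<lambda>j. S (edge_of n D (Suc i, k + j))) [0..<length (piece_cod n g)]"
  obtains u v where "coloring n D S i = u @ x @ v" "coloring n D S (Suc i) = u @ y @ v" "length u = k"
proof -
  define u where "u = map (\<lambda>j. S (edge_of n D (i, j))) [0..<k]"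
  define r where "r = length (level n D i) - (k + length (piece_dom n g))"
  define v where "v = map (\<lambda>j. S (edge_of n D (i, k + length (piece_dom n g) + j))) [0..<r]"
  have len: "length (level n D i) = k + (length (piece_dom n g) + r)"
    using assms(3) by (simp add: r_def)
  have len': "length (level n D (Suc i)) = k + (length (piece_cod n g) + r)"
    unfolding level_Suc[OF assms(1)] assms(2) using len by simp
  have shift: "[a..<a + l] = map ((+) a) [0..<l]" for a l :: nat
    by (induction l) auto
  have split: "map f [0..<k + (l + r)] = map f [0..<k] @ map (\<lambda>j. f (k + j)) [0..<l] @ map (\<lambda>j. f (k + l + j)) [0..<r]"
    for f :: "nat \<Rightarrow> nat" and l
  proof -
    have "[0..<k + (l + r)] = [0..<k] @ [k..<k + l] @ [k + l..<k + l + r]"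
      by (metis add.assoc le_add1 upt_add_eq_append zero_le)
    then show ?thesis by (simp add: shift comp_def)
  qed
  have join: "(p, q) \<in> joined n D" if "(p, q) \<in> slice_joins n (length (level n D i)) i (k, g)" for p q
    using slice_joins_joined[OF assms(1), unfolded assms(2)] that by blast
  have left: "edge_of n D (i, j) = edge_of n D (Suc i, j)" if "j < k" for j
    by (rule edge_of_joined[OF join]) (use that in auto)
  have right: "edge_of n D (i, k + length (piece_dom n g) + j) = edge_of n D (Suc i, k + length (piece_cod n g) + j)"
    if "j < r" for j
    by (rule edge_of_joined[OF join]) (use that len in auto)
  have 1: "coloring n D S i = u @ x @ v"
    unfolding coloring_def len split u_def x_def v_def ..
  have 2: "coloring n D S (Suc i) = u @ y @ v"
    unfolding coloring_def len' split u_def y_def v_def using left right by simp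
  have "length u = k" by (simp add: u_def)
  with 1 2 show thesis by (rule that)
qed

text \<open>The extension by zero lets sums run over intervals of slices, from which the topmost
  slice can be split off.\<close>

definition vertex_inversions :: "nat \<Rightarrow> diagram \<Rightarrow> ((nat \<times> nat) set \<Rightarrow> nat) \<Rightarrow> nat \<Rightarrow> nat" where
  "vertex_inversions n D S i = (if i \<in> vertices D then inversions n (vertex_perm n D S i) else 0)"

lemma slice_ok_length:
  "slice_ok n w (k, g) \<Longrightarrow> k + length (piece_dom n g) \<le> length w"
  by (auto simp: min_def dest!: arg_cong[where f = length] split: if_splits)

text \<open>The bands of a disc are numbered from left to right starting at 1, so
  \<open>P(S, v)\<close> is the word read on the line above a sink or below a source. Its
  \<open>n\<close> letters are distinct elements of \<open>{1..n}\<close>, hence all of them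
  occur.\<close>

lemma vertex_colors:
  fixes S :: "(nat \<times> nat) set \<Rightarrow> nat" and n v :: nat and D :: diagram
  assumes "v \<in> vertices D" "state n D S"
    and "\<And>j. j < n \<Longrightarrow> (if snd (D ! v) = Sink then v else Suc v, fst (D ! v) + j) \<in> points n D"
  defines "x \<equiv> map (\<lambda>j. S (edge_of n D (if snd (D ! v) = Sink then v else Suc v, fst (D ! v) + j))) [0..<n]"
  shows "distinct x" "set x = {1..n}" "inversions n (vertex_perm n D S v) = invs x"
proof -
  have x: "x = map (\<lambda>i. S (band n D v i)) [1..<Suc n]"
  proof -
    have "[1..<Suc n] = map Suc [0..<n]" by (simp add: map_Suc_upt)
    then show ?thesis by (simp add: x_def band_def band_end_def comp_def del: upt_Suc)
  qed
  have "inj_on (\<lambda>i. S (band n D v i)) {1..n}" using assms(1,2) by (auto simp: state_def)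
  then show d: "distinct x"
    unfolding x by (simp add: distinct_map atLeastLessThanSuc_atLeastAtMost del: upt_Suc)
  have "S (edge_of n D p) \<in> {1..n}" if "p \<in> points n D" for p
    using assms(2) that by (auto simp: state_def edges_def)
  then have "set x \<subseteq> {1..n}" using assms(3) by (auto simp: x_def)
  then show "set x = {1..n}"
    using distinct_card[OF d] by (intro card_subset_eq) (auto simp: x_def)
  have "map (vertex_perm n D S v) [1..<Suc n] = x"
    unfolding x by (rule map_cong) (auto simp: vertex_perm_def)
  then show "inversions n (vertex_perm n D S v) = invs x"
    by (simp add: inversions_conv_invs del: upt_Suc)
qed

text \<open>The discs below a line have together the parity of the inversions on that line. Edges
  refer to the whole diagram, so the induction keeps \<open>T\<close> above \<open>D\<close> as
  context and moves only the line between them.\<close>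

lemma state_parity:
  assumes "matched D" "\<forall>(k, g)\<in>set D. g \<noteq> PosX \<and> g \<noteq> NegX"
    "web_diagram n (T @ D)" "state n (T @ D) S"
  shows "even ((\<Sum>i\<in>{length T..<length (T @ D)}. vertex_inversions n (T @ D) S i) +
     invs (coloring n (T @ D) S (length T)))"
  using assms
proof (induction arbitrary: T rule: matched.induct)
  case Nil
  have "level n (T @ []) (length T) = []"
    using level_append[of n T "[]" "[]"] Nil by (simp add: web_diagram_def)
  then show ?case by (simp add: coloring_def)
next
  case (piece D g k)
  let ?G = "T @ (k, g) # D" and ?i = "length T"
  have i: "?i < length ?G" "?G ! ?i = (k, g)" by simp_all
  have "slice_ok n (level n ?G ?i) (k, g)"
    using level_append[of n T "(k, g) # D" "[]"] piece.prems(2) by (simp add: web_diagram_def)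
  from slice_ok_length[OF this] obtain u v where uv:
    "coloring n ?G S ?i = u @ map (\<lambda>j. S (edge_of n ?G (?i, k + j))) [0..<length (piece_dom n g)] @ v"
    "coloring n ?G S (Suc ?i) = u @ map (\<lambda>j. S (edge_of n ?G (Suc ?i, k + j))) [0..<length (piece_cod n g)] @ v"
    by (rule coloring_slice[OF i])
  have join: "edge_of n ?G p = edge_of n ?G q"
    if "(p, q) \<in> slice_joins n (length (level n ?G ?i)) ?i (k, g)" for p q
    by (rule edge_of_joined, rule slice_joins_joined[OF i(1)]) (use that i(2) in simp)
  have even: "even (invs (coloring n ?G S ?i)) \<longleftrightarrow> even (invs (coloring n ?G S (Suc ?i)))"
  proof (cases g)
    case (Cap d)
    have "edge_of n ?G (Suc ?i, k) = edge_of n ?G (Suc ?i, Suc k)"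
      by (rule join) (simp add: Cap)
    then show ?thesis
      unfolding uv using invs_insert_pair[of u _ v] Cap by (simp add: upt_rec)
  next
    case (Cup d)
    have "edge_of n ?G (?i, k) = edge_of n ?G (?i, Suc k)"
      by (rule join) (simp add: Cup)
    then show ?thesis
      unfolding uv using invs_insert_pair[of u _ v] Cup by (simp add: upt_rec)
  qed (use piece in auto)
  have "even ((\<Sum>i\<in>{Suc ?i..<length ?G}. vertex_inversions n ?G S i) + invs (coloring n ?G S (Suc ?i)))"
    using piece.IH[of "T @ [(k, g)]"] piece.prems by simp
  moreover have "vertex_inversions n ?G S ?i = 0"
    using piece.hyps i by (simp add: vertex_inversions_def vertices_def)
  ultimately show ?case
    using even by (simp add: sum.atLeast_Suc_lessThan del: sum.op_ivl_Suc)
next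
  case (pair D k)
  let ?G = "T @ (k, Sink) # (k, Source) # D" and ?i = "length T"
  have i: "?i < length ?G" "?G ! ?i = (k, Sink)" "Suc ?i < length ?G" "?G ! Suc ?i = (k, Source)"
    by (simp_all add: nth_append)
  have t: "slice_ok n (level n ?G ?i) (k, Sink)" "slice_ok n (level n ?G (Suc ?i)) (k, Source)"
    using level_append[of n T "(k, Sink) # (k, Source) # D" "[]"] pair.prems(2) level_Suc[OF i(1)] i(2)
    by (simp_all add: web_diagram_def)
  note le = slice_ok_length[OF t(1)] slice_ok_length[OF t(2)]
  define x where "x = map (\<lambda>j. S (edge_of n ?G (?i, k + j))) [0..<n]"
  define y where "y = map (\<lambda>j. S (edge_of n ?G (Suc (Suc ?i), k + j))) [0..<n]"
  obtain u v where uv: "coloring n ?G S ?i = u @ x @ v" "coloring n ?G S (Suc ?i) = u @ v" "length u = k"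
    by (rule coloring_slice[OF i(1,2) le(1), where S = S]) (auto simp: x_def)
  obtain u' v' where uv': "coloring n ?G S (Suc ?i) = u' @ v'" "coloring n ?G S (Suc (Suc ?i)) = u' @ y @ v'" "length u' = k"
    by (rule coloring_slice[OF i(3,4) le(2), where S = S]) (auto simp: y_def)
  \<comment> \<open>Both slices describe the same line between the two discs, and both discs have
    exactly \<open>k\<close> strands to their left.\<close>
  have u': "u' = u" "v' = v" using uv(2,3) uv'(1,3) by auto
  have v: "?i \<in> vertices ?G" "Suc ?i \<in> vertices ?G" using i by (simp_all add: vertices_def)
  have len: "length (level n ?G (Suc (Suc ?i))) = length (level n ?G (Suc ?i)) + n"
    using level_Suc[OF i(3)] i(4) le(2) by simp
  have px: "(?i, k + j) \<in> points n ?G" if "j < n" for j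
    using le(1) that by (simp add: points_def)
  have py: "(Suc (Suc ?i), k + j) \<in> points n ?G" if "j < n" for j
    using le(2) len that by (simp add: points_def)
  have x: "distinct x" "set x = {1..n}" "vertex_inversions n ?G S ?i = invs x"
    using vertex_colors[OF v(1) pair.prems(3)] px i v by (simp_all add: x_def vertex_inversions_def)
  have y: "distinct y" "set y = {1..n}" "vertex_inversions n ?G S (Suc ?i) = invs y"
    using vertex_colors[OF v(2) pair.prems(3)] py i v by (simp_all add: y_def vertex_inversions_def)
  have "invs (u @ x @ v) + invs y = invs (u @ y @ v) + invs x"
    by (rule invs_replace) (use x y in \<open>auto intro: mset_of_bijection\<close>)
  moreover have "even ((\<Sum>i\<in>{Suc (Suc ?i)..<length ?G}. vertex_inversions n ?G S i) + invs (u @ y @ v))"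
    using pair.IH[of "T @ [(k, Sink), (k, Source)]"] pair.prems uv'(2) u' by simp
  moreover have "(\<Sum>i\<in>{?i..<length ?G}. vertex_inversions n ?G S i) =
      invs x + invs y + (\<Sum>i\<in>{Suc (Suc ?i)..<length ?G}. vertex_inversions n ?G S i)"
    using x(3) y(3) by (simp add: sum.atLeast_Suc_lessThan del: sum.op_ivl_Suc)
  ultimately show ?case unfolding uv(1) by presburger
qed

theorem proposition10:
  fixes n :: nat and D \<Gamma> :: diagram
  assumes "2 \<le> n"
    and "link_diagram n D"
    and "resolution n D \<Gamma>"
  shows "(\<forall>S. state n \<Gamma> S \<longrightarrow> even (\<Sum>v\<in>vertices \<Gamma>. inversions n (vertex_perm n \<Gamma> S v))) \<and>
    (\<forall>B. web_bracket n B \<longrightarrow>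
       (\<forall>k. \<not> int n dvd k \<longrightarrow> Poly_Mapping.lookup (B \<Gamma>) k = 0) \<and>
       (\<forall>k. 0 \<le> Poly_Mapping.lookup (B \<Gamma>) k))"
proof -
  have matched: "matched \<Gamma>"
    using matched_resolution[OF assms(3)] assms(2) by (simp add: link_diagram_iff)
  have web: "web_diagram n \<Gamma>" and planar: "\<forall>(k, g)\<in>set \<Gamma>. g \<noteq> PosX \<and> g \<noteq> NegX"
    using planar_web_resolution[OF assms] by (simp_all add: planar_web_def)
  have "even (\<Sum>v\<in>vertices \<Gamma>. inversions n (vertex_perm n \<Gamma> S v))" if "state n \<Gamma> S" for S
  proof -
    have "(\<Sum>v\<in>vertices \<Gamma>. inversions n (vertex_perm n \<Gamma> S v)) =
        (\<Sum>i\<in>{0..<length \<Gamma>}. vertex_inversions n \<Gamma> S i)"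
      by (rule sum.mono_neutral_cong_left) (auto simp: vertices_def vertex_inversions_def)
    \<comment> \<open>No strand meets the line above the first slice, so for \<open>T = []\<close>
      the parity statement is about the sum alone.\<close>
    moreover have "coloring n \<Gamma> S 0 = []" by (simp add: coloring_def level_def)
    ultimately show ?thesis
      using state_parity[OF matched planar, of n "[]" S] web that by simp
  qed
  moreover have "power_sum n (B \<Gamma>)" if "web_bracket n B" for B
  proof -
    have "B \<Gamma> = state_sum n \<Gamma>"
      using bracket_eq_state_sum[OF that matched, of "[]"] web by simp
    moreover have "power_sum n ((- 1) ^ invs [] * state_sum n \<Gamma>)"
      unfolding state_sum_def
      by (rule state_sum_positive[OF matched planar, of n 0])
         (use tangle_dwidth[of n "[]" \<Gamma> "[]"] web in \<open>simp_all add: web_diagram_def colors_def\<close>)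
    ultimately show ?thesis by simp
  qed
  ultimately show ?thesis using power_sum_lookup by blast
qed

end
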